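(* Let $\mu$ be the Möbius function. For every constant $c>0$, as $x\to\infty$ through the integers, $$\frac{1}{x}\sum_{1\leq t\leq x}\ \sum_{1\le n \leq x} \mu(n)\, \mu(n+t) =O\left( \frac{x}{(\log x)^{2c}}\right),$$ where the implied constant depends only on $c$.
   Context: $\mu:\{1,2,3,\dots\}\to\{-1,0,1\}$ is the usual Möbius function: $\mu(n)=(-1)^w$ if $n$ is a product of $w$ distinct primes, and $\mu(n)=0$ otherwise. Here $\mu$ is the ordinary (not periodized) function. *)

theory Defs
  imports
    Complex_Main
    "HOL-Computational_Algebra.Squarefree"
    "HOL-Library.Landau_Symbols"
begin

text \<open>
  The Moebius function. The intended domain is the positive integers; the value at \<open>0\<close>
  is the junk value \<open>0\<close>, since \<open>0\<close> is not squarefree. The two lemmas below recover the usual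
  description by products of distinct primes (the empty product giving the value \<open>1\<close> at \<open>1\<close>).
\<close>

definition moebius_mu :: "nat \<Rightarrow> int" where
  "moebius_mu n = (if squarefree n then (-1) ^ card (prime_factors n) else 0)"

lemma prod_distinct_primes:
  fixes P :: "nat set"
  assumes "finite P" and "\<And>p. p \<in> P \<Longrightarrow> prime p"
  shows "squarefree (\<Prod>P)" and "prime_factors (\<Prod>P) = P"
proof -
  have "prime_factorization (\<Prod>P) = mset_set P"
    using assms prime_factorization_prod_mset_primes[of "mset_set P"]
    by (simp add: prod_unfold_prod_mset)
  moreover have nz: "\<Prod>P \<noteq> 0"
    using assms by (auto dest: prime_gt_0_nat)
  ultimately show "prime_factors (\<Prod>P) = P" "squarefree (\<Prod>P)"
    using assms nz
    by (auto simp: squarefree_factorial_semiring'' count_mset_set'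
        simp flip: count_prime_factorization_prime)
qed

lemma moebius_mu_prod_distinct_primes:
  fixes P :: "nat set"
  assumes "finite P" and "\<And>p. p \<in> P \<Longrightarrow> prime p"
  shows "moebius_mu (\<Prod>P) = (-1) ^ card P"
  using prod_distinct_primes[OF assms] by (simp add: moebius_mu_def)

lemma moebius_mu_eq_0:
  assumes "\<nexists>P. finite P \<and> (\<forall>p\<in>P. prime p) \<and> n = \<Prod>P"
  shows "moebius_mu n = 0"
proof (rule ccontr)
  assume "moebius_mu n \<noteq> 0"
  hence sf: "squarefree n" by (auto simp: moebius_mu_def split: if_splits)
  hence "n > 0" by (cases "n = 0") auto
  have "n = (\<Prod>p\<in>prime_factors n. p ^ multiplicity p n)"
    using prime_factorization_nat[OF \<open>n > 0\<close>] by simp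
  also have "\<dots> = (\<Prod>p\<in>prime_factors n. p ^ 1)"
    using sf \<open>n > 0\<close> squarefree_factorial_semiring'[of n] by (intro prod.cong) auto
  finally have "n = \<Prod>(prime_factors n)" by simp
  thus False using assms by (metis finite_set_mset in_prime_factors_imp_prime)
qed

end

theory Submission
  imports Defs "HOL-Probability.Probability"
begin

text \<open>
  Summing over \<open>t\<close> first turns the correlation sum into \<open>\<Sum>n. \<mu>(n) (M(n + x) - M(n))\<close>, where \<open>M\<close> is
  the summatory function of \<open>\<mu>\<close>, so it suffices that \<open>M(x) = O(x / (ln x)^m)\<close> for every \<open>m\<close>.
  No analytic continuation is needed for this: all estimates take place in \<open>Re s > 1\<close>, uniformly up to
  the boundary. There the series \<open>F\<^sub>k(s) = \<Sum>n. \<mu>(n) (ln n)^k n^(-s)\<close> is bounded by a power of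
  \<open>ln (2 + \<bar>t\<bar>)\<close>: Leibniz' rule for \<open>\<mu> * 1 = \<delta>\<close> expresses \<open>F\<^sub>k\<close> by the lower \<open>F\<^sub>j\<close> and the
  derivatives of \<open>\<zeta>\<close>, and \<open>1 / \<zeta>\<close> is controlled by the 3-4-1 inequality and the mean value
  theorem. Near \<open>s = 1\<close> the pole is avoided by using \<open>(1 - 2 powr (1 - s)) \<zeta>(s)\<close> instead of
  \<open>\<zeta>\<close>. Fourier inversion of the Riesz kernel then gives \<open>\<Sum>n\<le>x. \<mu>(n) (ln n)^k (x - n) = O(x\<^sup>2)\<close>, which beats the trivial bound
  by \<open>(ln x)^k\<close>; differencing in \<open>x\<close> loses half of this gain, and partial summation removes the
  weight \<open>(ln n)^k\<close>.
\<close>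

section \<open>Weighted Dirichlet series\<close>

text \<open>At \<sigma> = 1 + 1 / ln N the factor N^\<sigma> equals e N, so a bound for
  \<open>F\<^sub>k\<close> that is uniform as \<sigma> decreases to 1 can be used on that line at
  the cost of a constant; this is why no contour is moved. Termwise estimation there would only give
  order (ln N)^(k+1), so all of the saving lies in the uniformity in \<sigma>. The growth in t
  merely has to be slower than linear, because the transform 1 / (s (s + 1)) of the Riesz kernel
  decays quadratically. This is the reason for the weight x - n in place of a sharp cutoff. The
  recursion for \<open>F\<^sub>k\<close> divides by the leading series and needs the others bounded.
  At s = 1 the derivatives of \<zeta> blow up, while those of the alternating series stay bounded
  and the series itself stays away from 0. The \<open>F\<^sub>k\<close> are treated purely as
  coefficients of a formal quotient; the only series ever differentiated is \<zeta>, for the mean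
  value step.\<close>

lemma log_power_le_powr:
  fixes e :: real
  assumes "e > 0"
  obtains C where "C \<ge> 1" "\<And>x. x \<ge> 1 \<Longrightarrow> (1 + ln x) ^ k \<le> C * x powr e"
proof
  \<comment> \<open>The exponent is shared among the k factors; k + 1 in the denominator also covers
    k = 0.\<close>
  define a where "a = e / (k + 1)"
  have a: "a > 0" using assms by (simp add: a_def)
  have ak: "a * k \<le> e" using assms by (simp add: a_def field_simps)
  show "(1 + 1 / a) ^ k \<ge> 1" using a by (intro one_le_power) auto
  fix x :: real assume x: "x \<ge> 1"
  have "1 + ln x \<le> x powr a + x powr a / a"
    using ln_powr_bound[OF x a] ge_one_powr_ge_zero[of x a] x a by simp
  also have "\<dots> = (1 + 1 / a) * x powr a" by (simp add: algebra_simps)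
  finally have "(1 + ln x) ^ k \<le> ((1 + 1 / a) * x powr a) ^ k"
    using x by (intro power_mono) auto
  also have "\<dots> = (1 + 1 / a) ^ k * x powr (a * k)"
    using x by (simp add: power_mult_distrib powr_powr flip: powr_realpow)
  also have "\<dots> \<le> (1 + 1 / a) ^ k * x powr e"
    using x a ak by (intro mult_left_mono powr_mono) auto
  finally show "(1 + ln x) ^ k \<le> (1 + 1 / a) ^ k * x powr e" .
qed

definition dterm :: "(nat \<Rightarrow> complex) \<Rightarrow> nat \<Rightarrow> complex \<Rightarrow> nat \<Rightarrow> complex" where
  "dterm f k s n = f n * of_real (ln (real n) ^ k) * of_nat n powr (-s)"

text \<open>
  Up to the sign \<open>(-1)^k\<close>, this is the \<open>k\<close>-th derivative of the Dirichlet series of \<open>f\<close>.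
\<close>

definition dsum :: "(nat \<Rightarrow> complex) \<Rightarrow> nat \<Rightarrow> complex \<Rightarrow> complex" where
  "dsum f k s = infsum (dterm f k s) {0<..}"

text \<open>At n = 0 every number is a divisor and the sum over an infinite set is 0 by default;
  only positive n enter the series.\<close>

definition dconv :: "(nat \<Rightarrow> complex) \<Rightarrow> (nat \<Rightarrow> complex) \<Rightarrow> nat \<Rightarrow> complex" where
  "dconv f g n = (\<Sum>d | d dvd n. f d * g (n div d))"

lemma dterm_0 [simp]: "dterm f k s 0 = 0"
  by (simp add: dterm_def)

lemma norm_dterm: "n > 0 \<Longrightarrow> norm (dterm f k s n) = norm (f n) * ln (real n) ^ k * real n powr (-Re s)"
  by (simp add: dterm_def norm_mult norm_powr_real_powr norm_power)

lemma summable_norm_dterm: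
  assumes "Re s > 1" "\<And>n. norm (f n) \<le> B"
  shows "summable (\<lambda>n. norm (dterm f k s n))"
proof -
  \<comment> \<open>Half of the excess Re s - 1 pays for the logarithms; the other half leaves the
    exponent -(1 + Re s) / 2, which is still below -1.\<close>
  define e where "e = (Re s - 1) / 2"
  have e: "e > 0" using assms by (simp add: e_def)
  obtain C where C: "C \<ge> 1" "\<And>x. x \<ge> 1 \<Longrightarrow> (1 + ln x) ^ k \<le> C * x powr e"
    using log_power_le_powr[OF e] by blast
  have B: "B \<ge> 0" using assms(2)[of 0] norm_ge_zero order_trans by blast
  show ?thesis
  proof (rule summable_comparison_test')
    show "summable (\<lambda>n. B * C * real n powr (e - Re s))"
      using assms by (intro summable_mult) (simp add: summable_real_powr_iff e_def field_simps)
    fix n :: nat assume "n \<ge> 1"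
    hence "norm (dterm f k s n) = norm (f n) * ln (real n) ^ k * real n powr (-Re s)"
      by (simp add: norm_dterm)
    also have "\<dots> \<le> B * (C * real n powr e) * real n powr (-Re s)"
    proof (intro mult_right_mono mult_mono assms B)
      have "ln (real n) ^ k \<le> (1 + ln (real n)) ^ k" using \<open>n \<ge> 1\<close> by (intro power_mono) auto
      thus "ln (real n) ^ k \<le> C * real n powr e" using C(2)[of "real n"] \<open>n \<ge> 1\<close> by simp
    qed (use \<open>n \<ge> 1\<close> in auto)
    also have "\<dots> = B * C * real n powr (e - Re s)"
      by (simp add: powr_diff powr_minus field_simps)
    finally show "norm (norm (dterm f k s n)) \<le> B * C * real n powr (e - Re s)" by simp
  qed
qed

lemma dterm_abs_summable:
  assumes "Re s > 1" "\<And>n. norm (f n) \<le> B"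
  shows "(\<lambda>n. norm (dterm f k s n)) summable_on A"
proof -
  have "(\<lambda>n. norm (dterm f k s n)) summable_on UNIV"
    using summable_norm_dterm[OF assms]
    by (intro norm_summable_imp_summable_on) auto
  thus ?thesis by (rule summable_on_subset_banach) auto
qed

lemma dterm_summable_on:
  assumes "Re s > 1" "\<And>n. norm (f n) \<le> B"
  shows "dterm f k s summable_on A"
  using dterm_abs_summable[OF assms] by (rule abs_summable_summable)

lemma dsum_has_sum:
  assumes "Re s > 1" "\<And>n. norm (f n) \<le> B"
  shows "(dterm f k s has_sum dsum f k s) {0<..}"
  unfolding dsum_def using dterm_summable_on[OF assms] by (rule has_sum_infsum)

lemma dsum_sums:
  assumes "Re s > 1" "\<And>n. norm (f n) \<le> B"
  shows "dterm f k s sums dsum f k s"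
proof -
  have "(dterm f k s has_sum dsum f k s) UNIV"
    using dsum_has_sum[OF assms] by (subst has_sum_cong_neutral[of "{0<..}" UNIV]) auto
  thus ?thesis by (rule has_sum_imp_sums)
qed

text \<open>Absolute summability over pairs permits grouping by the product: (m, n) corresponds to
  (m n, m), and each group is a finite divisor sum.\<close>

lemma dsum_mult:
  assumes s: "Re s > 1" and f: "\<And>n. norm (f n) \<le> B" and g: "\<And>n. norm (g n) \<le> B'"
  shows "((\<lambda>n. \<Sum>d | d dvd n. dterm f j s d * dterm g i s (n div d)) has_sum
            (dsum f j s * dsum g i s)) {0<..}"
proof -
  define F where "F = dterm f j s"
  define G where "G = dterm g i s"
  let ?A = "{0<..} :: nat set"
  have "(\<lambda>p. norm (case p of (m,n) \<Rightarrow> F m * G n)) summable_on ?A \<times> ?A"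
    unfolding F_def G_def
    using dterm_abs_summable[OF s f] dterm_abs_summable[OF s g]
    by (subst Infinite_Sum.abs_summable_on_Sigma_iff)
       (auto simp: norm_mult abs_mult infsum_cmult_right' intro!: summable_on_cmult_right summable_on_cmult_left)
  hence summ: "(\<lambda>(m,n). F m * G n) summable_on ?A \<times> ?A"
    by (rule abs_summable_summable)
  have "((\<lambda>(m,n). F m * G n) has_sum (dsum f j s * dsum g i s)) (?A \<times> ?A)"
    using summ
  proof (rule has_sum_SigmaI[rotated 2])
    show "((\<lambda>y. case (x, y) of (m, n) \<Rightarrow> F m * G n) has_sum (F x * dsum g i s)) ?A" for x
      unfolding G_def using has_sum_cmult_right[OF dsum_has_sum[OF s g]] by simp
    show "((\<lambda>x. F x * dsum g i s) has_sum dsum f j s * dsum g i s) ?A"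
      unfolding F_def using has_sum_cmult_left[OF dsum_has_sum[OF s f]] by simp
  qed
  also have "?this \<longleftrightarrow> ((\<lambda>(n,d). F d * G (n div d)) has_sum (dsum f j s * dsum g i s))
      (SIGMA n:?A. {d. d dvd n})"
    by (rule has_sum_reindex_bij_witness[of _ "\<lambda>(n,d). (d, n div d)" "\<lambda>(m,n). (m * n, m)"])
       (auto elim!: dvdE)
  finally have 1: "((\<lambda>(n,d). F d * G (n div d)) has_sum (dsum f j s * dsum g i s))
      (SIGMA n:?A. {d. d dvd n})" .
  have "((\<lambda>n. \<Sum>d | d dvd n. F d * G (n div d)) has_sum (dsum f j s * dsum g i s)) ?A"
    by (rule has_sum_SigmaD[OF 1]) auto
  thus ?thesis by (simp add: F_def G_def)
qed

lemma dterm_mult: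
  assumes "d dvd n" "n > 0"
  shows "dterm f j s d * dterm g i s (n div d) =
    f d * g (n div d) * of_real (ln (real d) ^ j * ln (real (n div d)) ^ i) * of_nat n powr (-s)"
proof -
  obtain e where n: "n = d * e" using assms by blast
  have "of_nat n powr (-s) = (of_real (real d) * of_real (real e)) powr (-s)"
    by (simp add: n)
  also have "\<dots> = of_nat d powr (-s) * (of_nat e powr (-s) :: complex)"
    by (subst powr_times_real) auto
  finally show ?thesis using assms by (simp add: dterm_def n)
qed

lemma has_sum_finite_sum:
  fixes f :: "'a \<Rightarrow> 'b \<Rightarrow> 'c :: {topological_comm_monoid_add, t2_space}"
  assumes "\<And>j. j \<in> J \<Longrightarrow> (f j has_sum S j) A"
  shows "((\<lambda>n. \<Sum>j\<in>J. f j n) has_sum (\<Sum>j\<in>J. S j)) A"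
  using assms by (induction J rule: infinite_finite_induct) (auto intro!: has_sum_add)

text \<open>Since ln (d e) = ln d + ln e, the binomial theorem applies divisor by divisor, so
  Leibniz' rule is a termwise identity and nothing is differentiated. Boundedness of the convolution
  is not at issue: its series converges as a regrouped product.\<close>

lemma dsum_leibniz:
  assumes s: "Re s > 1" and f: "\<And>n. norm (f n) \<le> B" and g: "\<And>n. norm (g n) \<le> B'"
  shows "(\<Sum>j\<le>k. of_nat (k choose j) * (dsum f j s * dsum g (k - j) s)) = dsum (dconv f g) k s"
proof -
  let ?T = "\<lambda>n. \<Sum>j\<le>k. of_nat (k choose j) *
      (\<Sum>d | d dvd n. dterm f j s d * dterm g (k - j) s (n div d))"
  have 1: "(?T has_sum (\<Sum>j\<le>k. of_nat (k choose j) * (dsum f j s * dsum g (k - j) s))) {0<..}"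
    by (intro has_sum_finite_sum has_sum_cmult_right dsum_mult[OF s f g])
  have "?T n = dterm (dconv f g) k s n" if n: "n > 0" for n
  proof -
    have "?T n = (\<Sum>j\<le>k. of_nat (k choose j) * (\<Sum>d | d dvd n.
       f d * g (n div d) * of_real (ln (real d) ^ j * ln (real (n div d)) ^ (k - j)) * of_nat n powr (-s)))"
      using n by (intro sum.cong arg_cong2[where f = "(*)"] refl dterm_mult) auto
    also have "\<dots> = (\<Sum>d | d dvd n. \<Sum>j\<le>k. f d * g (n div d) * of_nat n powr (-s) *
       of_real (real (k choose j) * ln (real d) ^ j * ln (real (n div d)) ^ (k - j)))"
      by (subst sum.swap) (simp add: sum_distrib_left mult_ac)
    also have "\<dots> = (\<Sum>d | d dvd n. f d * g (n div d) * of_nat n powr (-s) *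
       of_real ((ln (real d) + ln (real (n div d))) ^ k))"
      by (simp add: binomial_ring sum_distrib_left)
    also have "\<dots> = (\<Sum>d | d dvd n. f d * g (n div d) * of_nat n powr (-s) * of_real (ln (real n) ^ k))"
    proof (intro sum.cong refl)
      fix d assume "d \<in> {d. d dvd n}"
      then obtain e where "n = d * e" by blast
      hence "ln (real n) = ln (real d) + ln (real (n div d))"
        using n by (simp add: ln_mult)
      thus "f d * g (n div d) * of_nat n powr (-s) * complex_of_real ((ln (real d) + ln (real (n div d))) ^ k)
        = f d * g (n div d) * of_nat n powr (-s) * complex_of_real (ln (real n) ^ k)" by simp
    qed
    also have "\<dots> = dterm (dconv f g) k s n"
      by (simp add: dterm_def dconv_def sum_distrib_left sum_distrib_right mult_ac)
    finally show ?thesis .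
  qed
  hence "(dterm (dconv f g) k s has_sum (\<Sum>j\<le>k. of_nat (k choose j) * (dsum f j s * dsum g (k - j) s))) {0<..}"
    using 1 by (subst has_sum_cong[of _ _ ?T]) auto
  thus ?thesis by (simp add: dsum_def infsumI)
qed

section \<open>Convolutions with the Moebius function\<close>

text \<open>Squarefree divisors of n are the products of subsets of its prime factors, and the
  signed count of the subsets expands the product of 1 - 1 over these primes, which is empty only
  for n = 1.\<close>

lemma sum_moebius_mu_divisors:
  assumes "n > 0"
  shows "(\<Sum>d | d dvd n. moebius_mu d) = (if n = 1 then 1 else 0)"
proof -
  let ?P = "prime_factors n"
  have fin: "finite {d. d dvd n}" using assms by simp
  have "(\<Sum>d | d dvd n. moebius_mu d) = (\<Sum>d | d dvd n \<and> squarefree d. moebius_mu d)"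
    using fin by (intro sum.mono_neutral_right) (auto simp: moebius_mu_def)
  also have "\<dots> = (\<Sum>Q\<in>Pow ?P. (-1) ^ card Q)"
  proof (rule sum.reindex_bij_witness[of _ "\<lambda>Q. \<Prod>Q" prime_factors])
    fix d assume "d \<in> {d. d dvd n \<and> squarefree d}"
    hence d: "d dvd n" "squarefree d" by auto
    hence "d > 0" using assms by (auto intro!: Nat.gr0I)
    have "d = (\<Prod>p\<in>prime_factors d. p ^ multiplicity p d)"
      using prime_factorization_nat[OF \<open>d > 0\<close>] by simp
    also have "\<dots> = (\<Prod>p\<in>prime_factors d. p ^ 1)"
      using d \<open>d > 0\<close> squarefree_factorial_semiring'[of d] by (intro prod.cong) auto
    finally show "\<Prod>(prime_factors d) = d" by simp
    show "prime_factors d \<in> Pow ?P" using d assms by (auto intro: dvd_prime_factors[THEN subsetD])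
    show "(-1) ^ card (prime_factors d) = moebius_mu d" using d by (simp add: moebius_mu_def)
  next
    fix Q assume "Q \<in> Pow ?P"
    hence Q: "Q \<subseteq> ?P" and "finite Q" and pr: "\<And>p. p \<in> Q \<Longrightarrow> prime p"
      by (auto intro: finite_subset)
    note pd = prod_distinct_primes[OF \<open>finite Q\<close> pr]
    show "prime_factors (\<Prod>Q) = Q" by (rule pd)
    have "\<Prod>Q dvd \<Prod>?P" using Q by (intro prod_dvd_prod_subset) auto
    also have "\<Prod>?P dvd (\<Prod>p\<in>?P. p ^ multiplicity p n)"
      by (intro prod_dvd_prod dvd_power) (auto simp: prime_factors_multiplicity)
    also have "\<dots> = n" using prime_factorization_nat[OF assms] by simp
    finally have "\<Prod>Q dvd n" .
    thus "\<Prod>Q \<in> {d. d dvd n \<and> squarefree d}" using pd by simp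
  qed
  also have "\<dots> = (\<Sum>Q\<in>Pow ?P. \<Prod>p\<in>Q. (-1::int))" by simp
  also have "\<dots> = (\<Prod>p\<in>?P. 1 - 1)"
    using prod_diff_conv_sum[of ?P "\<lambda>_. 1" "\<lambda>_. 1::int"] by simp
  also have "\<dots> = (if n = 1 then 1 else 0)"
  proof (cases "n = 1")
    case False
    then obtain p where "prime p" "p dvd n" using prime_factor_nat by blast
    hence "p \<in> ?P" using assms by (auto simp: prime_factors_dvd)
    hence "card ?P > 0" by (auto simp: card_gt_0_iff)
    thus ?thesis using False by simp
  qed auto
  finally show ?thesis .
qed

abbreviation mu_c :: "nat \<Rightarrow> complex" where
  "mu_c n \<equiv> of_int (moebius_mu n)"

abbreviation one_c :: "nat \<Rightarrow> complex" where
  "one_c n \<equiv> 1"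

text \<open>The coefficients of the Dirichlet eta function (1 - 2 powr (1 - s)) \<zeta>(s).\<close>

definition alt_c :: "nat \<Rightarrow> complex" where
  "alt_c n = (if even n then -1 else 1)"

lemma abs_moebius_mu_le: "\<bar>moebius_mu n\<bar> \<le> 1"
  by (simp add: moebius_mu_def)

lemma norm_mu_c_le: "norm (mu_c n) \<le> 1"
  using abs_moebius_mu_le[of n] by (metis norm_of_int of_int_abs of_int_le_1_iff)

lemma norm_alt_c_le: "norm (alt_c n) \<le> 1"
  by (simp add: alt_c_def)

lemma dconv_mu_one: "n > 0 \<Longrightarrow> dconv mu_c one_c n = (if n = 1 then 1 else 0)"
  using sum_moebius_mu_divisors[of n] unfolding dconv_def by (simp flip: of_int_sum)

text \<open>The coefficient form of eta / \<zeta> = 1 - 2 * 2 powr (-s). An alternating sign is 1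
  minus twice the indicator of the even numbers, and the divisors d of n with n / d even are the
  divisors of n / 2.\<close>

lemma dconv_mu_alt:
  assumes "n > 0"
  shows "dconv mu_c alt_c n = (if n = 1 then 1 else if n = 2 then -2 else 0)"
proof -
  have "dconv mu_c alt_c n = (\<Sum>d | d dvd n. mu_c d) - 2 * (\<Sum>d | d dvd n \<and> even (n div d). mu_c d)"
  proof -
    have "dconv mu_c alt_c n = (\<Sum>d | d dvd n. mu_c d - (if even (n div d) then 2 * mu_c d else 0))"
      unfolding dconv_def by (intro sum.cong) (auto simp: alt_c_def)
    thus ?thesis using assms by (simp add: sum_subtractf sum.inter_filter[symmetric] sum_distrib_left)
  qed
  also have "(\<Sum>d | d dvd n \<and> even (n div d). mu_c d) = (if n = 2 then 1 else 0)"
  proof (cases "even n")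
    case True
    then obtain m where m: "n = 2 * m" by blast
    have "{d. d dvd n \<and> even (n div d)} = {d. d dvd m}"
    proof (intro set_eqI iffI)
      fix d assume "d \<in> {d. d dvd n \<and> even (n div d)}"
      then obtain e where e: "n = d * e" "even (n div d)" by blast
      hence "d > 0" using assms by (intro Nat.gr0I) auto
      hence "even e" using e by simp
      then obtain k where "e = 2 * k" by blast
      thus "d \<in> {d. d dvd m}" using e m by simp
    qed (use assms in \<open>auto simp: m elim!: dvdE\<close>)
    moreover have "m > 0" using m assms by simp
    ultimately show ?thesis
      using dconv_mu_one[of m] by (auto simp: m dconv_def)
  next
    case False
    hence "{d. d dvd n \<and> even (n div d)} = {}" by (auto dest: dvd_mult2 simp: dvd_div_mult_self) (metis dvd_div_mult_self dvd_mult2)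
    thus ?thesis using False by (simp only:) auto
  qed
  also have "(\<Sum>d | d dvd n. mu_c d) = (if n = 1 then 1 else 0)"
    using dconv_mu_one[OF assms] by (simp add: dconv_def)
  finally show ?thesis by auto
qed

lemma dsum_finite_support:
  assumes "finite S" "0 \<notin> S" "\<And>n. n > 0 \<Longrightarrow> n \<notin> S \<Longrightarrow> f n = 0"
  shows "dsum f k s = (\<Sum>n\<in>S. dterm f k s n)"
proof -
  have "dsum f k s = infsum (dterm f k s) S"
    unfolding dsum_def using assms by (intro infsum_cong_neutral) (auto simp: dterm_def intro: Nat.gr0I)
  thus ?thesis using assms by simp
qed

lemma dsum_mu_zeta_leibniz:
  assumes "Re s > 1"
  shows "(\<Sum>j\<le>k. of_nat (k choose j) * (dsum mu_c j s * dsum one_c (k - j) s)) = (if k = 0 then 1 else 0)"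
proof -
  have "dsum (dconv mu_c one_c) k s = (\<Sum>n\<in>{1}. dterm (dconv mu_c one_c) k s n)"
    by (rule dsum_finite_support) (auto simp: dconv_mu_one)
  thus ?thesis
    using assms dsum_leibniz[of s mu_c 1 one_c 1 k] norm_mu_c_le
    by (simp add: dterm_def dconv_mu_one power_0_left)
qed

text \<open>Only n = 1 and n = 2 contribute to the convolution; the former gives (ln 1)^k, which is
  1 for k = 0 and 0 otherwise.\<close>

lemma dsum_mu_alt_leibniz:
  assumes "Re s > 1"
  shows "(\<Sum>j\<le>k. of_nat (k choose j) * (dsum mu_c j s * dsum alt_c (k - j) s)) =
    (if k = 0 then 1 else 0) - 2 * of_real (ln 2 ^ k) * 2 powr (-s)"
proof -
  have "dsum (dconv mu_c alt_c) k s = (\<Sum>n\<in>{1,2}. dterm (dconv mu_c alt_c) k s n)"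
    by (rule dsum_finite_support) (auto simp: dconv_mu_alt)
  thus ?thesis
    using assms dsum_leibniz[of s mu_c 1 alt_c 1 k] norm_mu_c_le norm_alt_c_le
    by (simp add: dterm_def dconv_mu_alt power_0_left)
qed

lemma mu_zeta: "Re s > 1 \<Longrightarrow> dsum mu_c 0 s * dsum one_c 0 s = 1"
  using dsum_mu_zeta_leibniz[of s 0] by simp


section \<open>Euler product and the 3-4-1 inequality\<close>

lemma dterm_one_mult:
  "dterm one_c 0 s (m * n) = of_nat m powr (-s) * dterm one_c 0 s n"
proof -
  have "of_nat (m * n) powr (-s) = (of_real (real m) * of_real (real n)) powr (-s)" by simp
  also have "\<dots> = of_nat m powr (-s) * (of_nat n powr (-s) :: complex)"
    by (subst powr_times_real) auto
  finally show ?thesis by (simp add: dterm_def)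
qed

text \<open>
  Multiplying by \<open>1 - p^(-s)\<close> removes the multiples of \<open>p\<close> from the range of summation.
\<close>

lemma sieve_has_sum:
  assumes s: "Re s > 1" and P: "finite P" "\<And>p. p \<in> P \<Longrightarrow> prime p"
  shows "(dterm one_c 0 s has_sum ((\<Prod>p\<in>P. 1 - of_nat p powr (-s)) * dsum one_c 0 s))
           {n::nat. n > 0 \<and> (\<forall>p\<in>P. \<not> p dvd n)}"
  using P
proof (induction P rule: finite_induct)
  case empty
  have "(dterm one_c 0 s has_sum dsum one_c 0 s) {0<..}"
    by (rule dsum_has_sum[OF s, of _ 1]) auto
  thus ?case by (simp add: greaterThan_def)
next
  case (insert p P)
  define A where "A = {n::nat. n > 0 \<and> (\<forall>p\<in>P. \<not> p dvd n)}"
  define T where "T = (\<Prod>p\<in>P. 1 - of_nat p powr (-s)) * dsum one_c 0 s"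
  have T: "(dterm one_c 0 s has_sum T) A" using insert by (simp add: A_def T_def)
  have p: "prime p" "p > 0" using insert by (auto intro: prime_gt_0_nat)
  have im: "(\<lambda>n. p * n) ` A = {n\<in>A. p dvd n}"
  proof (intro set_eqI iffI)
    fix n assume "n \<in> (\<lambda>n. p * n) ` A"
    then obtain m where m: "m \<in> A" "n = p * m" by blast
    have "\<not> q dvd p * m" if q: "q \<in> P" for q
    proof -
      have "prime q" "q \<noteq> p" using q insert by auto
      moreover have "\<not> q dvd m" using m q by (auto simp: A_def)
      ultimately show ?thesis
        using p primes_dvd_imp_eq[of q p] by (auto simp: prime_dvd_mult_iff)
    qed
    thus "n \<in> {n\<in>A. p dvd n}" using m p by (auto simp: A_def)
  next
    fix n assume "n \<in> {n\<in>A. p dvd n}"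
    then obtain m where m: "n = p * m" "n \<in> A" by auto
    hence "m \<in> A" by (auto simp: A_def)
    thus "n \<in> (\<lambda>n. p * n) ` A" using m by blast
  qed
  have "((\<lambda>n. dterm one_c 0 s (p * n)) has_sum (of_nat p powr (-s) * T)) A"
    unfolding dterm_one_mult by (intro has_sum_cmult_right T)
  hence "(dterm one_c 0 s has_sum (of_nat p powr (-s) * T)) {n\<in>A. p dvd n}"
    unfolding im[symmetric] using p by (subst has_sum_reindex) (auto simp: inj_on_def o_def)
  from has_sum_Diff[OF T this] have "(dterm one_c 0 s has_sum (T - of_nat p powr (-s) * T)) (A - {n\<in>A. p dvd n})"
    by auto
  also have "A - {n\<in>A. p dvd n} = {n. n > 0 \<and> (\<forall>q\<in>insert p P. \<not> q dvd n)}"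
    by (auto simp: A_def)
  also have "T - of_nat p powr (-s) * T = (\<Prod>p\<in>insert p P. 1 - of_nat p powr (-s)) * dsum one_c 0 s"
    using insert by (simp add: T_def algebra_simps)
  finally show ?case .
qed

definition primes_le :: "nat \<Rightarrow> nat set" where
  "primes_le y = {p. prime p \<and> p \<le> y}"

lemma finite_primes_le [simp]: "finite (primes_le y)"
  by (rule finite_subset[of _ "{..y}"]) (auto simp: primes_le_def)

text \<open>After sieving by all primes up to y only 1 and integers above y survive, so the error is
  at most a tail of an absolutely convergent series. Keeping the finite product multiplied by
  \<zeta> avoids infinite products and division.\<close>

lemma euler_product_zeta:
  assumes s: "Re s > 1"
  shows "(\<lambda>y. (\<Prod>p\<in>primes_le y. 1 - of_nat p powr (-s)) * dsum one_c 0 s) \<longlonglongrightarrow> 1"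
proof -
  define g where "g n = norm (dterm one_c 0 s n)" for n
  have "summable g" unfolding g_def by (rule summable_norm_dterm[OF s, of _ 1]) auto
  hence g: "g summable_on A" for A
    using dterm_abs_summable[OF s, of one_c 1 0 A] by (simp add: g_def[abs_def])
  have bound: "norm ((\<Prod>p\<in>primes_le y. 1 - of_nat p powr (-s)) * dsum one_c 0 s - 1) \<le> suminf g - (\<Sum>n<Suc y. g n)"
    (is "norm (?T - 1) \<le> _") for y
  proof -
    let ?A = "{n::nat. n > 0 \<and> (\<forall>p\<in>primes_le y. \<not> p dvd n)}"
    have "(dterm one_c 0 s has_sum ?T) ?A"
      by (rule sieve_has_sum[OF s]) (auto simp: primes_le_def)
    moreover have "(dterm one_c 0 s has_sum 1) {1}"
      by (rule has_sum_finiteI) (auto simp: dterm_def)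
    moreover have "{1} \<subseteq> ?A"
    proof -
      have "\<not> p dvd 1" if "p \<in> primes_le y" for p
        using that not_prime_unit[of p] by (auto simp: primes_le_def)
      thus ?thesis by blast
    qed
    ultimately have "(dterm one_c 0 s has_sum (?T - 1)) (?A - {1})"
      by (rule has_sum_Diff)
    moreover have "?A - {1} \<subseteq> {Suc y..}"
    proof
      fix n assume n: "n \<in> ?A - {1}"
      then obtain p where p: "prime p" "p dvd n" using prime_factor_nat[of n] by auto
      hence "p \<notin> primes_le y" using n by auto
      hence "p > y" using p by (auto simp: primes_le_def)
      moreover have "p \<le> n" using p n by (auto intro: dvd_imp_le)
      ultimately show "n \<in> {Suc y..}" by simp
    qed
    moreover have "(g has_sum (suminf g - (\<Sum>n<Suc y. g n))) {Suc y..}"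
    proof -
      have "(g has_sum suminf g) UNIV"
        using \<open>summable g\<close> by (intro sums_nonneg_imp_has_sum) (auto simp: g_def summable_sums)
      moreover have "(g has_sum (\<Sum>n<Suc y. g n)) {..<Suc y}"
        by (rule has_sum_finiteI) auto
      ultimately have "(g has_sum (suminf g - (\<Sum>n<Suc y. g n))) (UNIV - {..<Suc y})"
        by (rule has_sum_Diff) auto
      also have "UNIV - {..<Suc y} = {Suc y..}" by auto
      finally show ?thesis .
    qed
    hence "infsum g {Suc y..} = suminf g - (\<Sum>n<Suc y. g n)" by (rule infsumI)
    ultimately show ?thesis
    proof -
      assume 1: "(dterm one_c 0 s has_sum (?T - 1)) (?A - {1})" and 2: "?A - {1} \<subseteq> {Suc y..}"
         and 3: "infsum g {Suc y..} = suminf g - (\<Sum>n<Suc y. g n)"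
      have "norm (?T - 1) \<le> infsum g (?A - {1})"
      proof -
        have "norm (infsum (dterm one_c 0 s) (?A - {1})) \<le> infsum g (?A - {1})"
          unfolding g_def[abs_def] by (rule norm_infsum_bound, rule dterm_abs_summable[OF s, of _ 1]) simp
        thus ?thesis by (simp only: infsumI[OF 1])
      qed
      also have "\<dots> \<le> infsum g {Suc y..}"
        using 2 by (intro infsum_mono_neutral g) (auto simp: g_def)
      finally show ?thesis using 3 by simp
    qed
  qed
  have "(\<lambda>y. suminf g - (\<Sum>n<Suc y. g n)) \<longlonglongrightarrow> suminf g - suminf g"
    by (rule tendsto_diff[OF tendsto_const LIMSEQ_Suc[OF summable_LIMSEQ[OF \<open>summable g\<close>]]])
  hence "(\<lambda>y. (\<Prod>p\<in>primes_le y. 1 - of_nat p powr (-s)) * dsum one_c 0 s - 1) \<longlonglongrightarrow> 0"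
    by (intro Lim_null_comparison[OF always_eventually[OF allI[OF bound]]]) simp
  thus ?thesis by (rule LIM_zero_cancel)
qed

text \<open>
  The logarithm of the left-hand side is a power series in \<open>r\<close> whose coefficients are
  \<open>-(3 + 4 c + (2 c\<^sup>2 - 1)) / n = -2 (1 + c)\<^sup>2 / n\<close> with \<open>c = Re (w^n)\<close>.
\<close>

lemma three_four_one_factor:
  fixes r :: real and w :: complex
  assumes r: "0 < r" "r < 1" and w: "norm w = 1"
  shows "norm (1 - of_real r :: complex) ^ 3 * norm (1 - r * w) ^ 4 * norm (1 - r * w ^ 2) \<le> 1"
proof -
  have ser: "(\<lambda>n. - (r ^ n / n * Re (v ^ n))) sums ln (norm (1 - r * v))"
    and nz: "norm (1 - r * v) > 0" if v: "norm v = 1" for v :: complex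
  proof -
    have lt: "norm (- (r * v)) < 1" using r v by (simp add: norm_mult)
    hence ne: "1 - r * v \<noteq> 0" by auto
    thus "norm (1 - r * v) > 0" by simp
    have "(\<lambda>n. Re ((-1) ^ Suc n / of_nat n * (- (r * v)) ^ n)) sums Re (ln (1 + (- (r * v))))"
      by (intro sums_Re Ln_series lt)
    moreover have "Re ((-1) ^ Suc n / of_nat n * (- (r * v)) ^ n) = - (r ^ n / n * Re (v ^ n))" for n
    proof -
      have "(-1) ^ Suc n / of_nat n * (- (r * v)) ^ n = - ((-1) ^ n * (-1) ^ n) * (r * v) ^ n / of_nat n"
        by (subst power_minus) (simp add: mult_ac)
      also have "(-1) ^ n * (-1) ^ n = (1 :: complex)"
        by (metis left_minus_one_mult_self mult.right_neutral)
      also have "- 1 * (r * v) ^ n / of_nat n = of_real (- (r ^ n / n)) * v ^ n"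
        by (simp add: power_mult_distrib)
      finally have "(-1) ^ Suc n / of_nat n * (- (r * v)) ^ n = of_real (- (r ^ n / n)) * v ^ n" .
      thus ?thesis by (simp only:) simp
    qed
    ultimately have "(\<lambda>n. - (r ^ n / n * Re (v ^ n))) sums Re (ln (1 + (- (r * v))))"
      by (simp only:)
    thus "(\<lambda>n. - (r ^ n / n * Re (v ^ n))) sums ln (norm (1 - r * v))"
      using ne by simp
  qed
  have w2: "norm (w ^ 2) = 1" using w by (simp add: norm_power)
  let ?L = "3 * ln (norm (1 - of_real r :: complex)) + 4 * ln (norm (1 - r * w)) + ln (norm (1 - r * w ^ 2))"
  have sum3: "(\<lambda>n. 3 * - (r ^ n / n * Re (1 ^ n)) + 4 * - (r ^ n / n * Re (w ^ n)) + - (r ^ n / n * Re ((w ^ 2) ^ n))) sums ?L"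
    using w w2 ser[of 1] by (intro sums_add sums_mult ser) auto
  have "3 * - (r ^ n / n * Re (1 ^ n)) + 4 * - (r ^ n / n * Re (w ^ n)) + - (r ^ n / n * Re ((w ^ 2) ^ n)) \<le> 0" for n
  proof -
    define c d where "c = Re (w ^ n)" and "d = Im (w ^ n)"
    have "norm (w ^ n) = 1" using w by (simp add: norm_power)
    hence cd: "c ^ 2 + d ^ 2 = 1" unfolding c_def d_def by (simp add: cmod_def)
    have "(w ^ 2) ^ n = (w ^ n) ^ 2" by (metis power_mult mult.commute)
    hence "Re ((w ^ 2) ^ n) = c ^ 2 - d ^ 2" by (simp add: c_def d_def power2_eq_square)
    also have "\<dots> = 2 * c ^ 2 - 1" using cd by simp
    finally have e: "Re ((w ^ 2) ^ n) = 2 * c ^ 2 - 1" .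
    have "3 * - (r ^ n / n * Re (1 ^ n)) + 4 * - (r ^ n / n * Re (w ^ n)) + - (r ^ n / n * Re ((w ^ 2) ^ n))
      = - (2 * (r ^ n / n) * (1 + c) ^ 2)"
      unfolding e c_def[symmetric] by (simp add: algebra_simps power2_eq_square add_divide_distrib)
    thus ?thesis using r by simp
  qed
  from sums_le[OF this sum3 sums_zero] have L: "?L \<le> 0" .
  have "norm (1 - of_real r :: complex) ^ 3 * norm (1 - r * w) ^ 4 * norm (1 - r * w ^ 2) = exp ?L"
  proof -
    have pow: "exp (of_nat m * ln x) = x ^ m" if "x > 0" for x :: real and m
      using that by (simp add: exp_of_nat_mult)
    have "exp ?L = exp (of_nat 3 * ln (norm (1 - of_real r :: complex))) * exp (of_nat 4 * ln (norm (1 - r * w))) *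
        exp (ln (norm (1 - r * w ^ 2)))" by (simp only: exp_add) simp
    also have "\<dots> = norm (1 - of_real r :: complex) ^ 3 * norm (1 - r * w) ^ 4 * norm (1 - r * w ^ 2)"
      using nz[OF norm_one] by (simp only: pow[OF nz[OF w]] exp_ln[OF nz[OF w2]] mult_1_right pow)
    finally show ?thesis by simp
  qed
  thus ?thesis using L by simp
qed

text \<open>The local inequality bounds the 3-4-1 combination of the finite products by 1. Since
  each product times \<zeta> tends to 1, the same combination of \<zeta>-values cannot be below 1.
  No logarithm of \<zeta> is involved.\<close>

lemma zeta_three_four_one:
  assumes s: "\<sigma> > 1"
  shows "norm (dsum one_c 0 (of_real \<sigma>)) ^ 3 * norm (dsum one_c 0 (Complex \<sigma> t)) ^ 4 *
           norm (dsum one_c 0 (Complex \<sigma> (2 * t))) \<ge> 1"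
proof -
  define Q where "Q y s = (\<Prod>p\<in>primes_le y. 1 - (of_nat p :: complex) powr (-s))" for y s
  define Z where "Z = dsum one_c 0"
  have lim: "(\<lambda>y. Q y s * Z s) \<longlonglongrightarrow> 1" if "Re s > 1" for s
    unfolding Q_def Z_def by (rule euler_product_zeta[OF that])
  have "(\<lambda>y. norm (Q y (of_real \<sigma>) * Z (of_real \<sigma>)) ^ 3 * norm (Q y (Complex \<sigma> t) * Z (Complex \<sigma> t)) ^ 4 *
          norm (Q y (Complex \<sigma> (2*t)) * Z (Complex \<sigma> (2*t)))) \<longlonglongrightarrow> norm (1::complex) ^ 3 * norm (1::complex) ^ 4 * norm (1::complex)"
    using s by (intro tendsto_intros lim) auto
  moreover have "norm (Q y (of_real \<sigma>) * Z (of_real \<sigma>)) ^ 3 * norm (Q y (Complex \<sigma> t) * Z (Complex \<sigma> t)) ^ 4 *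
          norm (Q y (Complex \<sigma> (2*t)) * Z (Complex \<sigma> (2*t)))
       \<le> norm (Z (of_real \<sigma>)) ^ 3 * norm (Z (Complex \<sigma> t)) ^ 4 * norm (Z (Complex \<sigma> (2*t)))" for y
  proof -
    have "norm (Q y (of_real \<sigma>)) ^ 3 * norm (Q y (Complex \<sigma> t)) ^ 4 * norm (Q y (Complex \<sigma> (2*t)))
      = (\<Prod>p\<in>primes_le y. norm (1 - (of_nat p :: complex) powr (-of_real \<sigma>)) ^ 3 *
           norm (1 - (of_nat p :: complex) powr (-Complex \<sigma> t)) ^ 4 *
           norm (1 - (of_nat p :: complex) powr (-Complex \<sigma> (2*t))))"
      by (simp add: Q_def prod_norm[symmetric] prod.distrib prod_power_distrib)
    also have "\<dots> \<le> 1"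
    proof (intro prod_le_1 conjI)
      fix p assume "p \<in> primes_le y"
      hence p: "p > 1" using prime_gt_1_nat by (auto simp: primes_le_def)
      \<comment> \<open>With p powr (-s) = r w, doubling the ordinate squares w and leaves r
        unchanged.\<close>
      define r where "r = real p powr (-\<sigma>)"
      define w where "w = (of_nat p :: complex) powr (-(\<i> * of_real t))"
      have r: "0 < r" "r < 1" using p s by (auto simp: r_def powr_less_one)
      have w: "norm w = 1" using p by (simp add: w_def norm_powr_real_powr)
      have rc: "(of_nat p :: complex) powr (-of_real \<sigma>) = of_real r"
        using p powr_of_real[of "real p" "-\<sigma>"] by (simp add: r_def)
      have 1: "(of_nat p :: complex) powr (-Complex \<sigma> t) = r * w"
      proof -
        have "-Complex \<sigma> t = -of_real \<sigma> + -(\<i> * of_real t)" by (simp add: complex_eq_iff)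
        thus ?thesis unfolding rc[symmetric] w_def by (simp only: powr_add)
      qed
      have 2: "(of_nat p :: complex) powr (-Complex \<sigma> (2*t)) = r * w ^ 2"
      proof -
        have "-Complex \<sigma> (2*t) = -of_real \<sigma> + (-(\<i> * of_real t) + -(\<i> * of_real t))"
          by (simp add: complex_eq_iff)
        thus ?thesis unfolding rc[symmetric] w_def by (simp only: powr_add power2_eq_square)
      qed
      show "norm (1 - (of_nat p :: complex) powr (-of_real \<sigma>)) ^ 3 *
           norm (1 - (of_nat p :: complex) powr (-Complex \<sigma> t)) ^ 4 *
           norm (1 - (of_nat p :: complex) powr (-Complex \<sigma> (2*t))) \<le> 1"
        unfolding rc 1 2 by (rule three_four_one_factor[OF r w])
    qed auto
    finally have *: "norm (Q y (of_real \<sigma>)) ^ 3 * norm (Q y (Complex \<sigma> t)) ^ 4 * norm (Q y (Complex \<sigma> (2*t))) \<le> 1" .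
    have "norm (Q y (of_real \<sigma>) * Z (of_real \<sigma>)) ^ 3 * norm (Q y (Complex \<sigma> t) * Z (Complex \<sigma> t)) ^ 4 *
          norm (Q y (Complex \<sigma> (2*t)) * Z (Complex \<sigma> (2*t)))
      = (norm (Q y (of_real \<sigma>)) ^ 3 * norm (Q y (Complex \<sigma> t)) ^ 4 * norm (Q y (Complex \<sigma> (2*t)))) *
        (norm (Z (of_real \<sigma>)) ^ 3 * norm (Z (Complex \<sigma> t)) ^ 4 * norm (Z (Complex \<sigma> (2*t))))"
      by (simp add: norm_mult power_mult_distrib mult_ac)
    also have "\<dots> \<le> 1 * (norm (Z (of_real \<sigma>)) ^ 3 * norm (Z (Complex \<sigma> t)) ^ 4 * norm (Z (Complex \<sigma> (2*t))))"
      by (intro mult_right_mono *) auto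
    finally show ?thesis by simp
  qed
  ultimately show ?thesis unfolding Z_def by (intro LIMSEQ_le_const2) auto
qed


section \<open>Derivatives of the zeta function near the line Re s = 1\<close>

text \<open>The summand as a function of the summation variable. It is taken complex so that complex
  derivative rules apply, but it is evaluated only at positive reals.\<close>

definition logpow :: "nat \<Rightarrow> complex \<Rightarrow> complex \<Rightarrow> complex" where
  "logpow j s z = Ln z ^ j * z powr (-s)"

text \<open>
  An antiderivative in \<open>z\<close> of \<open>logpow j s\<close>, by repeated integration by parts.
\<close>

fun logpow_prim :: "nat \<Rightarrow> complex \<Rightarrow> complex \<Rightarrow> complex" where
  "logpow_prim 0 s z = z powr (1 - s) / (1 - s)"
| "logpow_prim (Suc j) s z = (Ln z ^ Suc j * z powr (1 - s) - of_nat (Suc j) * logpow_prim j s z) / (1 - s)"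

lemma dterm_one_eq_logpow: "n > 0 \<Longrightarrow> dterm one_c j s n = logpow j s (of_nat n)"
  by (simp add: dterm_def logpow_def)

lemma logpow_deriv:
  assumes "z \<notin> \<real>\<^sub>\<le>\<^sub>0"
  shows "(logpow j s has_field_derivative
           ((of_nat j * Ln z ^ (j - 1) - s * Ln z ^ j) * z powr (-s - 1))) (at z)"
proof -
  have z: "z \<noteq> 0" using assms by auto
  have 1: "((\<lambda>z. Ln z ^ j) has_field_derivative (of_nat j * Ln z ^ (j - 1) * inverse z)) (at z)"
    using DERIV_power[OF has_field_derivative_Ln[OF assms], of j] by (simp add: mult_ac)
  have "(logpow j s has_field_derivative (of_nat j * Ln z ^ (j - 1) * inverse z * z powr (-s) +
     (-s * z powr (-s - 1)) * Ln z ^ j)) (at z)"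
    unfolding logpow_def[abs_def] by (rule DERIV_mult[OF 1 has_field_derivative_powr[OF assms]])
  also have "z powr (-s) = z * z powr (-s - 1)"
    using z by (simp add: powr_diff)
  also have "of_nat j * Ln z ^ (j - 1) * inverse z * (z * z powr (-s - 1)) + (-s * z powr (-s - 1)) * Ln z ^ j
    = (of_nat j * Ln z ^ (j - 1) - s * Ln z ^ j) * z powr (-s - 1)"
    using z by (simp add: algebra_simps)
  finally show ?thesis .
qed

lemma logpow_prim_deriv:
  assumes "z \<notin> \<real>\<^sub>\<le>\<^sub>0" "s \<noteq> 1"
  shows "(logpow_prim j s has_field_derivative logpow j s z) (at z)"
proof (induction j)
  case 0
  have "((\<lambda>z. z powr (1 - s) / (1 - s)) has_field_derivative ((1 - s) * z powr (1 - s - 1)) / (1 - s)) (at z)"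
    by (intro DERIV_cdivide has_field_derivative_powr assms)
  thus ?case using assms by (simp add: logpow_def[abs_def] fun_eq_iff)
next
  case (Suc j)
  have z: "z \<noteq> 0" using assms by auto
  have 1: "((\<lambda>z. Ln z ^ Suc j) has_field_derivative (of_nat (Suc j) * Ln z ^ j * inverse z)) (at z)"
    using DERIV_power[OF has_field_derivative_Ln[OF assms(1)], of "Suc j"] by (simp add: mult_ac)
  have e: "z powr (1 - s) = z * z powr (-s)" using z by (simp add: powr_diff powr_minus field_simps)
  have "((\<lambda>z. (Ln z ^ Suc j * z powr (1 - s) - of_nat (Suc j) * logpow_prim j s z) / (1 - s)) has_field_derivative
     ((of_nat (Suc j) * Ln z ^ j * inverse z * z powr (1 - s) + ((1 - s) * z powr (1 - s - 1)) * Ln z ^ Suc j)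
        - of_nat (Suc j) * logpow j s z) / (1 - s)) (at z)"
    by (intro DERIV_cdivide DERIV_diff DERIV_cmult Suc DERIV_mult 1 has_field_derivative_powr assms)
  also have "((of_nat (Suc j) * Ln z ^ j * inverse z * z powr (1 - s) + ((1 - s) * z powr (1 - s - 1)) * Ln z ^ Suc j)
        - of_nat (Suc j) * logpow j s z) / (1 - s) = logpow (Suc j) s z"
    using z assms by (simp add: e logpow_def field_simps)
  finally show ?case by (simp add: fun_eq_iff[symmetric])
qed

lemma segment_nat_E:
  assumes "z \<in> closed_segment (of_nat n :: complex) (of_nat (Suc n))"
  obtains u where "z = of_real u" "real n \<le> u" "u \<le> real n + 1"
proof -
  from assms obtain v where v: "0 \<le> v" "v \<le> 1"
    "z = (1 - v) *\<^sub>R of_nat n + v *\<^sub>R of_nat (Suc n)" by (auto simp: in_segment)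
  have "z = of_real (real n + v)" by (simp add: v scaleR_conv_of_real algebra_simps)
  thus ?thesis using v by (intro that[of "real n + v"]) auto
qed

text \<open>Re s > 1 caps the power at u powr (-2), and half a power is spent on the logarithms. The
  dependence on s is then only a factor of size norm s, uniformly up to the boundary line.\<close>

lemma logpow_deriv_bound:
  obtains C where "C \<ge> 0"
    "\<And>s u. Re s > 1 \<Longrightarrow> u \<ge> 1 \<Longrightarrow>
       norm ((of_nat j * Ln (of_real u) ^ (j - 1) - s * Ln (of_real u) ^ j) * of_real u powr (-s - 1))
         \<le> C * (real j + norm s) * u powr (-3/2)"
proof -
  obtain C :: real where C: "C \<ge> 1" "\<And>x. x \<ge> 1 \<Longrightarrow> (1 + ln x) ^ j \<le> C * x powr (1/2)"
    by (rule log_power_le_powr[of "1/2" j]) auto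
  show ?thesis
  proof (rule that[of C])
    show "C \<ge> 0" using C by simp
    fix s :: complex and u :: real assume s: "Re s > 1" and u: "u \<ge> 1"
    have l: "ln u \<ge> 0" using u by simp
    have Lnu: "Ln (of_real u) = of_real (ln u)" using u by (simp add: Ln_of_real)
    \<comment> \<open>For j = 0 the truncated j - 1 is 0; the value is harmless, as it is multiplied
      by j.\<close>
    have p1: "ln u ^ (j - 1) \<le> (1 + ln u) ^ j"
    proof -
      have "ln u ^ (j - 1) \<le> (1 + ln u) ^ (j - 1)" using l by (intro power_mono) auto
      also have "\<dots> \<le> (1 + ln u) ^ j" using l by (intro power_increasing) auto
      finally show ?thesis .
    qed
    have p2: "ln u ^ j \<le> (1 + ln u) ^ j" using l by (intro power_mono) auto
    have "norm (of_nat j * Ln (of_real u) ^ (j - 1) - s * Ln (of_real u) ^ j)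
       \<le> real j * ln u ^ (j - 1) + norm s * ln u ^ j"
      unfolding Lnu by (rule order_trans[OF norm_triangle_ineq4]) (use l in \<open>simp add: norm_mult norm_power\<close>)
    also have "\<dots> \<le> real j * (1 + ln u) ^ j + norm s * (1 + ln u) ^ j"
      using p1 p2 by (intro add_mono mult_left_mono) auto
    also have "\<dots> = (real j + norm s) * (1 + ln u) ^ j" by (simp add: algebra_simps)
    also have "\<dots> \<le> (real j + norm s) * (C * u powr (1/2))"
      using C(2)[OF u] by (intro mult_left_mono) auto
    finally have 1: "norm (of_nat j * Ln (of_real u) ^ (j - 1) - s * Ln (of_real u) ^ j)
       \<le> (real j + norm s) * (C * u powr (1/2))" .
    have "norm (of_real u powr (-s - 1) :: complex) = u powr (-Re s - 1)"
      using u by (simp add: norm_powr_real_powr)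
    also have "\<dots> \<le> u powr (-2)" using u s by (intro powr_mono) auto
    finally have "norm ((of_nat j * Ln (of_real u) ^ (j - 1) - s * Ln (of_real u) ^ j) * of_real u powr (-s - 1))
      \<le> ((real j + norm s) * (C * u powr (1/2))) * u powr (-2)"
      unfolding norm_mult using 1 C by (intro mult_mono) auto
    also have "\<dots> = C * (real j + norm s) * u powr (1/2 + -2)"
      unfolding powr_add by (simp add: mult_ac)
    finally show "norm ((of_nat j * Ln (of_real u) ^ (j - 1) - s * Ln (of_real u) ^ j) * of_real u powr (-s - 1))
         \<le> C * (real j + norm s) * u powr (-3/2)" by simp
  qed
qed

lemma logpow_diff_bound:
  obtains C where "C \<ge> 0"
    "\<And>s n z. Re s > 1 \<Longrightarrow> n \<ge> 1 \<Longrightarrow> z \<in> closed_segment (of_nat n) (of_nat (Suc n)) \<Longrightarrow>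
       norm (logpow j s z - logpow j s (of_nat n)) \<le> C * (real j + norm s) * real n powr (-3/2)"
    "\<And>s n. Re s > 1 \<Longrightarrow> n \<ge> 1 \<Longrightarrow>
       norm (logpow j s (of_nat n) - (logpow_prim j s (of_nat (Suc n)) - logpow_prim j s (of_nat n)))
         \<le> C * (real j + norm s) * real n powr (-3/2)"
proof -
  obtain C where C: "C \<ge> 0"
    "\<And>s u. Re s > 1 \<Longrightarrow> u \<ge> 1 \<Longrightarrow>
       norm ((of_nat j * Ln (of_real u) ^ (j - 1) - s * Ln (of_real u) ^ j) * of_real u powr (-s - 1))
         \<le> C * (real j + norm s) * u powr (-3/2)"
    using logpow_deriv_bound[of j] by blast
  have 1: "norm (logpow j s z - logpow j s (of_nat n)) \<le> C * (real j + norm s) * real n powr (-3/2)"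
    if s: "Re s > 1" and n: "n \<ge> 1" and z: "z \<in> closed_segment (of_nat n) (of_nat (Suc n))" for s n z
  proof -
    let ?S = "closed_segment (of_nat n :: complex) (of_nat (Suc n))"
    have "norm (logpow j s z - logpow j s (of_nat n)) \<le> (C * (real j + norm s) * real n powr (-3/2)) * norm (z - of_nat n)"
    proof (rule field_differentiable_bound[where S = ?S])
      fix w assume "w \<in> ?S"
      then obtain u where u: "w = of_real u" "real n \<le> u" "u \<le> real n + 1" by (rule segment_nat_E)
      have "w \<notin> \<real>\<^sub>\<le>\<^sub>0" using u n by (auto simp: complex_nonpos_Reals_iff)
      thus "(logpow j s has_field_derivative
           ((of_nat j * Ln w ^ (j - 1) - s * Ln w ^ j) * w powr (-s - 1))) (at w within ?S)"
        by (rule has_field_derivative_at_within[OF logpow_deriv])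
      have "norm ((of_nat j * Ln w ^ (j - 1) - s * Ln w ^ j) * w powr (-s - 1))
         \<le> C * (real j + norm s) * u powr (-3/2)" unfolding u(1) using u n by (intro C(2) s) auto
      also have "\<dots> \<le> C * (real j + norm s) * real n powr (-3/2)"
        using C(1) u n by (intro mult_left_mono powr_mono2') auto
      finally show "norm ((of_nat j * Ln w ^ (j - 1) - s * Ln w ^ j) * w powr (-s - 1))
        \<le> C * (real j + norm s) * real n powr (-3/2)" .
    qed (use z in auto)
    also have "norm (z - of_nat n) \<le> 1"
    proof -
      obtain u where u: "z = of_real u" "real n \<le> u" "u \<le> real n + 1" using z by (rule segment_nat_E)
      have "z - of_nat n = of_real (u - real n)" by (simp add: u)
      thus ?thesis using u by (simp only: norm_of_real)
    qed
    hence "(C * (real j + norm s) * real n powr (-3/2)) * norm (z - of_nat n) \<le>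
      (C * (real j + norm s) * real n powr (-3/2)) * 1"
      using C(1) by (intro mult_left_mono) auto
    finally show ?thesis by simp
  qed
  have 2: "norm (logpow j s (of_nat n) - (logpow_prim j s (of_nat (Suc n)) - logpow_prim j s (of_nat n)))
         \<le> C * (real j + norm s) * real n powr (-3/2)"
    if s: "Re s > 1" and n: "n \<ge> 1" for s n
  proof -
    let ?S = "closed_segment (of_nat n :: complex) (of_nat (Suc n))"
    \<comment> \<open>Subtracting a linear function makes the derivative of \<open>h\<close> exactly
      the difference bounded before, so comparing a term with its integral is a second mean value
      estimate and no integral has to be formed.\<close>
    define h where "h z = logpow_prim j s z - z * logpow j s (of_nat n)" for z
    have "norm (h (of_nat (Suc n)) - h (of_nat n)) \<le> (C * (real j + norm s) * real n powr (-3/2)) * norm (of_nat (Suc n) - of_nat n :: complex)"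
    proof (rule field_differentiable_bound[where S = ?S])
      fix w assume w: "w \<in> ?S"
      then obtain u where u: "w = of_real u" "real n \<le> u" "u \<le> real n + 1" by (rule segment_nat_E)
      have "w \<notin> \<real>\<^sub>\<le>\<^sub>0" using u n by (auto simp: complex_nonpos_Reals_iff)
      moreover have "s \<noteq> 1" using s by auto
      ultimately have "(h has_field_derivative (logpow j s w - 1 * logpow j s (of_nat n))) (at w)"
        unfolding h_def[abs_def] by (intro DERIV_diff logpow_prim_deriv DERIV_cmult_right DERIV_ident)
      thus "(h has_field_derivative (logpow j s w - logpow j s (of_nat n))) (at w within ?S)"
        unfolding mult_1 by (rule has_field_derivative_at_within)
      show "norm (logpow j s w - logpow j s (of_nat n)) \<le> C * (real j + norm s) * real n powr (-3/2)"
        by (rule 1[OF s n w])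
    qed auto
    also have "h (of_nat (Suc n)) - h (of_nat n) =
      - (logpow j s (of_nat n) - (logpow_prim j s (of_nat (Suc n)) - logpow_prim j s (of_nat n)))"
      by (simp add: h_def algebra_simps)
    finally show ?thesis by (simp only: norm_minus_cancel) simp
  qed
  show ?thesis by (rule that[OF C(1) 1 2])
qed

text \<open>Each integration by parts divides by 1 - s and multiplies the constant by at most j + 2,
  which produces the factorial over a power of d. The hypothesis d \<le> 1 keeps the constant at
  least 1, so that it absorbs the boundary term.\<close>

lemma norm_logpow_prim_le:
  assumes s: "Re s > 1" and d: "0 < d" "d \<le> 1" "d \<le> norm (1 - s)" and u: "u \<ge> 1"
  shows "norm (logpow_prim j s (of_real u)) \<le> fact (Suc j) / d ^ Suc j * (1 + ln u) ^ j * u powr (1 - Re s)"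
proof (induction j)
  case 0
  have "norm (logpow_prim 0 s (of_real u)) = u powr (1 - Re s) / norm (1 - s)"
    using u by (simp add: norm_divide norm_powr_real_powr)
  also have "\<dots> \<le> u powr (1 - Re s) / d" using d by (intro frac_le) auto
  finally show ?case by simp
next
  case (Suc j)
  have Lnu: "Ln (of_real u) = of_real (ln u)" and l: "ln u \<ge> 0" using u by (simp_all add: Ln_of_real)
  let ?U = "u powr (1 - Re s)"
  let ?F = "fact (Suc j) / d ^ Suc j :: real"
  have F: "?F \<ge> 1"
  proof -
    have "d ^ Suc j \<le> 1" using d by (intro power_le_one) auto
    also have "1 \<le> (fact (Suc j) :: real)" by (rule fact_ge_1)
    finally show ?thesis using d by simp
  qed
  have "norm (Ln (of_real u) ^ Suc j * of_real u powr (1 - s) - of_nat (Suc j) * logpow_prim j s (of_real u))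
    \<le> ln u ^ Suc j * ?U + real (Suc j) * norm (logpow_prim j s (of_real u))"
    unfolding Lnu by (rule order_trans[OF norm_triangle_ineq4])
      (use l u in \<open>simp add: norm_mult norm_power norm_powr_real_powr del: of_nat_Suc power_Suc\<close>)
  also have "\<dots> \<le> (?F * (1 + ln u) ^ Suc j) * ?U + real (Suc j) * (?F * (1 + ln u) ^ Suc j * ?U)"
  proof (intro add_mono mult_left_mono mult_right_mono)
    have "ln u ^ Suc j \<le> (1 + ln u) ^ Suc j" using l by (intro power_mono) auto
    also have "\<dots> = 1 * (1 + ln u) ^ Suc j" by simp
    also have "\<dots> \<le> ?F * (1 + ln u) ^ Suc j" using F l by (intro mult_right_mono) auto
    finally show "ln u ^ Suc j \<le> ?F * (1 + ln u) ^ Suc j" .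
    have "norm (logpow_prim j s (of_real u)) \<le> ?F * (1 + ln u) ^ j * ?U" by (rule Suc)
    also have "\<dots> \<le> ?F * (1 + ln u) ^ Suc j * ?U"
      using F l by (intro mult_left_mono mult_right_mono power_increasing) auto
    finally show "norm (logpow_prim j s (of_real u)) \<le> ?F * (1 + ln u) ^ Suc j * ?U" .
  qed auto
  also have "\<dots> = (real (Suc (Suc j)) * ?F) * (1 + ln u) ^ Suc j * ?U"
    unfolding of_nat_Suc[of "Suc j"] by (simp only: ring_distribs mult_1 mult.assoc)
  finally have 1: "norm (Ln (of_real u) ^ Suc j * of_real u powr (1 - s) - of_nat (Suc j) * logpow_prim j s (of_real u))
    \<le> (real (Suc (Suc j)) * ?F) * (1 + ln u) ^ Suc j * ?U" .
  have "norm (logpow_prim (Suc j) s (of_real u)) \<le> (real (Suc (Suc j)) * ?F) * (1 + ln u) ^ Suc j * ?U / d"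
    unfolding logpow_prim.simps norm_divide
    by (intro frac_le 1 d mult_nonneg_nonneg) (use F l in auto)
  also have "\<dots> = fact (Suc (Suc j)) / d ^ Suc (Suc j) * (1 + ln u) ^ Suc j * ?U"
    by (simp add: field_simps)
  finally show ?case .
qed

lemma logpow_prim_tendsto_0:
  assumes s: "Re s > 1"
  shows "(\<lambda>n. logpow_prim j s (of_nat n)) \<longlonglongrightarrow> 0"
proof -
  define d where "d = min 1 (norm (1 - s))"
  have "s \<noteq> 1" using s by auto
  hence d: "0 < d" "d \<le> 1" "d \<le> norm (1 - s)" by (auto simp: d_def)
  define e where "e = (Re s - 1) / 2"
  have e: "e > 0" using s by (simp add: e_def)
  obtain C where C: "C \<ge> 1" "\<And>x. x \<ge> 1 \<Longrightarrow> (1 + ln x) ^ j \<le> C * x powr e"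
    using log_power_le_powr[OF e] by blast
  have b: "norm (logpow_prim j s (of_nat n)) \<le> fact (Suc j) / d ^ Suc j * C * real n powr (-e)" if "n \<ge> 1" for n
  proof -
    have "norm (logpow_prim j s (of_real (real n))) \<le> fact (Suc j) / d ^ Suc j * (1 + ln (real n)) ^ j * real n powr (1 - Re s)"
      using that by (intro norm_logpow_prim_le s d) auto
    also have "\<dots> \<le> fact (Suc j) / d ^ Suc j * (C * real n powr e) * real n powr (1 - Re s)"
      using that d by (intro mult_right_mono mult_left_mono C) auto
    also have "\<dots> = fact (Suc j) / d ^ Suc j * C * real n powr (e + (1 - Re s))"
      by (simp add: powr_add)
    also have "e + (1 - Re s) = -e" by (simp add: e_def field_simps)
    finally show ?thesis by simp
  qed
  have "(\<lambda>n. real n powr (-e)) \<longlonglongrightarrow> 0"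
    using e by (intro tendsto_neg_powr filterlim_real_sequentially) auto
  from tendsto_mult_right_zero[OF this, of "fact (Suc j) / d ^ Suc j * C"]
  have lim: "(\<lambda>n. fact (Suc j) / d ^ Suc j * C * real n powr (-e)) \<longlonglongrightarrow> 0" .
  have "eventually (\<lambda>n. norm (logpow_prim j s (of_nat n)) \<le> fact (Suc j) / d ^ Suc j * C * real n powr (-e)) sequentially"
    using b by (auto simp: eventually_sequentially intro!: exI[of _ 1])
  from Lim_null_comparison[OF this lim] show ?thesis .
qed

section \<open>Comparison of the zeta series with an integral\<close>

text \<open>Splitting 3/2 = 5/4 + 1/4 gives the tail bound from mere convergence. The exponent -1/4
  is not sharp; cutting later at N of order (1 + \<bar>t\<bar>)^4 makes up for it.\<close>

lemma sum_powr_tail_bound: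
  obtains S :: real where "S \<ge> 0"
    "\<And>N M. N \<ge> 1 \<Longrightarrow> (\<Sum>n=N..<M. real n powr (-3/2)) \<le> S * real N powr (-1/4)"
proof -
  have summ: "summable (\<lambda>n. real n powr (-5/4))" by (simp add: summable_real_powr_iff)
  define S where "S = suminf (\<lambda>n. real n powr (-5/4))"
  show ?thesis
  proof (rule that[of S])
    show "S \<ge> 0" unfolding S_def by (rule suminf_nonneg[OF summ]) auto
    fix N M :: nat assume N: "N \<ge> 1"
    have "(\<Sum>n=N..<M. real n powr (-3/2)) \<le> (\<Sum>n=N..<M. real n powr (-5/4) * real N powr (-1/4))"
    proof (rule sum_mono)
      fix n assume n: "n \<in> {N..<M}"
      have "real n powr (-3/2) = real n powr (-5/4) * real n powr (-1/4)"
        by (simp flip: powr_add)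
      also have "\<dots> \<le> real n powr (-5/4) * real N powr (-1/4)"
        using n N by (intro mult_left_mono powr_mono2') auto
      finally show "real n powr (-3/2) \<le> real n powr (-5/4) * real N powr (-1/4)" .
    qed
    also have "\<dots> = (\<Sum>n=N..<M. real n powr (-5/4)) * real N powr (-1/4)" by (simp add: sum_distrib_right)
    also have "\<dots> \<le> S * real N powr (-1/4)"
      unfolding S_def by (intro mult_right_mono sum_le_suminf summ) auto
    finally show "(\<Sum>n=N..<M. real n powr (-3/2)) \<le> S * real N powr (-1/4)" .
  qed
qed

text \<open>The tail from N on is replaced by its integral, which is
  -\<open>logpow_prim j s N\<close> because the antiderivative vanishes at infinity; the errors of
  the single terms add up. The constant depends on j alone.\<close>

lemma zeta_deriv_approx:
  obtains C where "C \<ge> 0"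
    "\<And>s N. Re s > 1 \<Longrightarrow> N \<ge> 1 \<Longrightarrow>
       norm (dsum one_c j s - ((\<Sum>n<N. dterm one_c j s n) - logpow_prim j s (of_nat N)))
         \<le> C * (real j + norm s) * real N powr (-1/4)"
proof -
  obtain C where C: "C \<ge> 0"
    "\<And>s n. Re s > 1 \<Longrightarrow> n \<ge> 1 \<Longrightarrow>
       norm (logpow j s (of_nat n) - (logpow_prim j s (of_nat (Suc n)) - logpow_prim j s (of_nat n)))
         \<le> C * (real j + norm s) * real n powr (-3/2)"
    using logpow_diff_bound[of j] by metis
  obtain S where S: "S \<ge> 0" "\<And>N M. N \<ge> 1 \<Longrightarrow> (\<Sum>n=N..<M. real n powr (-3/2)) \<le> S * real N powr (-1/4)"
    using sum_powr_tail_bound by blast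
  show ?thesis
  proof (rule that[of "C * S"])
    show "C * S \<ge> 0" using C S by simp
    fix s :: complex and N :: nat assume s: "Re s > 1" and N: "N \<ge> 1"
    let ?g = "\<lambda>n. logpow_prim j s (of_nat n)"
    let ?X = "\<lambda>M. (\<Sum>n<M. dterm one_c j s n) - ?g M - ((\<Sum>n<N. dterm one_c j s n) - ?g N)"
    have "dterm one_c j s sums dsum one_c j s" by (rule dsum_sums[OF s, of _ 1]) auto
    hence "(\<lambda>M. norm (?X M)) \<longlonglongrightarrow> norm (dsum one_c j s - 0 - ((\<Sum>n<N. dterm one_c j s n) - ?g N))"
      unfolding sums_def by (intro tendsto_norm tendsto_diff tendsto_const logpow_prim_tendsto_0[OF s])
    moreover have "norm (?X M) \<le> C * S * (real j + norm s) * real N powr (-1/4)" if M: "M \<ge> N" for M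
    proof -
      have "?X M = (\<Sum>n=N..<M. dterm one_c j s n - (?g (Suc n) - ?g n))"
        using M by (induction M rule: dec_induct) (simp_all add: algebra_simps)
      also have "norm \<dots> \<le> (\<Sum>n=N..<M. C * (real j + norm s) * real n powr (-3/2))"
        using N by (intro sum_norm_le) (use C(2)[OF s] in \<open>auto simp: dterm_one_eq_logpow\<close>)
      also have "\<dots> = C * (real j + norm s) * (\<Sum>n=N..<M. real n powr (-3/2))"
        by (simp add: sum_distrib_left)
      also have "\<dots> \<le> C * (real j + norm s) * (S * real N powr (-1/4))"
        using C(1) by (intro mult_left_mono S N) auto
      finally show ?thesis by (simp add: mult_ac)
    qed
    ultimately show "norm (dsum one_c j s - ((\<Sum>n<N. dterm one_c j s n) - ?g N))
        \<le> C * S * (real j + norm s) * real N powr (-1/4)"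
      by (intro LIMSEQ_le_const2[where X = "\<lambda>M. norm (?X M)"]) auto
  qed
qed

lemma zeta_pole_approx:
  obtains A where "A > 0" "\<And>s. Re s > 1 \<Longrightarrow> norm s \<le> 3 \<Longrightarrow> norm (dsum one_c 0 s - 1 / (s - 1)) \<le> A"
proof -
  obtain C where C: "C \<ge> 0"
    "\<And>s N. Re s > 1 \<Longrightarrow> N \<ge> 1 \<Longrightarrow>
       norm (dsum one_c 0 s - ((\<Sum>n<N. dterm one_c 0 s n) - logpow_prim 0 s (of_nat N)))
         \<le> C * (real 0 + norm s) * real N powr (-1/4)"
    using zeta_deriv_approx[of 0] by blast
  show ?thesis
  \<comment> \<open>The extra 1 makes the constant strictly positive, since its reciprocal is taken
    later.\<close>
  proof (rule that[of "C * 3 + 1"])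
    fix s :: complex assume s: "Re s > 1" "norm s \<le> 3"
    have "norm (dsum one_c 0 s - 1 / (s - 1)) \<le> C * norm s"
    proof -
      \<comment> \<open>For N = 1 the partial sum holds only the vanishing term n = 0, so the
        integral alone remains, and it is the pole.\<close>
      have "(\<Sum>n<1. dterm one_c 0 s n) - logpow_prim 0 s (of_nat 1) = - (1 / (1 - s))" by simp
      also have "\<dots> = 1 / (s - 1)" by (metis minus_diff_eq minus_divide_right)
      finally show ?thesis using C(2)[OF s(1), of 1] by simp
    qed
    also have "\<dots> \<le> C * 3" using s C by (intro mult_left_mono) auto
    finally show "norm (dsum one_c 0 s - 1 / (s - 1)) \<le> C * 3 + 1" by simp
  qed (use C in auto)
qed

section \<open>Growth of zeta and its derivatives in vertical direction\<close>

definition tlog :: "real \<Rightarrow> real" where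
  "tlog t = 1 + ln (1 + \<bar>t\<bar>)"

lemma tlog_ge_1: "tlog t \<ge> 1"
  by (simp add: tlog_def)

lemma tlog_double: "tlog (2 * t) \<le> 2 * tlog t"
proof -
  have "ln (1 + \<bar>2 * t\<bar>) \<le> ln (2 * (1 + \<bar>t\<bar>))" by (subst ln_le_cancel_iff) auto
  also have "\<dots> = ln 2 + ln (1 + \<bar>t\<bar>)"
    using ln_mult[of 2 "1 + \<bar>t\<bar>"] by (simp del: distrib_left_numeral)
  also have "ln 2 \<le> (1::real)" using ln_2_less_1 by simp
  finally have "ln (1 + \<bar>2 * t\<bar>) \<le> 1 + ln (1 + \<bar>t\<bar>)" by simp
  moreover have "ln (1 + \<bar>t\<bar>) \<ge> 0" by simp
  ultimately show ?thesis unfolding tlog_def distrib_left by linarith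
qed

lemma sum_dterm_one_le:
  assumes "Re s > 1" "N \<ge> 1"
  shows "norm (\<Sum>n<N. dterm one_c j s n) \<le> (1 + ln (real N)) ^ Suc j"
proof -
  have l: "ln (real N) \<ge> 0" using assms by simp
  have "norm (\<Sum>n<N. dterm one_c j s n) \<le> (\<Sum>n\<in>{1..<N}. (1 + ln (real N)) ^ j * inverse (real n))"
  proof -
    have "(\<Sum>n<N. dterm one_c j s n) = (\<Sum>n\<in>{1..<N}. dterm one_c j s n)"
      by (rule sum.mono_neutral_right) (auto simp: not_le)
    also have "norm \<dots> \<le> (\<Sum>n\<in>{1..<N}. (1 + ln (real N)) ^ j * inverse (real n))"
    proof (rule sum_norm_le)
      fix n assume n: "n \<in> {1..<N}"
      have "norm (dterm one_c j s n) = ln (real n) ^ j * real n powr (-Re s)"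
        using n by (simp add: norm_dterm)
      also have "\<dots> \<le> (1 + ln (real N)) ^ j * real n powr (-1)"
      proof (intro mult_mono power_mono powr_mono)
        have "ln (real n) \<le> ln (real N)" using n by (subst ln_le_cancel_iff) auto
        thus "ln (real n) \<le> 1 + ln (real N)" by simp
      qed (use n assms l in auto)
      finally show "norm (dterm one_c j s n) \<le> (1 + ln (real N)) ^ j * inverse (real n)"
        using n by (simp add: powr_minus)
    qed
    finally show ?thesis .
  qed
  also have "\<dots> = (1 + ln (real N)) ^ j * (\<Sum>n\<in>{1..<N}. inverse (real n))" by (simp add: sum_distrib_left)
  also have "\<dots> \<le> (1 + ln (real N)) ^ j * harm N"
    unfolding harm_def using l by (intro mult_left_mono sum_mono2) auto
  also have "\<dots> \<le> (1 + ln (real N)) ^ j * (1 + ln (real N))"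
    using l assms euler_mascheroni_sequence_decreasing[of 1 N] by (intro mult_left_mono) (auto simp: harm_expand)
  finally show ?thesis by (simp add: mult.commute)
qed

text \<open>
  Cutting the series at \<open>N\<close> of size \<open>(1 + \<bar>t\<bar>)^4\<close> makes the error term of the comparison with the
  integral bounded.
\<close>

lemma zeta_deriv_bound:
  assumes d: "0 < d" "d \<le> 1"
  obtains C where "C \<ge> 1"
    "\<And>\<sigma> t. 1 < \<sigma> \<Longrightarrow> \<sigma> \<le> 2 \<Longrightarrow> d \<le> \<bar>t\<bar> \<Longrightarrow> norm (dsum one_c j (Complex \<sigma> t)) \<le> C * tlog t ^ Suc j"
proof -
  obtain C where C: "C \<ge> 0"
    "\<And>s N. Re s > 1 \<Longrightarrow> N \<ge> 1 \<Longrightarrow>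
       norm (dsum one_c j s - ((\<Sum>n<N. dterm one_c j s n) - logpow_prim j s (of_nat N)))
         \<le> C * (real j + norm s) * real N powr (-1/4)"
    using zeta_deriv_approx[of j] by blast
  \<comment> \<open>The pole enters only here, through the negative powers of 1 - s in the
    antiderivative.\<close>
  define B where "B = fact (Suc j) / d ^ Suc j"
  have B: "B \<ge> 0" using d by (simp add: B_def)
  define D where "D = C * (real j + 2) + (1 + B) * 4 ^ Suc j"
  show ?thesis
  proof (rule that[of D])
    have "1 * 1 \<le> (1 + B) * (4::real) ^ Suc j" using B by (intro mult_mono one_le_power) auto
    moreover have "0 \<le> C * (real j + 2)" using C(1) by simp
    ultimately show "D \<ge> 1" unfolding D_def by linarith
    fix \<sigma> t :: real assume \<sigma>: "1 < \<sigma>" "\<sigma> \<le> 2" and t: "d \<le> \<bar>t\<bar>"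
    define s where "s = Complex \<sigma> t"
    have s: "Re s > 1" using \<sigma> by (simp add: s_def)
    define T where "T = 1 + \<bar>t\<bar>"
    have T: "T \<ge> 1" by (simp add: T_def)
    define N where "N = nat \<lceil>T ^ 4\<rceil>"
    have T4: "T ^ 4 \<ge> 1" using T by simp
    have N: "real N \<ge> T ^ 4" "real N \<le> 2 * T ^ 4" using T4 unfolding N_def by linarith+
    have N1: "N \<ge> 1" using N T4 by linarith
    have lnN: "1 + ln (real N) \<le> 4 * tlog t"
    proof -
      have "ln (real N) \<le> ln (2 * T ^ 4)" using N N1 T by (subst ln_le_cancel_iff) auto
      also have "\<dots> = ln 2 + 4 * ln T" using T by (simp add: ln_mult ln_realpow)
      finally show ?thesis using ln_2_less_1 by (simp add: tlog_def T_def)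
    qed
    have l0: "1 + ln (real N) \<ge> 1" using N1 by simp
    have ns: "norm s \<le> 2 * T"
      using cmod_le[of s] \<sigma> by (simp add: s_def T_def)
    have dn: "d \<le> norm (1 - s)" using t abs_Im_le_cmod[of "1 - s"] by (simp add: s_def)
    have "real N powr (-1/4) \<le> (T ^ 4) powr (-1/4)" using N T4 by (intro powr_mono2') auto
    also have "\<dots> = T powr (-1)" using T by (simp add: powr_powr flip: powr_numeral)
    finally have Np: "real N powr (-1/4) \<le> 1 / T" using T by (simp add: powr_minus_divide)
    have "C * (real j + norm s) * real N powr (-1/4) \<le> C * (real j * T + 2 * T) * (1 / T)"
    proof (intro mult_mono mult_left_mono add_mono Np ns)
      show "real j \<le> real j * T" using T by (simp add: mult_le_cancel_left1)
    qed (use C T in auto)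
    also have "\<dots> = C * (real j + 2)" using T by (simp add: field_simps)
    finally have e1: "C * (real j + norm s) * real N powr (-1/4) \<le> C * (real j + 2) * 1" by simp
    have e2: "norm (\<Sum>n<N. dterm one_c j s n) \<le> (1 + ln (real N)) ^ Suc j"
      by (rule sum_dterm_one_le[OF s N1])
    have e3: "norm (logpow_prim j s (of_nat N)) \<le> B * (1 + ln (real N)) ^ Suc j"
    proof -
      have "norm (logpow_prim j s (of_real (real N))) \<le> B * (1 + ln (real N)) ^ j * real N powr (1 - Re s)"
        unfolding B_def using N1 by (intro norm_logpow_prim_le s d dn) auto
      also have "\<dots> \<le> B * (1 + ln (real N)) ^ j * 1"
      proof (rule mult_left_mono)
        have "real N powr (1 - Re s) \<le> real N powr 0" using N1 s by (intro powr_mono) auto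
        thus "real N powr (1 - Re s) \<le> 1" using N1 by simp
      qed (use B l0 in auto)
      also have "\<dots> \<le> B * (1 + ln (real N)) ^ Suc j * 1"
        using l0 B by (intro mult_left_mono mult_right_mono power_increasing) auto
      finally show ?thesis by simp
    qed
    have "norm (dsum one_c j s) \<le> norm (dsum one_c j s - ((\<Sum>n<N. dterm one_c j s n) - logpow_prim j s (of_nat N)))
       + norm ((\<Sum>n<N. dterm one_c j s n) - logpow_prim j s (of_nat N))"
      by (metis norm_triangle_sub add.commute)
    also have "\<dots> \<le> C * (real j + 2) * 1 + ((1 + ln (real N)) ^ Suc j + B * (1 + ln (real N)) ^ Suc j)"
      by (intro add_mono order_trans[OF C(2)[OF s N1] e1] order_trans[OF norm_triangle_ineq4 add_mono[OF e2 e3]])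
    also have "\<dots> = C * (real j + 2) * 1 + (1 + B) * (1 + ln (real N)) ^ Suc j" by (simp add: algebra_simps)
    also have "\<dots> \<le> C * (real j + 2) * tlog t ^ Suc j + (1 + B) * (4 * tlog t) ^ Suc j"
      using lnN l0 C B tlog_ge_1 by (intro add_mono mult_left_mono power_mono one_le_power) auto
    also have "\<dots> = D * tlog t ^ Suc j" by (simp add: D_def power_mult_distrib algebra_simps)
    finally show "norm (dsum one_c j (Complex \<sigma> t)) \<le> D * tlog t ^ Suc j" by (simp add: s_def)
  qed
qed


section \<open>The reciprocal of the zeta function\<close>

lemma zeta_has_field_derivative:
  assumes s: "Re s > 1"
  shows "(dsum one_c 0 has_field_derivative (- dsum one_c 1 s)) (at s)"
proof -
  \<comment> \<open>Any abscissa strictly between 1 and Re s serves: the differentiated series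
    converges uniformly to the right of it and s is an interior point.\<close>
  define a where "a = (1 + Re s) / 2"
  have a: "1 < a" "a < Re s" using s by (auto simp: a_def)
  define S where "S = {z::complex. a \<le> Re z}"
  have conv: "convex S" unfolding S_def by (rule convex_halfspace_Re_ge)
  have int: "{z. a < Re z} \<subseteq> interior S"
    by (rule interior_maximal) (auto simp: S_def open_halfspace_Re_gt)
  have "((\<lambda>z. \<Sum>n. dterm one_c 0 z n) has_field_derivative (\<Sum>n. - dterm one_c 1 s n)) (at s)"
  proof (rule has_field_derivative_series'(2)[where S = S])
    show "convex S" by (rule conv)
    show "((\<lambda>z. dterm one_c 0 z n) has_field_derivative - dterm one_c 1 z n) (at z within S)" for n z
    proof (cases "n = 0")
      case False
      have "((\<lambda>z. of_nat n powr (- z)) has_field_derivative (Ln (of_nat n) * of_nat n powr (-z)) * (-1)) (at z within S)"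
        using False by (intro DERIV_chain'[OF _ has_field_derivative_powr_right] derivative_eq_intros) auto
      thus ?thesis using False by (simp add: dterm_def[abs_def])
    qed auto
    show "uniformly_convergent_on S (\<lambda>n z. \<Sum>i<n. - dterm one_c 1 z i)"
    proof (rule Weierstrass_m_test')
      show "summable (\<lambda>n. norm (dterm one_c 1 (of_real a) n))"
        by (rule summable_norm_dterm[of _ _ 1]) (use a in auto)
      show "norm (- dterm one_c 1 z n) \<le> norm (dterm one_c 1 (of_real a) n)" if "z \<in> S" for n z
      proof (cases "n = 0")
        case False
        thus ?thesis using that by (auto simp: norm_dterm S_def intro!: mult_left_mono powr_mono)
      qed auto
    qed
    show "of_real a \<in> S" by (simp add: S_def)
    have "dterm one_c 0 (of_real a) sums dsum one_c 0 (of_real a)"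
      by (rule dsum_sums[of _ _ 1]) (use a in auto)
    thus "summable (\<lambda>n. dterm one_c 0 (of_real a) n)" by (rule sums_summable)
    show "s \<in> interior S" using int a by auto
  qed
  also have "(\<Sum>n. - dterm one_c 1 s n) = - dsum one_c 1 s"
    using dsum_sums[OF s, of one_c 1 1] by (intro sums_unique[symmetric] sums_minus) auto
  finally show ?thesis
  proof (rule has_field_derivative_transform_within_open)
    show "open {z. 1 < Re z}" by (rule open_halfspace_Re_gt)
    show "(\<Sum>n. dterm one_c 0 z n) = dsum one_c 0 z" if "z \<in> {z. 1 < Re z}" for z
      using dsum_sums[of z one_c 1 0] that by (intro sums_unique[symmetric]) auto
  qed (use s in auto)
qed

lemma zeta_increment_bound:
  assumes "1 < \<sigma>" "\<sigma> \<le> \<sigma>'"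
    and "\<And>x. \<sigma> \<le> x \<Longrightarrow> x \<le> \<sigma>' \<Longrightarrow> norm (dsum one_c 1 (Complex x t)) \<le> Y"
  shows "norm (dsum one_c 0 (Complex \<sigma>' t) - dsum one_c 0 (Complex \<sigma> t)) \<le> Y * (\<sigma>' - \<sigma>)"
proof -
  let ?S = "closed_segment (Complex \<sigma> t) (Complex \<sigma>' t)"
  have "norm (dsum one_c 0 (Complex \<sigma>' t) - dsum one_c 0 (Complex \<sigma> t)) \<le>
      Y * norm (Complex \<sigma>' t - Complex \<sigma> t)"
  proof (rule field_differentiable_bound[where S = ?S])
    fix z assume "z \<in> ?S"
    then obtain v where v: "0 \<le> v" "v \<le> 1" "z = (1 - v) *\<^sub>R Complex \<sigma> t + v *\<^sub>R Complex \<sigma>' t"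
      by (auto simp: in_segment)
    define x where "x = \<sigma> + v * (\<sigma>' - \<sigma>)"
    have z: "z = Complex x t" by (simp add: v complex_eq_iff x_def algebra_simps)
    have "0 \<le> v * (\<sigma>' - \<sigma>)" "v * (\<sigma>' - \<sigma>) \<le> 1 * (\<sigma>' - \<sigma>)"
      using mult_right_mono[of v 1 "\<sigma>' - \<sigma>"] v assms(2) by simp_all
    hence x: "\<sigma> \<le> x" "x \<le> \<sigma>'" by (auto simp: x_def)
    show "(dsum one_c 0 has_field_derivative - dsum one_c 1 z) (at z within ?S)"
      by (rule has_field_derivative_at_within[OF zeta_has_field_derivative]) (use x assms z in auto)
    show "norm (- dsum one_c 1 z) \<le> Y" unfolding z using assms(3)[OF x] by simp
  qed auto
  also have "Complex \<sigma>' t - Complex \<sigma> t = of_real (\<sigma>' - \<sigma>)" by (simp add: complex_eq_iff)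
  also have "norm \<dots> = \<sigma>' - \<sigma>" using assms(2) by (simp only: norm_of_real)
  finally show ?thesis .
qed

lemma zeta_real_bound:
  obtains B where "B \<ge> 1" "\<And>\<sigma>. 1 < \<sigma> \<Longrightarrow> \<sigma> \<le> 2 \<Longrightarrow> norm (dsum one_c 0 (of_real \<sigma>)) \<le> B / (\<sigma> - 1)"
proof -
  obtain A where A: "A > 0" "\<And>s. Re s > 1 \<Longrightarrow> norm s \<le> 3 \<Longrightarrow> norm (dsum one_c 0 s - 1 / (s - 1)) \<le> A"
    using zeta_pole_approx by blast
  show ?thesis
  proof (rule that[of "1 + A"])
    fix \<sigma> :: real assume \<sigma>: "1 < \<sigma>" "\<sigma> \<le> 2"
    have "norm (dsum one_c 0 (of_real \<sigma>)) \<le> norm (1 / (of_real \<sigma> - 1 :: complex)) + A"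
      using A(2)[of "of_real \<sigma>"] \<sigma> norm_triangle_sub[of "dsum one_c 0 (of_real \<sigma>)" "1 / (of_real \<sigma> - 1)"] by simp
    also have "1 / (of_real \<sigma> - 1 :: complex) = of_real (1 / (\<sigma> - 1))" by simp
    also have "norm \<dots> = 1 / (\<sigma> - 1)" using \<sigma> by (simp only: norm_of_real) simp
    also have "1 / (\<sigma> - 1) + A \<le> (1 + A) / (\<sigma> - 1)"
    proof -
      have "A * (\<sigma> - 1) \<le> A * 1" using \<sigma> A by (intro mult_left_mono) auto
      hence "A \<le> A / (\<sigma> - 1)" using \<sigma> by (simp add: le_divide_eq)
      thus ?thesis by (simp add: add_divide_distrib)
    qed
    finally show "norm (dsum one_c 0 (of_real \<sigma>)) \<le> (1 + A) / (\<sigma> - 1)" .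
  qed (use A in auto)
qed

text \<open>The classical combination of the 3-4-1 inequality with a bound for the derivative.
  Stating it as 1 \<le> ... without division includes that \<zeta> does not vanish.\<close>

lemma inverse_zeta_bound:
  assumes d: "0 < d" "d \<le> 1"
  obtains C m where "C \<ge> 1"
    "\<And>\<sigma> t. 1 < \<sigma> \<Longrightarrow> \<sigma> \<le> 2 \<Longrightarrow> d \<le> \<bar>t\<bar> \<Longrightarrow> 1 \<le> C * tlog t ^ m * norm (dsum one_c 0 (Complex \<sigma> t))"
proof -
  obtain B where B: "B \<ge> 1" "\<And>\<sigma>. 1 < \<sigma> \<Longrightarrow> \<sigma> \<le> 2 \<Longrightarrow> norm (dsum one_c 0 (of_real \<sigma>)) \<le> B / (\<sigma> - 1)"
    using zeta_real_bound by blast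
  obtain C0 where C0: "C0 \<ge> 1" "\<And>\<sigma> t. 1 < \<sigma> \<Longrightarrow> \<sigma> \<le> 2 \<Longrightarrow> d \<le> \<bar>t\<bar> \<Longrightarrow>
      norm (dsum one_c 0 (Complex \<sigma> t)) \<le> C0 * tlog t ^ Suc 0"
    using zeta_deriv_bound[OF d, of 0] by blast
  obtain C1 where C1: "C1 \<ge> 1" "\<And>\<sigma> t. 1 < \<sigma> \<Longrightarrow> \<sigma> \<le> 2 \<Longrightarrow> d \<le> \<bar>t\<bar> \<Longrightarrow>
      norm (dsum one_c 1 (Complex \<sigma> t)) \<le> C1 * tlog t ^ Suc 1"
    using zeta_deriv_bound[OF d, of 1] by blast
  define C where "C = 2 * C0 + C1"
  have C: "C \<ge> 1" using C0 C1 by (simp add: C_def)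
  show ?thesis
  proof (rule that[of "16 * B ^ 3 * C ^ 4" "8"])
    have "1 * 1 * 1 \<le> 16 * B ^ 3 * C ^ 4" using B C by (intro mult_mono one_le_power) auto
    thus "1 \<le> 16 * B ^ 3 * C ^ 4" by simp
    fix \<sigma> t :: real assume \<sigma>: "1 < \<sigma>" "\<sigma> \<le> 2" and t: "d \<le> \<bar>t\<bar>"
    let ?L = "tlog t"
    have L: "?L \<ge> 1" by (rule tlog_ge_1)
    \<comment> \<open>One quantity dominates both \<zeta> at ordinate 2 t, linear in
      \<open>tlog t\<close>, and the derivative at ordinate t, quadratic in it. The final bound
      contains Y^4, hence the exponent 8.\<close>
    define Y where "Y = C * ?L ^ 2"
    have LL: "?L \<le> ?L ^ 2" using L by (simp add: power2_eq_square)
    have Y1: "Y \<ge> 1"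
    proof -
      have "1 * 1 \<le> Y" unfolding Y_def using C L by (intro mult_mono one_le_power) auto
      thus ?thesis by simp
    qed
    have Z2: "norm (dsum one_c 0 (Complex x (2 * t))) \<le> Y" if "1 < x" "x \<le> 2" for x
    proof -
      have "norm (dsum one_c 0 (Complex x (2 * t))) \<le> C0 * tlog (2 * t)" using C0(2)[of x "2 * t"] that t by simp
      also have "\<dots> \<le> C0 * (2 * ?L)" using C0 by (intro mult_left_mono tlog_double) auto
      also have "\<dots> = (2 * C0) * ?L" by simp
      also have "\<dots> \<le> C * ?L ^ 2" using C0 C1 L LL by (intro mult_mono) (auto simp: C_def)
      finally show ?thesis by (simp add: Y_def)
    qed
    have Z1: "norm (dsum one_c 1 (Complex x t)) \<le> Y" if "1 < x" "x \<le> 2" for x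
    proof -
      have "norm (dsum one_c 1 (Complex x t)) \<le> C1 * ?L ^ 2"
        using C1(2)[of x t] that t by (simp add: power2_eq_square)
      also have "\<dots> \<le> C * ?L ^ 2" using C0 C1 by (intro mult_right_mono) (auto simp: C_def)
      finally show ?thesis by (simp add: Y_def)
    qed
    \<comment> \<open>To the right of \<open>1 + \<theta>\<close> the 3-4-1 inequality gives \<open>\<bar>\<zeta>\<bar> \<ge> 2 \<theta> Y\<close>; moving left by at most
      \<open>\<theta>\<close> costs at most \<open>\<theta> Y\<close>.\<close>
    define \<theta> where "\<theta> = 1 / (16 * B ^ 3 * Y ^ 5)"
    have B3: "B ^ 3 \<ge> 1" using B by simp
    have Y5: "Y ^ 5 \<ge> 1" using Y1 by simp
    have BY: "1 * 1 \<le> B ^ 3 * Y ^ 5" using B3 Y5 B Y1 by (intro mult_mono) auto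
    have \<theta>: "0 < \<theta>" "\<theta> \<le> 1" using BY by (auto simp: \<theta>_def)
    have \<theta>Y: "16 * B ^ 3 * Y ^ 5 * \<theta> = 1" using BY B Y1 by (auto simp: \<theta>_def)
    define \<sigma>' where "\<sigma>' = max \<sigma> (1 + \<theta>)"
    have \<sigma>': "1 < \<sigma>'" "\<sigma>' \<le> 2" "\<sigma> \<le> \<sigma>'" "\<theta> \<le> \<sigma>' - 1" "\<sigma>' - \<sigma> \<le> \<theta>"
      using \<sigma> \<theta> by (auto simp: \<sigma>'_def)
    define x where "x = norm (dsum one_c 0 (Complex \<sigma>' t))"
    have x0: "x \<ge> 0" by (simp add: x_def)
    \<comment> \<open>Otherwise the 3-4-1 product would be smaller than (B / \<theta>)^3 (2 \<theta>
      Y)^4 Y = 16 B^3 Y^5 \<theta>, and \<theta> is chosen to make this exactly 1.\<close>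
    have x: "x \<ge> 2 * \<theta> * Y"
    proof (rule ccontr)
      assume "\<not> x \<ge> 2 * \<theta> * Y"
      hence lt: "x < 2 * \<theta> * Y" by simp
      have "1 \<le> norm (dsum one_c 0 (of_real \<sigma>')) ^ 3 * x ^ 4 * norm (dsum one_c 0 (Complex \<sigma>' (2 * t)))"
        unfolding x_def by (rule zeta_three_four_one[OF \<sigma>'(1)])
      also have "\<dots> \<le> (B / \<theta>) ^ 3 * x ^ 4 * Y"
      proof (intro mult_mono power_mono order_refl)
        have "norm (dsum one_c 0 (of_real \<sigma>')) \<le> B / (\<sigma>' - 1)" using \<sigma>' by (intro B) auto
        also have "\<dots> \<le> B / \<theta>" using \<sigma>' \<theta> B by (intro divide_left_mono mult_pos_pos) auto
        finally show "norm (dsum one_c 0 (of_real \<sigma>')) \<le> B / \<theta>" .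
      qed (use Z2 \<sigma>' B \<theta> x0 in auto)
      also have "\<dots> < (B / \<theta>) ^ 3 * (2 * \<theta> * Y) ^ 4 * Y"
        using lt x0 B \<theta> Y1 by (intro mult_strict_right_mono mult_strict_left_mono power_strict_mono) auto
      also have "\<dots> = 16 * B ^ 3 * Y ^ 5 * \<theta>"
        using \<theta> by (simp add: field_simps eval_nat_numeral)
      finally show False using \<theta>Y by simp
    qed
    have "x - norm (dsum one_c 0 (Complex \<sigma> t)) \<le> norm (dsum one_c 0 (Complex \<sigma>' t) - dsum one_c 0 (Complex \<sigma> t))"
      unfolding x_def by (rule norm_triangle_ineq2)
    also have "\<dots> \<le> Y * (\<sigma>' - \<sigma>)"
      using \<sigma> \<sigma>' by (intro zeta_increment_bound Z1) auto
    also have "\<dots> \<le> Y * \<theta>" using \<sigma>' Y1 by (intro mult_left_mono) auto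
    finally have low: "\<theta> * Y \<le> norm (dsum one_c 0 (Complex \<sigma> t))" using x by (simp add: mult_ac)
    have "1 = 16 * B ^ 3 * Y ^ 4 * (\<theta> * Y)" using \<theta>Y by (simp add: eval_nat_numeral mult_ac)
    also have "\<dots> \<le> 16 * B ^ 3 * Y ^ 4 * norm (dsum one_c 0 (Complex \<sigma> t))"
      using low B Y1 by (intro mult_left_mono) auto
    also have "Y ^ 4 = C ^ 4 * ?L ^ 8" by (simp add: Y_def power_mult_distrib flip: power_mult)
    finally show "1 \<le> 16 * B ^ 3 * C ^ 4 * ?L ^ 8 * norm (dsum one_c 0 (Complex \<sigma> t))"
      by (simp add: mult_ac)
  qed
qed

text \<open>
  Consecutive terms of the alternating series are paired.
\<close>

lemma eta_deriv_bound:
  obtains C where "C \<ge> 0" "\<And>s. Re s > 1 \<Longrightarrow> norm s \<le> 3 \<Longrightarrow> norm (dsum alt_c j s) \<le> C"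
proof -
  obtain C where C: "C \<ge> 0"
    "\<And>s n z. Re s > 1 \<Longrightarrow> n \<ge> 1 \<Longrightarrow> z \<in> closed_segment (of_nat n) (of_nat (Suc n)) \<Longrightarrow>
       norm (logpow j s z - logpow j s (of_nat n)) \<le> C * (real j + norm s) * real n powr (-3/2)"
    using logpow_diff_bound[of j] by metis
  obtain S where S: "S \<ge> 0" "\<And>N M. N \<ge> 1 \<Longrightarrow> (\<Sum>n=N..<M. real n powr (-3/2)) \<le> S * real N powr (-1/4)"
    using sum_powr_tail_bound by blast
  show ?thesis
  proof (rule that[of "C * (real j + 3) * S"])
    show "C * (real j + 3) * S \<ge> 0" using C S by simp
    fix s :: complex assume s: "Re s > 1" "norm s \<le> 3"
    let ?f = "\<lambda>n. logpow j s (of_nat n)"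
    \<comment> \<open>The term n = 0 vanishes, so the indices below 2 M + 1 are exactly M pairs (2 m
      + 1, 2 m + 2).\<close>
    have pair: "(\<Sum>n<2*M+1. dterm alt_c j s n) = (\<Sum>m<M. ?f (2*m+1) - ?f (2*m+2))" for M
    proof (induction M)
      case (Suc M)
      have "dterm alt_c j s (2*M+1) = ?f (2*M+1)" "dterm alt_c j s (2*M+2) = - ?f (2*M+2)"
        by (simp_all add: dterm_def alt_c_def logpow_def Ln_of_nat del: of_nat_add of_nat_mult of_nat_Suc)
      thus ?case using Suc by simp
    qed simp
    have b: "norm (\<Sum>n<2*M+1. dterm alt_c j s n) \<le> C * (real j + 3) * S" for M
    proof -
      have "norm (\<Sum>n<2*M+1. dterm alt_c j s n) \<le> (\<Sum>m<M. C * (real j + 3) * real (Suc m) powr (-3/2))"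
        unfolding pair
      proof (rule sum_norm_le)
        fix m assume "m \<in> {..<M}"
        have "norm (?f (2*m+1) - ?f (2*m+2)) = norm (?f (Suc (2*m+1)) - ?f (2*m+1))"
          by (simp add: norm_minus_commute)
        also have "\<dots> \<le> C * (real j + norm s) * real (2*m+1) powr (-3/2)"
          by (intro C s) auto
        also have "\<dots> \<le> C * (real j + 3) * real (Suc m) powr (-3/2)"
          using C s by (intro mult_mono mult_left_mono add_left_mono powr_mono2') auto
        finally show "norm (?f (2*m+1) - ?f (2*m+2)) \<le> C * (real j + 3) * real (Suc m) powr (-3/2)" .
      qed
      also have "\<dots> = C * (real j + 3) * (\<Sum>m<M. real (Suc m) powr (-3/2))" by (simp add: sum_distrib_left)
      also have "(\<Sum>m<M. real (Suc m) powr (-3/2)) = (\<Sum>n=1..<Suc M. real n powr (-3/2))"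
        by (rule sum.reindex_bij_witness[of _ "\<lambda>n. n - 1" Suc]) auto
      also have "C * (real j + 3) * \<dots> \<le> C * (real j + 3) * (S * real 1 powr (-1/4))"
        using C by (intro mult_left_mono S) auto
      finally show ?thesis by simp
    qed
    have "dterm alt_c j s sums dsum alt_c j s" by (rule dsum_sums[OF s(1) norm_alt_c_le])
    hence "(\<lambda>N. \<Sum>n<N. dterm alt_c j s n) \<longlonglongrightarrow> dsum alt_c j s" by (simp add: sums_def)
    moreover have "strict_mono (\<lambda>M::nat. 2 * M + 1)" by (rule strict_monoI) auto
    ultimately have "(\<lambda>M. \<Sum>n<2*M+1. dterm alt_c j s n) \<longlonglongrightarrow> dsum alt_c j s"
      using LIMSEQ_subseq_LIMSEQ by (fastforce simp: o_def)
    thus "norm (dsum alt_c j s) \<le> C * (real j + 3) * S"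
      using b by (intro Lim_bounded[OF tendsto_norm]) auto
  qed
qed

section \<open>Uniform bounds for the weighted Moebius series\<close>

text \<open>
  For \<open>F B = P\<close> read as an identity between power series with divided-power coefficients, this bounds
  the coefficients of the quotient \<open>F = P / B\<close>.
\<close>

lemma leibniz_quotient_bound:
  obtains c :: real where "c \<ge> 0"
    "\<And>(F :: nat \<Rightarrow> complex) B P Y. (\<And>k. (\<Sum>j\<le>k. of_nat (k choose j) * (F j * B (k - j))) = P k) \<Longrightarrow>
       1 \<le> Y \<Longrightarrow> (\<And>j. j \<le> K \<Longrightarrow> norm (B j) \<le> Y) \<Longrightarrow> (\<And>j. j \<le> K \<Longrightarrow> norm (P j) \<le> Y) \<Longrightarrow>
       1 \<le> Y * norm (B 0) \<Longrightarrow> norm (F K) \<le> c * Y ^ (2 * K + 2)"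
proof -
  \<comment> \<open>The induction needs the bound for all indices up to K, with c chosen before the
    sequences. Each further index costs two factors Y: one for the values of B and one for dividing
    by B 0.\<close>
  have "\<exists>c\<ge>0. \<forall>(F :: nat \<Rightarrow> complex) B P Y. (\<forall>k. (\<Sum>j\<le>k. of_nat (k choose j) * (F j * B (k - j))) = P k) \<longrightarrow>
       1 \<le> Y \<longrightarrow> (\<forall>j\<le>K. norm (B j) \<le> Y) \<longrightarrow> (\<forall>j\<le>K. norm (P j) \<le> Y) \<longrightarrow>
       1 \<le> Y * norm (B 0) \<longrightarrow> (\<forall>j\<le>K. norm (F j) \<le> c * Y ^ (2 * K + 2))"
  proof (induction K)
    case 0
    show ?case
    proof (intro exI[of _ 1] conjI allI impI)
      fix F B P :: "nat \<Rightarrow> complex" and Y :: real and j :: nat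
      assume 1: "\<forall>k. (\<Sum>j\<le>k. of_nat (k choose j) * (F j * B (k - j))) = P k" and Y: "1 \<le> Y"
        and P: "\<forall>j\<le>0. norm (P j) \<le> Y" and B0: "1 \<le> Y * norm (B 0)" and j: "j \<le> 0"
      have "F 0 * B 0 = P 0" using 1[rule_format, of 0] by simp
      hence FB: "norm (F 0) * norm (B 0) \<le> Y" using P by (simp flip: norm_mult)
      have "norm (F 0) * 1 \<le> norm (F 0) * (Y * norm (B 0))" using B0 by (intro mult_left_mono) auto
      also have "\<dots> = Y * (norm (F 0) * norm (B 0))" by simp
      also have "\<dots> \<le> Y * Y" using FB Y by (intro mult_left_mono) auto
      finally show "norm (F j) \<le> 1 * Y ^ (2 * 0 + 2)" using j by (simp add: power2_eq_square)
    qed auto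
  next
    case (Suc K)
    then obtain c where c: "c \<ge> 0" and IH: "\<And>(F :: nat \<Rightarrow> complex) B P Y j.
       (\<forall>k. (\<Sum>j\<le>k. of_nat (k choose j) * (F j * B (k - j))) = P k) \<Longrightarrow>
       1 \<le> Y \<Longrightarrow> (\<forall>j\<le>K. norm (B j) \<le> Y) \<Longrightarrow> (\<forall>j\<le>K. norm (P j) \<le> Y) \<Longrightarrow>
       1 \<le> Y * norm (B 0) \<Longrightarrow> j \<le> K \<Longrightarrow> norm (F j) \<le> c * Y ^ (2 * K + 2)" by blast
    define c' where "c' = c + 1 + c * (\<Sum>j\<le>K. real (Suc K choose j))"
    have S0: "(\<Sum>j\<le>K. real (Suc K choose j)) \<ge> 0" by (rule sum_nonneg) auto
    have c': "c' \<ge> 0" using c S0 by (simp add: c'_def)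
    show ?case
    proof (intro exI[of _ c'] conjI allI impI c')
      fix F B P :: "nat \<Rightarrow> complex" and Y :: real and j :: nat
      assume 1: "\<forall>k. (\<Sum>j\<le>k. of_nat (k choose j) * (F j * B (k - j))) = P k" and Y: "1 \<le> Y"
        and B: "\<forall>j\<le>Suc K. norm (B j) \<le> Y"
        and P: "\<forall>j\<le>Suc K. norm (P j) \<le> Y" and B0: "1 \<le> Y * norm (B 0)" and j: "j \<le> Suc K"
      have F: "norm (F i) \<le> c * Y ^ (2 * K + 2)" if "i \<le> K" for i
        using IH[OF 1 Y _ _ B0 that] B P by auto
      have Yp: "Y ^ (2 * K + 2) \<le> Y ^ (2 * Suc K + 2)" using Y by (intro power_increasing) auto
      show "norm (F j) \<le> c' * Y ^ (2 * Suc K + 2)"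
      proof (cases "j \<le> K")
        case True
        have "norm (F j) \<le> c * Y ^ (2 * K + 2)" by (rule F[OF True])
        also have "\<dots> \<le> c' * Y ^ (2 * Suc K + 2)"
          using Yp c c' Y S0 by (intro mult_mono) (auto simp: c'_def)
        finally show ?thesis .
      next
        case False
        hence j: "j = Suc K" using j by simp
        have "F (Suc K) * B 0 = P (Suc K) - (\<Sum>j\<le>K. of_nat (Suc K choose j) * (F j * B (Suc K - j)))"
          using 1[rule_format, of "Suc K"] by (simp add: algebra_simps)
        hence "norm (F (Suc K)) * norm (B 0) =
           norm (P (Suc K) - (\<Sum>j\<le>K. of_nat (Suc K choose j) * (F j * B (Suc K - j))))"
          by (metis norm_mult)
        also have "\<dots> \<le> norm (P (Suc K)) + (\<Sum>j\<le>K. norm (of_nat (Suc K choose j) * (F j * B (Suc K - j))))"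
          by (rule order_trans[OF norm_triangle_ineq4]) (intro add_left_mono norm_sum)
        also have "\<dots> \<le> Y + (\<Sum>j\<le>K. real (Suc K choose j) * ((c * Y ^ (2 * K + 2)) * Y))"
          unfolding norm_mult norm_of_nat
          using P B F c Y by (intro add_mono sum_mono mult_left_mono mult_mono) auto
        also have "\<dots> = Y + c * (\<Sum>j\<le>K. real (Suc K choose j)) * Y ^ (2 * K + 3)"
          by (simp add: sum_distrib_left sum_distrib_right mult_ac eval_nat_numeral)
        also have "\<dots> \<le> Y ^ (2 * K + 3) + c * (\<Sum>j\<le>K. real (Suc K choose j)) * Y ^ (2 * K + 3)"
          using power_increasing[of 1 "2 * K + 3" Y] Y by simp
        also have "\<dots> \<le> c' * Y ^ (2 * K + 3)" using c Y by (simp add: c'_def algebra_simps)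
        finally have FB: "norm (F (Suc K)) * norm (B 0) \<le> c' * Y ^ (2 * K + 3)" .
        have "norm (F (Suc K)) * 1 \<le> norm (F (Suc K)) * (Y * norm (B 0))"
          using B0 by (intro mult_left_mono) auto
        also have "\<dots> = Y * (norm (F (Suc K)) * norm (B 0))" by simp
        also have "\<dots> \<le> Y * (c' * Y ^ (2 * K + 3))" using FB Y by (intro mult_left_mono) auto
        also have "\<dots> = c' * Y ^ (2 * Suc K + 2)" by (simp add: eval_nat_numeral)
        finally show ?thesis unfolding j by simp
      qed
    qed
  qed
  then obtain c where "c \<ge> 0" and c: "\<And>(F :: nat \<Rightarrow> complex) B P Y j.
       (\<forall>k. (\<Sum>j\<le>k. of_nat (k choose j) * (F j * B (k - j))) = P k) \<Longrightarrow>
       1 \<le> Y \<Longrightarrow> (\<forall>j\<le>K. norm (B j) \<le> Y) \<Longrightarrow> (\<forall>j\<le>K. norm (P j) \<le> Y) \<Longrightarrow>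
       1 \<le> Y * norm (B 0) \<Longrightarrow> j \<le> K \<Longrightarrow> norm (F j) \<le> c * Y ^ (2 * K + 2)" by blast
  show ?thesis
    by (rule that[OF \<open>c \<ge> 0\<close>], rule c) auto
qed

text \<open>The power of \<open>tlog t\<close> that the quotient recursion yields depends on k. It
  is weakened to an exponent 1/2 common to all k; against the quadratic decay of the kernel
  transform, (1 + \<bar>t\<bar>) powr (-3/2) is left, which is integrable.\<close>

lemma mu_bound_away:
  assumes d: "0 < d" "d \<le> 1"
  obtains C where "C \<ge> 0"
    "\<And>\<sigma> t. 1 < \<sigma> \<Longrightarrow> \<sigma> \<le> 2 \<Longrightarrow> d \<le> \<bar>t\<bar> \<Longrightarrow> norm (dsum mu_c k (Complex \<sigma> t)) \<le> C * (1 + \<bar>t\<bar>) powr (1/2)"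
proof -
  obtain c :: real where c: "c \<ge> 0"
    "\<And>(F :: nat \<Rightarrow> complex) B P Y. (\<And>k. (\<Sum>j\<le>k. of_nat (k choose j) * (F j * B (k - j))) = P k) \<Longrightarrow>
       1 \<le> Y \<Longrightarrow> (\<And>j. j \<le> k \<Longrightarrow> norm (B j) \<le> Y) \<Longrightarrow> (\<And>j. j \<le> k \<Longrightarrow> norm (P j) \<le> Y) \<Longrightarrow>
       1 \<le> Y * norm (B 0) \<Longrightarrow> norm (F k) \<le> c * Y ^ (2 * k + 2)"
    using leibniz_quotient_bound[of k] by blast
  obtain C0 m where C0: "C0 \<ge> 1"
    "\<And>\<sigma> t. 1 < \<sigma> \<Longrightarrow> \<sigma> \<le> 2 \<Longrightarrow> d \<le> \<bar>t\<bar> \<Longrightarrow> 1 \<le> C0 * tlog t ^ m * norm (dsum one_c 0 (Complex \<sigma> t))"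
    using inverse_zeta_bound[OF d] by blast
  have "\<exists>C\<ge>1. \<forall>\<sigma> t. 1 < \<sigma> \<longrightarrow> \<sigma> \<le> 2 \<longrightarrow> d \<le> \<bar>t\<bar> \<longrightarrow> norm (dsum one_c j (Complex \<sigma> t)) \<le> C * tlog t ^ Suc j" for j
    using zeta_deriv_bound[OF d, of j] by metis
  then obtain C1 where C1: "\<And>j. C1 j \<ge> 1"
    "\<And>j \<sigma> t. 1 < \<sigma> \<Longrightarrow> \<sigma> \<le> 2 \<Longrightarrow> d \<le> \<bar>t\<bar> \<Longrightarrow> norm (dsum one_c j (Complex \<sigma> t)) \<le> C1 j * tlog t ^ Suc j"
    by metis
  define A where "A = C0 + (\<Sum>j\<le>k. C1 j)"
  \<comment> \<open>Large enough to dominate both the exponents Suc j with j \<le> k of the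
    derivatives and the exponent m of the reciprocal.\<close>
  define n where "n = m + Suc k"
  have C1s: "(\<Sum>j\<le>k. C1 j) \<ge> 0" using C1(1) by (intro sum_nonneg) (meson order_trans zero_le_one)
  have A1: "A \<ge> 1" using C0 C1s by (simp add: A_def)
  obtain D :: real where D: "D \<ge> 1" "\<And>x. x \<ge> 1 \<Longrightarrow> (1 + ln x) ^ (n * (2 * k + 2)) \<le> D * x powr (1/2)"
    by (rule log_power_le_powr[of "1/2" "n * (2 * k + 2)"]) auto
  show ?thesis
  proof (rule that[of "c * A ^ (2 * k + 2) * D"])
    show "c * A ^ (2 * k + 2) * D \<ge> 0" using c A1 D by simp
    fix \<sigma> t :: real assume \<sigma>: "1 < \<sigma>" "\<sigma> \<le> 2" and t: "d \<le> \<bar>t\<bar>"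
    let ?s = "Complex \<sigma> t"
    have s: "Re ?s > 1" using \<sigma> by simp
    define Y where "Y = A * tlog t ^ n"
    have L: "tlog t \<ge> 1" by (rule tlog_ge_1)
    have Y1: "Y \<ge> 1"
    proof -
      have "1 * 1 \<le> Y" unfolding Y_def using A1 L by (intro mult_mono one_le_power) auto
      thus ?thesis by simp
    qed
    have "norm (dsum mu_c k ?s) \<le> c * Y ^ (2 * k + 2)"
    proof (rule c(2)[where F = "\<lambda>j. dsum mu_c j ?s" and B = "\<lambda>j. dsum one_c j ?s" and P = "\<lambda>k. if k = 0 then 1 else 0"])
      show "(\<Sum>j\<le>k. of_nat (k choose j) * (dsum mu_c j ?s * dsum one_c (k - j) ?s)) = (if k = 0 then 1 else 0)" for k
        by (rule dsum_mu_zeta_leibniz[OF s])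
      show "1 \<le> Y" by (rule Y1)
      show "norm (dsum one_c j ?s) \<le> Y" if j: "j \<le> k" for j
      proof -
        have "norm (dsum one_c j ?s) \<le> C1 j * tlog t ^ Suc j" by (rule C1(2)[OF \<sigma> t])
        also have "\<dots> \<le> A * tlog t ^ n"
        proof (intro mult_mono power_increasing)
          have "C1 j \<le> (\<Sum>j\<le>k. C1 j)"
            using C1(1) j by (intro member_le_sum) (auto intro: order_trans[OF zero_le_one])
          thus "C1 j \<le> A" using C0 by (simp add: A_def)
        qed (use j L A1 in \<open>auto simp: n_def\<close>)
        finally show ?thesis by (simp add: Y_def)
      qed
      show "norm (if j = 0 then 1 else 0 :: complex) \<le> Y" for j :: nat using Y1 by auto
      have "1 \<le> C0 * tlog t ^ m * norm (dsum one_c 0 ?s)" by (rule C0(2)[OF \<sigma> t])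
      also have "\<dots> \<le> Y * norm (dsum one_c 0 ?s)"
        unfolding Y_def using C0 C1s L A1
        by (intro mult_right_mono mult_mono power_increasing) (auto simp: A_def n_def)
      finally show "1 \<le> Y * norm (dsum one_c 0 ?s)" .
    qed
    also have "Y ^ (2 * k + 2) = A ^ (2 * k + 2) * (1 + ln (1 + \<bar>t\<bar>)) ^ (n * (2 * k + 2))"
      unfolding Y_def tlog_def power_mult_distrib power_mult ..
    also have "c * (A ^ (2 * k + 2) * (1 + ln (1 + \<bar>t\<bar>)) ^ (n * (2 * k + 2))) \<le>
        c * (A ^ (2 * k + 2) * (D * (1 + \<bar>t\<bar>) powr (1/2)))"
      using c A1 by (intro mult_left_mono D) auto
    finally show "norm (dsum mu_c k ?s) \<le> c * A ^ (2 * k + 2) * D * (1 + \<bar>t\<bar>) powr (1/2)"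
      by (simp add: mult_ac)
  qed
qed

lemma exp_minus_one_lower:
  obtains r where "r > 0" "\<And>z::complex. norm z \<le> r \<Longrightarrow> norm z / 2 \<le> norm (exp z - 1)"
proof -
  have "(exp has_field_derivative exp 0) (at (0::complex))" by (rule DERIV_exp)
  hence "(\<lambda>h::complex. (exp (0 + h) - exp 0) / h) \<midarrow>0\<rightarrow> 1" by (simp add: DERIV_def)
  hence "\<exists>r>0. \<forall>x::complex. x \<noteq> 0 \<and> dist x 0 < r \<longrightarrow> dist ((exp (0 + x) - exp 0) / x) 1 < 1/2"
    unfolding LIM_def by (metis half_gt_zero zero_less_one)
  then obtain r where r: "r > 0" "\<And>x::complex. x \<noteq> 0 \<Longrightarrow> norm x < r \<Longrightarrow> norm ((exp x - 1) / x - 1) < 1/2"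
    by (auto simp: dist_norm)
  show ?thesis
  proof (rule that[of "r / 2"])
    fix z :: complex assume z: "norm z \<le> r / 2"
    show "norm z / 2 \<le> norm (exp z - 1)"
    proof (cases "z = 0")
      case False
      have "norm ((exp z - 1) / z - 1) < 1/2" using z r(1) False by (intro r) auto
      moreover have "norm (1::complex) - norm ((exp z - 1) / z) \<le> norm ((exp z - 1) / z - 1)"
        by (metis norm_minus_commute norm_triangle_ineq2)
      ultimately have "1/2 \<le> norm ((exp z - 1) / z)" by simp
      thus ?thesis using False by (simp add: norm_divide field_simps)
    qed auto
  qed (use r in auto)
qed

text \<open>The derivatives of eta are bounded here, so only a lower bound for eta is missing. By
  the pole, 1 / \<zeta> has size at most 2 norm (s - 1), whereas its product with eta is 1 - 2 powr
  (1 - s), of size at least norm (s - 1) ln 2 / 2; the factor norm (s - 1) cancels. The radius d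
  comes before k because it serves all k.\<close>

lemma mu_bound_near:
  obtains d where "0 < d" "d \<le> 1"
    "\<And>k. \<exists>C\<ge>0. \<forall>\<sigma> t. 1 < \<sigma> \<longrightarrow> \<sigma> \<le> 1 + d \<longrightarrow> \<bar>t\<bar> \<le> d \<longrightarrow> norm (dsum mu_c k (Complex \<sigma> t)) \<le> C"
proof -
  obtain A where A: "A > 0" "\<And>s. Re s > 1 \<Longrightarrow> norm s \<le> 3 \<Longrightarrow> norm (dsum one_c 0 s - 1 / (s - 1)) \<le> A"
    using zeta_pole_approx by blast
  obtain r where r: "r > 0" "\<And>z::complex. norm z \<le> r \<Longrightarrow> norm z / 2 \<le> norm (exp z - 1)"
    using exp_minus_one_lower by blast
  \<comment> \<open>Here norm (s - 1) \<le> 2 d. The bound 1 keeps norm s \<le> 3, the bound 1 / (4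
    A) lets the pole exceed the error A by a factor 2, and r / 2 keeps (s - 1) ln 2 within the range
    of the estimate for exp.\<close>
  define d where "d = Min {1, 1 / (4 * A), r / 2}"
  have d: "0 < d" "d \<le> 1" "d \<le> 1 / (4 * A)" "d \<le> r / 2"
    using A r by (auto simp: d_def)
  \<comment> \<open>The reciprocal of the lower bound ln 2 / 4 for eta.\<close>
  define q where "q = 4 / ln (2::real)"
  have l2: "0 < ln (2::real)" "ln (2::real) < 1" using ln_2_less_1 by auto
  have q: "q \<ge> 4" using l2 by (simp add: q_def field_simps)
  have eta: "Re (Complex \<sigma> t) > 1 \<and> norm (Complex \<sigma> t) \<le> 3 \<and> 1 \<le> q * norm (dsum alt_c 0 (Complex \<sigma> t))"
    if \<sigma>: "1 < \<sigma>" "\<sigma> \<le> 1 + d" and t: "\<bar>t\<bar> \<le> d" for \<sigma> t :: real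
  proof -
    define s where "s = Complex \<sigma> t"
    have s: "Re s > 1" using \<sigma> by (simp add: s_def)
    have n: "norm (s - 1) \<le> 2 * d" using cmod_le[of "s - 1"] \<sigma> t by (simp add: s_def)
    have n3: "norm s \<le> 3" using cmod_le[of s] \<sigma> t d by (simp add: s_def)
    have s1: "norm (s - 1) > 0" using s by auto
    let ?Z = "dsum one_c 0 s" and ?F = "dsum mu_c 0 s" and ?H = "dsum alt_c 0 s"
    have "norm (1 / (s - 1)) - norm ?Z \<le> A"
      using A(2)[OF s n3] norm_triangle_ineq2[of "1 / (s - 1)" ?Z] by (simp add: norm_minus_commute)
    moreover have "2 * A \<le> norm (1 / (s - 1))"
    proof -
      have "norm (s - 1) \<le> 1 / (2 * A)" using n d by simp
      thus ?thesis using A s1 by (simp add: norm_divide field_simps)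
    qed
    ultimately have "1 / (2 * norm (s - 1)) \<le> norm ?Z" by (simp add: norm_divide field_simps)
    hence Z: "1 \<le> 2 * norm (s - 1) * norm ?Z" using s1 by (simp add: field_simps)
    have FZ: "norm ?F * norm ?Z = 1" using mu_zeta[OF s] by (metis norm_mult norm_one)
    have "norm ?F * 1 \<le> norm ?F * (2 * norm (s - 1) * norm ?Z)" using Z by (intro mult_left_mono) auto
    also have "\<dots> = 2 * norm (s - 1)" using FZ by simp
    finally have F: "norm ?F \<le> 2 * norm (s - 1)" by simp
    have FH: "?F * ?H = 1 - 2 * 2 powr (-s)" using dsum_mu_alt_leibniz[OF s, of 0] by simp
    have "2 * 2 powr (-s) = exp (- ((s - 1) * of_real (ln 2)))"
    proof -
      have "2 * 2 powr (-s) = (2::complex) powr (1 + (-s))" by (subst powr_add) simp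
      also have "\<dots> = exp ((1 + (-s)) * of_real (ln 2))"
        by (simp add: powr_def) (metis Ln_of_real of_real_numeral zero_less_numeral)
      finally show ?thesis by (simp add: algebra_simps)
    qed
    hence "norm (1 - 2 * 2 powr (-s)) = norm (exp (- ((s - 1) * of_real (ln 2))) - 1)"
      by (simp add: norm_minus_commute)
    moreover have w: "norm (- ((s - 1) * of_real (ln 2))) = norm (s - 1) * ln 2"
      using l2 by (simp add: norm_mult)
    moreover have "norm (s - 1) * ln 2 \<le> r"
    proof -
      have "norm (s - 1) * ln 2 \<le> (2 * d) * 1" using n l2 d by (intro mult_mono) auto
      thus ?thesis using d by simp
    qed
    ultimately have "norm (s - 1) * ln 2 / 2 \<le> norm (1 - 2 * 2 powr (-s))"
      using r(2)[of "- ((s - 1) * of_real (ln 2))"] by simp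
    also have "\<dots> = norm ?F * norm ?H" unfolding FH[symmetric] by (rule norm_mult)
    also have "\<dots> \<le> 2 * norm (s - 1) * norm ?H" using F by (intro mult_right_mono) auto
    finally have "norm (s - 1) * (ln 2 / 2) \<le> norm (s - 1) * (2 * norm ?H)" by simp
    hence "ln 2 / 2 \<le> 2 * norm ?H" using s1 by simp
    hence "1 \<le> q * norm ?H" using l2 by (simp add: q_def field_simps)
    thus ?thesis using s n3 by (simp add: s_def)
  qed
  have "\<exists>C\<ge>0. \<forall>\<sigma> t. 1 < \<sigma> \<longrightarrow> \<sigma> \<le> 1 + d \<longrightarrow> \<bar>t\<bar> \<le> d \<longrightarrow> norm (dsum mu_c k (Complex \<sigma> t)) \<le> C" for k
  proof -
    obtain c :: real where c: "c \<ge> 0"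
      "\<And>(F :: nat \<Rightarrow> complex) B P Y. (\<And>k. (\<Sum>j\<le>k. of_nat (k choose j) * (F j * B (k - j))) = P k) \<Longrightarrow>
         1 \<le> Y \<Longrightarrow> (\<And>j. j \<le> k \<Longrightarrow> norm (B j) \<le> Y) \<Longrightarrow> (\<And>j. j \<le> k \<Longrightarrow> norm (P j) \<le> Y) \<Longrightarrow>
         1 \<le> Y * norm (B 0) \<Longrightarrow> norm (F k) \<le> c * Y ^ (2 * k + 2)"
      using leibniz_quotient_bound[of k] by blast
    have "\<exists>C\<ge>0. \<forall>s. Re s > 1 \<longrightarrow> norm s \<le> 3 \<longrightarrow> norm (dsum alt_c j s) \<le> C" for j
      using eta_deriv_bound[of j] by metis
    then obtain C1 where C1: "\<And>j. C1 j \<ge> 0" "\<And>j s. Re s > 1 \<Longrightarrow> norm s \<le> 3 \<Longrightarrow> norm (dsum alt_c j s) \<le> C1 j"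
      by metis
    define Y where "Y = q + (\<Sum>j\<le>k. C1 j)"
    have C1s: "(\<Sum>j\<le>k. C1 j) \<ge> 0" using C1(1) by (intro sum_nonneg) auto
    have Y: "Y \<ge> 4" "Y \<ge> q" using q C1s by (auto simp: Y_def)
    show ?thesis
    proof (intro exI[of _ "c * Y ^ (2 * k + 2)"] conjI allI impI)
      show "c * Y ^ (2 * k + 2) \<ge> 0" using c Y by simp
      fix \<sigma> t :: real assume \<sigma>: "1 < \<sigma>" "\<sigma> \<le> 1 + d" and t: "\<bar>t\<bar> \<le> d"
      let ?s = "Complex \<sigma> t"
      have s: "Re ?s > 1" "norm ?s \<le> 3" "1 \<le> q * norm (dsum alt_c 0 ?s)" using eta[OF \<sigma> t] by auto
      show "norm (dsum mu_c k ?s) \<le> c * Y ^ (2 * k + 2)"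
      proof (rule c(2)[where F = "\<lambda>j. dsum mu_c j ?s" and B = "\<lambda>j. dsum alt_c j ?s" and
           P = "\<lambda>k. (if k = 0 then 1 else 0) - 2 * of_real (ln 2 ^ k) * 2 powr (-?s)"])
        show "(\<Sum>j\<le>k. of_nat (k choose j) * (dsum mu_c j ?s * dsum alt_c (k - j) ?s)) =
            (if k = 0 then 1 else 0) - 2 * of_real (ln 2 ^ k) * 2 powr (-?s)" for k
          by (rule dsum_mu_alt_leibniz[OF s(1)])
        show "1 \<le> Y" using Y by simp
        show "norm (dsum alt_c j ?s) \<le> Y" if j: "j \<le> k" for j
        proof -
          have "norm (dsum alt_c j ?s) \<le> C1 j" by (rule C1(2)[OF s(1,2)])
          also have "\<dots> \<le> (\<Sum>j\<le>k. C1 j)" using C1(1) j by (intro member_le_sum) auto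
          finally show ?thesis using q by (simp add: Y_def)
        qed
        show "norm ((if j = 0 then 1 else 0) - 2 * of_real (ln 2 ^ j) * 2 powr (-?s)) \<le> Y" for j :: nat
        proof -
          have "norm (2 powr (-?s) :: complex) = 2 powr (-\<sigma>)" by (simp add: norm_powr_real_powr)
          also have "\<dots> \<le> 2 powr 0" using \<sigma> by (intro powr_mono) auto
          finally have p: "norm (2 powr (-?s) :: complex) \<le> 1" by simp
          have "norm ((if j = 0 then 1 else 0) - 2 * of_real (ln 2 ^ j) * 2 powr (-?s)) \<le>
             norm (if j = 0 then 1 else 0 :: complex) + norm (2 * of_real (ln 2 ^ j) * 2 powr (-?s) :: complex)"
            by (rule norm_triangle_ineq4)
          also have "\<dots> = norm (if j = 0 then 1 else 0 :: complex) + 2 * (ln 2 ^ j) * norm (2 powr (-?s) :: complex)"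
            using l2 by (simp add: norm_mult norm_power)
          also have "\<dots> \<le> 1 + 2 * 1 * 1"
            using l2 p by (intro add_mono mult_mono power_le_one) auto
          finally show ?thesis using Y by simp
        qed
        have "1 \<le> q * norm (dsum alt_c 0 ?s)" by (rule s)
        also have "\<dots> \<le> Y * norm (dsum alt_c 0 ?s)" using Y by (intro mult_right_mono) auto
        finally show "1 \<le> Y * norm (dsum alt_c 0 ?s)" .
      qed
    qed
  qed
  with d that show ?thesis by blast
qed

text \<open>The neighbourhood of the pole fixes d; the bound away from it is available for any such
  d and is then applied with this one.\<close>

lemma mu_bound:
  obtains d where "0 < d" "d \<le> 1"
    "\<And>k. \<exists>C\<ge>0. \<forall>\<sigma> t. 1 < \<sigma> \<longrightarrow> \<sigma> \<le> 1 + d \<longrightarrow>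
        norm (dsum mu_c k (Complex \<sigma> t)) \<le> C * (1 + \<bar>t\<bar>) powr (1/2)"
proof -
  obtain d where d: "0 < d" "d \<le> 1" and near:
    "\<And>k. \<exists>C\<ge>0. \<forall>\<sigma> t. 1 < \<sigma> \<longrightarrow> \<sigma> \<le> 1 + d \<longrightarrow> \<bar>t\<bar> \<le> d \<longrightarrow> norm (dsum mu_c k (Complex \<sigma> t)) \<le> C"
    using mu_bound_near by blast
  have "\<exists>C\<ge>0. \<forall>\<sigma> t. 1 < \<sigma> \<longrightarrow> \<sigma> \<le> 1 + d \<longrightarrow>
        norm (dsum mu_c k (Complex \<sigma> t)) \<le> C * (1 + \<bar>t\<bar>) powr (1/2)" for k
  proof -
    obtain C1 where C1: "C1 \<ge> 0" "\<And>\<sigma> t. 1 < \<sigma> \<Longrightarrow> \<sigma> \<le> 1 + d \<Longrightarrow> \<bar>t\<bar> \<le> d \<Longrightarrow>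
        norm (dsum mu_c k (Complex \<sigma> t)) \<le> C1" using near[of k] by blast
    obtain C2 where C2: "C2 \<ge> 0" "\<And>\<sigma> t. 1 < \<sigma> \<Longrightarrow> \<sigma> \<le> 2 \<Longrightarrow> d \<le> \<bar>t\<bar> \<Longrightarrow>
        norm (dsum mu_c k (Complex \<sigma> t)) \<le> C2 * (1 + \<bar>t\<bar>) powr (1/2)"
      using mu_bound_away[OF d, of k] by blast
    show ?thesis
    proof (intro exI[of _ "C1 + C2"] conjI allI impI)
      fix \<sigma> t :: real assume \<sigma>: "1 < \<sigma>" "\<sigma> \<le> 1 + d"
      have p: "1 \<le> (1 + \<bar>t\<bar>) powr (1/2)" by (intro ge_one_powr_ge_zero) auto
      show "norm (dsum mu_c k (Complex \<sigma> t)) \<le> (C1 + C2) * (1 + \<bar>t\<bar>) powr (1/2)"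
      proof (cases "\<bar>t\<bar> \<le> d")
        case True
        have "norm (dsum mu_c k (Complex \<sigma> t)) \<le> C1 * 1" using C1(2)[OF \<sigma> True] by simp
        also have "\<dots> \<le> (C1 + C2) * (1 + \<bar>t\<bar>) powr (1/2)" using C1 C2 p by (intro mult_mono) auto
        finally show ?thesis .
      next
        case False
        have "norm (dsum mu_c k (Complex \<sigma> t)) \<le> C2 * (1 + \<bar>t\<bar>) powr (1/2)"
          using False \<sigma> d by (intro C2(2)) auto
        also have "\<dots> \<le> (C1 + C2) * (1 + \<bar>t\<bar>) powr (1/2)" using C1 by (intro mult_right_mono) auto
        finally show ?thesis .
      qed
    qed (use C1 C2 in auto)
  qed
  with d that show ?thesis by blast
qed


section \<open>Fourier inversion and the Riesz kernel\<close>

lemma std_normal_density_fourier: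
  "complex_of_real (std_normal_density w) =
     1 / sqrt (2 * pi) * (CLINT x|std_normal_distribution. iexp (w * x))"
proof -
  have "(CLINT x|std_normal_distribution. iexp (w * x)) = char std_normal_distribution w"
    by (simp add: char_def)
  also have "\<dots> = complex_of_real (exp (- (w\<^sup>2) / 2))"
    unfolding char_std_normal_distribution ..
  finally show ?thesis by (simp only:) (simp add: std_normal_density_def)
qed

text \<open>
  The Gaussian is its own Fourier transform, so smoothing with it is a Fubini exchange.
\<close>

lemma gaussian_smoothing_fourier:
  fixes K :: "real \<Rightarrow> real" and H :: "real \<Rightarrow> complex"
  assumes K: "continuous_on UNIV K" "integrable lborel K"
    and H: "\<And>w. H w = (CLBINT u. K u * iexp (w * u))" and Hint: "integrable lborel H"
    and T: "T > 0"
  shows "complex_of_real (LINT x|std_normal_distribution. K (v + x / T)) =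
           1 / (2 * pi) * (CLBINT y. exp (- (y / T)\<^sup>2 / 2) *\<^sub>R (iexp (- (v * y)) * H y))"
proof -
  interpret N: real_distribution std_normal_distribution by (rule real_dist_normal_dist)
  interpret P: pair_sigma_finite lborel std_normal_distribution ..
  have Kmeas [measurable]: "K \<in> borel_measurable borel"
    using K(1) by (rule borel_measurable_continuous_onI)
  have Hmeas [measurable]: "H \<in> borel_measurable borel"
    using Hint by simp
  let ?c = "complex_of_real (1 / sqrt (2 * pi))"
  have "(LINT x|std_normal_distribution. K (v + x / T)) = (LBINT x. std_normal_density x * K (v + x / T))"
    by (subst integral_density) auto
  also have "\<dots> = T * (LBINT u. std_normal_density (- T * v + T * u) * K (v + (- T * v + T * u) / T))"
    using T by (subst lborel_integral_real_affine[where c = T and t = "- T * v"]) auto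
  also have "(\<lambda>u. v + (- T * v + T * u) / T) = (\<lambda>u. u)"
    using T by (auto simp: field_simps)
  hence "(\<lambda>u. std_normal_density (- T * v + T * u) * K (v + (- T * v + T * u) / T)) =
     (\<lambda>u. std_normal_density (T * (u - v)) * K u)"
    by (auto simp: fun_eq_iff algebra_simps)
  finally have "(LINT x|std_normal_distribution. K (v + x / T)) = T * (LBINT u. std_normal_density (T * (u - v)) * K u)" .
  hence "complex_of_real (LINT x|std_normal_distribution. K (v + x / T)) =
     of_real (T * (LBINT u. std_normal_density (T * (u - v)) * K u))"
    by (simp only:)
  also have "\<dots> = T * (CLBINT u. of_real (std_normal_density (T * (u - v)) * K u))"
    by (subst of_real_mult, subst integral_complex_of_real) (rule refl)
  also have "(CLBINT u. of_real (std_normal_density (T * (u - v)) * K u)) =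
     (CLBINT u. ?c * (CLINT x|std_normal_distribution. K u * iexp (T * (u - v) * x)))"
    by (intro Bochner_Integration.integral_cong refl) (simp add: std_normal_density_fourier)
  also have "\<dots> = ?c * (CLBINT u. (CLINT x|std_normal_distribution. K u * iexp (T * (u - v) * x)))"
    by simp
  also have "(CLBINT u. (CLINT x|std_normal_distribution. K u * iexp (T * (u - v) * x))) =
     (CLINT x|std_normal_distribution. (CLBINT u. K u * iexp (T * (u - v) * x)))"
  proof (rule P.Fubini_integral[symmetric])
    show "integrable (lborel \<Otimes>\<^sub>M std_normal_distribution) (\<lambda>(u, x). K u * iexp (T * (u - v) * x))"
    proof (rule P.Fubini_integrable)
      have "(\<lambda>u. LINT x|std_normal_distribution. norm (K u * iexp (T * (u - v) * x))) = (\<lambda>u. norm (K u))"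
        using N.prob_space by (simp add: norm_mult)
      thus "integrable lborel (\<lambda>u. LINT x|std_normal_distribution. norm (case (u, x) of (u, x) \<Rightarrow> K u * iexp (T * (u - v) * x)))"
        using integrable_norm[OF K(2)] by simp
      have "integrable std_normal_distribution (\<lambda>x. K u * iexp (T * (u - v) * x))" for u
        by (rule N.integrable_const_bound[of _ "norm (K u)"]) (auto simp: norm_mult)
      thus "AE u in lborel. integrable std_normal_distribution (\<lambda>x. case (u, x) of (u, x) \<Rightarrow> K u * iexp (T * (u - v) * x))"
        by simp
    qed measurable
  qed
  also have "\<dots> = (CLINT x|std_normal_distribution. iexp (- (v * (T * x))) * H (T * x))"
  proof (intro Bochner_Integration.integral_cong refl)
    fix x
    have "(CLBINT u. K u * iexp (T * (u - v) * x)) = (CLBINT u. iexp (- (v * (T * x))) * (K u * iexp (T * x * u)))"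
      by (intro Bochner_Integration.integral_cong refl) (simp add: algebra_simps flip: exp_add)
    also have "\<dots> = iexp (- (v * (T * x))) * H (T * x)" by (simp add: H)
    finally show "(CLBINT u. K u * iexp (T * (u - v) * x)) = iexp (- (v * (T * x))) * H (T * x)" .
  qed
  also have "\<dots> = (CLBINT x. std_normal_density x *\<^sub>R (iexp (- (v * (T * x))) * H (T * x)))"
    by (subst integral_density) auto
  also have "of_real T * (?c * \<dots>) =
     ?c * (\<bar>T\<bar> *\<^sub>R (CLBINT x. std_normal_density ((0 + T * x) / T) *\<^sub>R (iexp (- (v * (0 + T * x))) * H (0 + T * x))))"
    using T by (simp add: scaleR_conv_of_real)
  also have "\<bar>T\<bar> *\<^sub>R (CLBINT x. std_normal_density ((0 + T * x) / T) *\<^sub>R (iexp (- (v * (0 + T * x))) * H (0 + T * x)))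
     = (CLBINT y. std_normal_density (y / T) *\<^sub>R (iexp (- (v * y)) * H y))"
    using T by (subst lborel_integral_real_affine[where c = T and t = 0, symmetric]) auto
  also have "\<dots> = (CLBINT y. ?c * (exp (- (y / T)\<^sup>2 / 2) *\<^sub>R (iexp (- (v * y)) * H y)))"
    by (intro Bochner_Integration.integral_cong refl) (simp add: std_normal_density_def scaleR_conv_of_real)
  also have "\<dots> = ?c * (CLBINT y. exp (- (y / T)\<^sup>2 / 2) *\<^sub>R (iexp (- (v * y)) * H y))"
    by (rule integral_mult_right_zero)
  also have "?c * \<dots> = 1 / (2 * pi) * (CLBINT y. exp (- (y / T)\<^sup>2 / 2) *\<^sub>R (iexp (- (v * y)) * H y))"
  proof -
    \<comment> \<open>One factor stems from writing the density as a Fourier integral, the other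
      from the density of the Gaussian measure itself.\<close>
    have "(1 / sqrt (2 * pi)) * (1 / sqrt (2 * pi)) = 1 / (2 * pi)"
      by (simp only: times_divide_times_eq real_sqrt_mult_self) simp
    hence cc: "?c * ?c = of_real (1 / (2 * pi))" by (simp only: of_real_mult[symmetric])
    show ?thesis unfolding mult.assoc[symmetric] cc ..
  qed
  finally show ?thesis .
qed

text \<open>As T grows in the smoothed identity, the left side tends to K v by continuity and
  boundedness of K, and the right side converges under the integrable majorant norm (H y).\<close>

theorem fourier_inversion:
  fixes K :: "real \<Rightarrow> real" and H :: "real \<Rightarrow> complex"
  assumes K: "continuous_on UNIV K" "integrable lborel K" "\<And>u. \<bar>K u\<bar> \<le> B"
    and H: "\<And>w. H w = (CLBINT u. K u * iexp (w * u))" and Hint: "integrable lborel H"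
  shows "complex_of_real (K v) = 1 / (2 * pi) * (CLBINT y. iexp (- (v * y)) * H y)"
proof -
  interpret N: real_distribution std_normal_distribution by (rule real_dist_normal_dist)
  have Kmeas [measurable]: "K \<in> borel_measurable borel"
    using K(1) by (rule borel_measurable_continuous_onI)
  have Hmeas [measurable]: "H \<in> borel_measurable borel"
    using Hint by simp
  define T where "T n = real (Suc n)" for n
  have lim0: "(\<lambda>n. x / T n) \<longlonglongrightarrow> 0" for x
    unfolding T_def using LIMSEQ_Suc[OF lim_const_over_n[of x]] by simp
  have "(\<lambda>n. LINT x|std_normal_distribution. K (v + x / T n)) \<longlonglongrightarrow> (LINT x|std_normal_distribution. K v)"
  proof (rule integral_dominated_convergence[where w = "\<lambda>_. B"])
    show "AE x in std_normal_distribution. (\<lambda>n. K (v + x / T n)) \<longlonglongrightarrow> K v"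
    proof (rule AE_I2)
      fix x
      have "(\<lambda>n. v + x / T n) \<longlonglongrightarrow> v + 0" by (intro tendsto_intros lim0)
      thus "(\<lambda>n. K (v + x / T n)) \<longlonglongrightarrow> K v"
        using K(1) by (intro continuous_on_tendsto_compose[OF K(1)]) auto
    qed
  qed (use K(3) in auto)
  also have "(LINT x|std_normal_distribution. K v) = K v" using N.prob_space by simp
  finally have L1: "(\<lambda>n. complex_of_real (LINT x|std_normal_distribution. K (v + x / T n))) \<longlonglongrightarrow> complex_of_real (K v)"
    by (rule tendsto_of_real)
  have "(\<lambda>n. CLBINT y. exp (- (y / T n)\<^sup>2 / 2) *\<^sub>R (iexp (- (v * y)) * H y)) \<longlonglongrightarrow> (CLBINT y. iexp (- (v * y)) * H y)"
  proof (rule integral_dominated_convergence[where w = "\<lambda>y. norm (H y)"])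
    show "AE y in lborel. (\<lambda>n. exp (- (y / T n)\<^sup>2 / 2) *\<^sub>R (iexp (- (v * y)) * H y)) \<longlonglongrightarrow> iexp (- (v * y)) * H y"
    proof (rule AE_I2)
      fix y
      have "(\<lambda>n. exp (- (y / T n)\<^sup>2 / 2) *\<^sub>R (iexp (- (v * y)) * H y)) \<longlonglongrightarrow> exp (- 0\<^sup>2 / 2) *\<^sub>R (iexp (- (v * y)) * H y)"
        by (intro tendsto_intros lim0) auto
      thus "(\<lambda>n. exp (- (y / T n)\<^sup>2 / 2) *\<^sub>R (iexp (- (v * y)) * H y)) \<longlonglongrightarrow> iexp (- (v * y)) * H y" by simp
    qed
    show "AE y in lborel. norm (exp (- (y / T n)\<^sup>2 / 2) *\<^sub>R (iexp (- (v * y)) * H y)) \<le> norm (H y)" for n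
      by (intro AE_I2) (simp add: norm_mult mult_left_le_one_le)
  qed (use Hint in auto)
  hence "(\<lambda>n. 1 / (2 * pi) * (CLBINT y. exp (- (y / T n)\<^sup>2 / 2) *\<^sub>R (iexp (- (v * y)) * H y))) \<longlonglongrightarrow>
     1 / (2 * pi) * (CLBINT y. iexp (- (v * y)) * H y)"
    by (rule tendsto_mult_left)
  moreover have "complex_of_real (LINT x|std_normal_distribution. K (v + x / T n)) =
     1 / (2 * pi) * (CLBINT y. exp (- (y / T n)\<^sup>2 / 2) *\<^sub>R (iexp (- (v * y)) * H y))" for n
    by (rule gaussian_smoothing_fourier[OF K(1,2) H Hint]) (simp add: T_def)
  ultimately show ?thesis using LIMSEQ_unique[OF L1] by simp
qed

section \<open>The Riesz kernel and its transform\<close>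

text \<open>At u = ln (N / n) with n \<le> N this is (n / N) powr \<sigma> * (1 - n / N), and it is
  0 for n \<ge> N. Using max u 0 gives the one-sided kernel without cases, so continuity is
  immediate.\<close>

definition riesz_kernel :: "real \<Rightarrow> real \<Rightarrow> real" where
  "riesz_kernel \<sigma> u = exp (- \<sigma> * max u 0) * (1 - exp (- max u 0))"

lemma riesz_kernel_nonpos: "u \<le> 0 \<Longrightarrow> riesz_kernel \<sigma> u = 0"
  by (simp add: riesz_kernel_def max_def)

lemma riesz_kernel_nonneg: "u \<ge> 0 \<Longrightarrow> riesz_kernel \<sigma> u = exp (- \<sigma> * u) - exp (- (\<sigma> + 1) * u)"
  by (simp add: riesz_kernel_def max_def algebra_simps flip: exp_add)

lemma continuous_riesz_kernel: "continuous_on UNIV (riesz_kernel \<sigma>)"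
  unfolding riesz_kernel_def by (intro continuous_intros)

lemma riesz_kernel_bound: "\<sigma> > 0 \<Longrightarrow> \<bar>riesz_kernel \<sigma> u\<bar> \<le> 1"
  unfolding riesz_kernel_def abs_mult by (intro mult_le_one) auto

lemma exp_neg_tendsto_0_at_top:
  assumes "a > 0"
  shows "((\<lambda>u::real. exp (- a * u)) \<longlongrightarrow> 0) at_top"
proof -
  have "filterlim (\<lambda>u::real. a * u) at_top at_top"
    using assms by (rule filterlim_tendsto_pos_mult_at_top[OF tendsto_const _ filterlim_ident])
  hence "filterlim (\<lambda>u::real. - (a * u)) at_bot at_top"
    by (simp add: filterlim_uminus_at_bot)
  from filterlim_compose[OF exp_at_bot this] show ?thesis by simp
qed

lemma set_integrable_exp_neg:
  assumes "a > (0::real)"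
  shows "set_integrable lborel {0<..} (\<lambda>u. exp (- a * u))"
proof -
  have "set_integrable lborel (einterval 0 \<infinity>) (\<lambda>u. exp (- a * u))"
  proof (rule interval_integral_FTC_nonneg(1)[where F = "\<lambda>u. - exp (- a * u) / a" and A = "- exp (- a * 0) / a" and B = "- 0 / a"])
    show "((\<lambda>u. - exp (- a * u) / a) has_real_derivative exp (- a * x)) (at x)" for x
      using assms by (auto intro!: derivative_eq_intros)
    show "(((\<lambda>u. - exp (- a * u) / a) \<circ> real_of_ereal) \<longlongrightarrow> - exp (- a * 0) / a) (at_right 0)"
      unfolding zero_ereal_def ereal_tendsto_simps using assms by (intro tendsto_intros) auto
    show "(((\<lambda>u. - exp (- a * u) / a) \<circ> real_of_ereal) \<longlongrightarrow> - 0 / a) (at_left \<infinity>)"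
      unfolding ereal_tendsto_simps using assms exp_neg_tendsto_0_at_top[OF assms] by (intro tendsto_intros) auto
  qed auto
  thus ?thesis by (simp add: zero_ereal_def)
qed

lemma integrable_riesz_kernel:
  assumes "\<sigma> > 0"
  shows "integrable lborel (riesz_kernel \<sigma>)"
proof -
  have "integrable lborel (\<lambda>u. indicator {0<..} u *\<^sub>R exp (- \<sigma> * u))"
    using set_integrable_exp_neg[OF assms] by (simp add: set_integrable_def)
  thus ?thesis
  proof (rule Bochner_Integration.integrable_bound)
    show "riesz_kernel \<sigma> \<in> borel_measurable lborel"
      using borel_measurable_continuous_onI[OF continuous_riesz_kernel] by simp
    show "AE u in lborel. norm (riesz_kernel \<sigma> u) \<le> norm (indicator {0<..} u *\<^sub>R exp (- \<sigma> * u))"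
    proof (rule AE_I2)
      fix u :: real
      show "norm (riesz_kernel \<sigma> u) \<le> norm (indicator {0<..} u *\<^sub>R exp (- \<sigma> * u))"
      proof (cases "u > 0")
        case True
        have "exp (- \<sigma> * u) * \<bar>1 - exp (- u)\<bar> \<le> exp (- \<sigma> * u) * 1"
          using True by (intro mult_left_mono) auto
        thus ?thesis using True by (simp add: riesz_kernel_def max_def abs_mult)
      qed (auto simp: riesz_kernel_nonpos)
    qed
  qed
qed

text \<open>The transform is 1 / s - 1 / (s + 1) with s = \<sigma> - i w. The two simple poles
  cancel to first order at infinity, which gives the quadratic decay on which absolute convergence
  rests.\<close>

lemma riesz_kernel_fourier:
  assumes \<sigma>: "\<sigma> > 0"
  shows "(CLBINT u. riesz_kernel \<sigma> u * iexp (w * u)) = 1 / (Complex \<sigma> (-w) * (Complex \<sigma> (-w) + 1))"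
proof -
  define s where "s = Complex \<sigma> (-w)"
  have s0: "s \<noteq> 0" "s + 1 \<noteq> 0" using \<sigma> by (auto simp: s_def complex_eq_iff)
  define f where "f u = exp (- s * of_real u) - exp (- (s + 1) * of_real u)" for u :: real
  define F where "F u = - exp (- s * of_real u) / s + exp (- (s + 1) * of_real u) / (s + 1)" for u :: real
  have f_eq: "riesz_kernel \<sigma> u * iexp (w * u) = f u" if "u \<ge> 0" for u
  proof -
    have "- s * of_real u = of_real (- \<sigma> * u) + \<i> * of_real (w * u)"
      "- (s + 1) * of_real u = of_real (- (\<sigma> + 1) * u) + \<i> * of_real (w * u)"
      by (simp_all add: s_def complex_eq_iff algebra_simps)
    hence "exp (- s * of_real u) = of_real (exp (- \<sigma> * u)) * iexp (w * u)"
      "exp (- (s + 1) * of_real u) = of_real (exp (- (\<sigma> + 1) * u)) * iexp (w * u)"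
      by (simp_all only: exp_add exp_of_real)
    thus ?thesis unfolding f_def riesz_kernel_nonneg[OF that]
      by (simp only: of_real_diff left_diff_distrib)
  qed
  have "(CLBINT u. riesz_kernel \<sigma> u * iexp (w * u)) = (CLBINT u:{0<..}. f u)"
    unfolding set_lebesgue_integral_def
    by (intro Bochner_Integration.integral_cong refl) (auto simp: f_eq riesz_kernel_nonpos simp del: of_real_mult split: split_indicator)
  also have "\<dots> = (CLBINT u=0..\<infinity>. f u)"
    by (simp add: interval_lebesgue_integral_0_infty)
  also have "\<dots> = 0 - F 0"
  proof (rule interval_integral_FTC_integrable)
    show "(F has_vector_derivative f x) (at x)" for x
    proof -
      have D: "((\<lambda>z. exp (- a * z) / a) has_field_derivative (- exp (- a * of_real x))) (at (of_real x))"
        if "a \<noteq> 0" for a :: complex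
        using that by (auto intro!: derivative_eq_intros)
      have "((\<lambda>z. - (exp (- s * z) / s) + exp (- (s + 1) * z) / (s + 1)) has_field_derivative
          (- (- exp (- s * of_real x)) + - exp (- (s + 1) * of_real x))) (at (of_real x))"
        by (intro DERIV_add DERIV_minus D s0)
      from has_vector_derivative_real_field[OF this] show ?thesis
        unfolding F_def[abs_def] f_def by simp
    qed
    show "isCont f x" for x unfolding f_def by (intro continuous_intros)
    have "integrable lborel (\<lambda>u. riesz_kernel \<sigma> u * iexp (w * u))"
      by (rule Bochner_Integration.integrable_bound[OF integrable_riesz_kernel[OF \<sigma>]])
         (use borel_measurable_continuous_onI[OF continuous_riesz_kernel] in \<open>auto simp: norm_mult\<close>)
    also have "(\<lambda>u. riesz_kernel \<sigma> u * iexp (w * u)) = (\<lambda>u. indicator {0<..} u *\<^sub>R f u)"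
      by (auto simp: fun_eq_iff f_eq riesz_kernel_nonpos simp del: of_real_mult split: split_indicator)
    finally show "set_integrable lborel (einterval 0 \<infinity>) f"
      by (simp add: set_integrable_def zero_ereal_def)
    have "isCont F 0" unfolding F_def by (intro continuous_intros) (use s0 in auto)
    thus "((F \<circ> real_of_ereal) \<longlongrightarrow> F 0) (at_right 0)"
      unfolding zero_ereal_def ereal_tendsto_simps by (auto simp: isCont_def intro: filterlim_mono at_le)
    have ex: "((\<lambda>u. exp (- z * of_real u)) \<longlongrightarrow> 0) at_top" if "Re z > 0" for z :: complex
      by (rule tendsto_norm_zero_cancel) (use exp_neg_tendsto_0_at_top[OF that] in simp)
    have "(F \<longlongrightarrow> - 0 / s + 0 / (s + 1)) at_top"
      unfolding F_def by (intro tendsto_intros ex) (use \<sigma> s0 in \<open>auto simp: s_def\<close>)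
    thus "((F \<circ> real_of_ereal) \<longlongrightarrow> 0) (at_left \<infinity>)"
      unfolding ereal_tendsto_simps by simp
  qed auto
  also have "0 - F 0 = 1 / (s * (s + 1))" using s0 by (simp add: F_def field_simps)
  finally show ?thesis by (simp add: s_def)
qed

lemma norm_riesz_kernel_fourier_le:
  assumes "\<sigma> \<ge> 1"
  shows "norm (1 / (Complex \<sigma> w * (Complex \<sigma> w + 1))) \<le> 1 / (1 + w\<^sup>2)"
proof -
  have "sqrt (1 + w\<^sup>2) \<le> norm (Complex x w)" if "x \<ge> 1" for x
    unfolding cmod_def using that by (intro real_sqrt_le_mono) auto
  from this[of \<sigma>] this[of "\<sigma> + 1"] have "sqrt (1 + w\<^sup>2) * sqrt (1 + w\<^sup>2) \<le> norm (Complex \<sigma> w) * norm (Complex (\<sigma> + 1) w)"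
    using assms by (intro mult_mono) auto
  moreover have "Complex (\<sigma> + 1) w = Complex \<sigma> w + 1" by (simp add: complex_eq_iff)
  ultimately have "1 + w\<^sup>2 \<le> norm (Complex \<sigma> w * (Complex \<sigma> w + 1))"
    by (simp add: norm_mult)
  moreover have "1 + w\<^sup>2 > 0" by (smt (verit) zero_le_power2)
  ultimately show ?thesis by (simp add: norm_divide frac_le)
qed

lemma integrable_one_plus_abs_powr:
  "integrable lborel (\<lambda>t::real. (1 + \<bar>t\<bar>) powr (-3/2))"
proof -
  have "set_integrable lborel (einterval 0 \<infinity>) (\<lambda>t. (1 + t) powr (-3/2))"
  proof (rule interval_integral_FTC_nonneg(1)[where F = "\<lambda>t. - 2 * (1 + t) powr (-1/2)" and A = "- 2 * (1 + 0) powr (-1/2)" and B = "- 2 * 0"])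
    show "((\<lambda>t. - 2 * (1 + t) powr (-1/2)) has_real_derivative (1 + x) powr (-3/2)) (at x)" if "0 < ereal x" for x
      using that by (auto intro!: derivative_eq_intros)
    show "isCont (\<lambda>t. (1 + t) powr (-3/2)) x" if "0 < ereal x" for x :: real
      using that by (intro continuous_intros) auto
    show "(((\<lambda>t. - 2 * (1 + t) powr (-1/2)) \<circ> real_of_ereal) \<longlongrightarrow> - 2 * (1 + 0) powr (-1/2)) (at_right 0)"
      unfolding zero_ereal_def ereal_tendsto_simps by (intro tendsto_intros) auto
    have "filterlim (\<lambda>t::real. 1 + t) at_top at_top"
      by (rule filterlim_tendsto_add_at_top[OF tendsto_const filterlim_ident])
    hence "((\<lambda>t::real. (1 + t) powr (-1/2)) \<longlongrightarrow> 0) at_top"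
      by (intro tendsto_neg_powr) auto
    thus "(((\<lambda>t. - 2 * (1 + t) powr (-1/2)) \<circ> real_of_ereal) \<longlongrightarrow> - 2 * 0) (at_left \<infinity>)"
      unfolding ereal_tendsto_simps by (intro tendsto_intros)
  qed auto
  hence *: "integrable lborel (\<lambda>t::real. indicator {0<..} t * (1 + \<bar>t\<bar>) powr (-3/2))"
    by (simp add: zero_ereal_def set_integrable_def) (auto elim!: Bochner_Integration.integrable_cong[THEN iffD1, rotated -1] split: split_indicator)
  have "integrable lborel (\<lambda>t::real. indicator {0<..} (0 + (-1) * t) * (1 + \<bar>0 + (-1) * t\<bar>) powr (-3/2))"
    by (rule lborel_integrable_real_affine[OF *]) simp
  with * have "integrable lborel (\<lambda>t::real. indicator {0<..} t * (1 + \<bar>t\<bar>) powr (-3/2) +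
      indicator {0<..} (0 + (-1) * t) * (1 + \<bar>0 + (-1) * t\<bar>) powr (-3/2))"
    by (rule Bochner_Integration.integrable_add)
  \<comment> \<open>The two half-lines miss the origin, hence equality only almost
    everywhere.\<close>
  moreover have "AE t::real in lborel. (1 + \<bar>t\<bar>) powr (-3/2) = indicator {0<..} t * (1 + \<bar>t\<bar>) powr (-3/2) +
      indicator {0<..} (0 + (-1) * t) * (1 + \<bar>0 + (-1) * t\<bar>) powr (-3/2)"
    using AE_lborel_singleton[of "0::real"] by eventually_elim (auto split: split_indicator)
  ultimately show ?thesis
    by (subst integrable_cong_AE) auto
qed


section \<open>Sums of the Moebius function\<close>

text \<open>A smoothed Perron formula: inverting the kernel at ln (N / n) for every n and exchanging
  sum and integral expresses the Riesz sum through \<open>dsum mu_c k\<close> on the single line Re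
  s = \<sigma>, where the hypothesis is integrated against the kernel transform.\<close>

lemma riesz_mean_integral_bound:
  assumes \<sigma>: "\<sigma> > 1" and N: "N \<ge> 1" and C: "C \<ge> 0"
    and F: "\<And>t. norm (dsum mu_c k (Complex \<sigma> t)) \<le> C * (1 + \<bar>t\<bar>) powr (1/2)"
  shows "\<bar>\<Sum>n=1..N. of_int (moebius_mu n) * ln (real n) ^ k * (real N - real n)\<bar>
    \<le> real N powr (\<sigma> + 1) * (C * (LBINT t. (1 + \<bar>t\<bar>) powr (-3/2)))"
proof -
  define v where "v = ln (real N)"
  define H where "H y = 1 / (Complex \<sigma> (-y) * (Complex \<sigma> (-y) + 1))" for y
  define a where "a n = dterm mu_c k (of_real \<sigma>) n" for n
  define I where "I = (LBINT t::real. (1 + \<bar>t\<bar>) powr (-3/2))"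
  define A where "A = (\<Sum>n=1..N. of_int (moebius_mu n) * ln (real n) ^ k * (real N - real n))"
  have \<sigma>0: "\<sigma> > 0" using \<sigma> by simp
  have Hb: "norm (H y) * (1 + \<bar>y\<bar>) powr (1/2) \<le> 2 * (1 + \<bar>y\<bar>) powr (-3/2)" for y
  proof -
    have "norm (H y) \<le> 1 / (1 + (-y)\<^sup>2)" unfolding H_def using \<sigma> by (intro norm_riesz_kernel_fourier_le) auto
    also have "\<dots> \<le> 2 / (1 + \<bar>y\<bar>)\<^sup>2"
    proof -
      have "0 \<le> (1 - \<bar>y\<bar>)\<^sup>2" by simp
      hence "(1 + \<bar>y\<bar>)\<^sup>2 \<le> 2 * (1 + y\<^sup>2)" by (simp add: power2_eq_square algebra_simps)
      moreover have "(1 + \<bar>y\<bar>)\<^sup>2 > 0" by (intro zero_less_power) auto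
      ultimately have "2 / (2 * (1 + y\<^sup>2)) \<le> 2 / (1 + \<bar>y\<bar>)\<^sup>2" by (intro frac_le) auto
      thus ?thesis by (simp del: distrib_left_numeral)
    qed
    also have "\<dots> = 2 * (1 + \<bar>y\<bar>) powr (-2)" by (simp add: powr_minus_divide)
    finally have "norm (H y) * (1 + \<bar>y\<bar>) powr (1/2) \<le> 2 * (1 + \<bar>y\<bar>) powr (-2) * (1 + \<bar>y\<bar>) powr (1/2)"
      by (intro mult_right_mono) auto
    also have "\<dots> = 2 * (1 + \<bar>y\<bar>) powr (-2 + 1/2)" unfolding powr_add by simp
    finally show ?thesis by simp
  qed
  have Hmeas [measurable]: "H \<in> borel_measurable borel"
  proof (rule borel_measurable_continuous_onI)
    have "Complex \<sigma> (-y) \<noteq> 0" "Complex \<sigma> (-y) + 1 \<noteq> 0" for y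
      using \<sigma> by (auto simp: complex_eq_iff)
    moreover have "(\<lambda>y. Complex \<sigma> (-y)) = (\<lambda>y. of_real \<sigma> - \<i> * of_real y)"
      by (auto simp: complex_eq_iff)
    hence "continuous_on UNIV (\<lambda>y. Complex \<sigma> (-y))" by (simp only:) (intro continuous_intros)
    ultimately show "continuous_on UNIV H" unfolding H_def by (intro continuous_intros) auto
  qed
  have Hint: "integrable lborel H"
  proof (rule Bochner_Integration.integrable_bound)
    show "integrable lborel (\<lambda>t::real. 2 * (1 + \<bar>t\<bar>) powr (-3/2))"
      by (intro integrable_mult_right integrable_one_plus_abs_powr)
    show "AE y in lborel. norm (H y) \<le> norm (2 * (1 + \<bar>y\<bar>) powr (-3/2))"
    proof (rule AE_I2)
      fix y :: real
      have "norm (H y) * 1 \<le> norm (H y) * (1 + \<bar>y\<bar>) powr (1/2)"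
        by (intro mult_left_mono ge_one_powr_ge_zero) auto
      thus "norm (H y) \<le> norm (2 * (1 + \<bar>y\<bar>) powr (-3/2))" using Hb[of y] by simp
    qed
  qed simp
  have inv: "complex_of_real (riesz_kernel \<sigma> w) = 1 / (2 * pi) * (CLBINT y. iexp (- (w * y)) * H y)" for w
    by (rule fourier_inversion[OF continuous_riesz_kernel integrable_riesz_kernel[OF \<sigma>0] riesz_kernel_bound[OF \<sigma>0] _ Hint])
       (simp only: H_def riesz_kernel_fourier[OF \<sigma>0])
  \<comment> \<open>Multiplying by n powr (-\<sigma>) and translating the argument by ln n together
    turn the phase into n powr (-s), as \<open>f_eq\<close> records.\<close>
  define f where "f n y = a n * (iexp (- ((v - ln (real n)) * y)) * H y)" for n y
  have f_eq: "f n y = iexp (- (v * y)) * H y * dterm mu_c k (Complex \<sigma> (-y)) n" for n y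
  proof (cases "n = 0")
    case False
    have "- Complex \<sigma> (-y) = - of_real \<sigma> + \<i> * of_real y" by (simp add: complex_eq_iff)
    hence "of_nat n powr (- Complex \<sigma> (-y)) = (of_nat n powr (- of_real \<sigma>) * of_nat n powr (\<i> * of_real y) :: complex)"
      by (simp only: powr_add)
    also have "of_nat n powr (\<i> * of_real y) = iexp (ln (real n) * y)"
      using False by (simp add: powr_def mult_ac)
    finally have 1: "of_nat n powr (- Complex \<sigma> (-y)) = of_nat n powr (- of_real \<sigma>) * iexp (ln (real n) * y)" .
    have 2: "iexp (- ((v - ln (real n)) * y)) = iexp (- (v * y)) * iexp (ln (real n) * y)"
      by (simp add: algebra_simps flip: exp_add)
    show ?thesis unfolding f_def a_def dterm_def 1 2 by (simp only: mult_ac)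
  qed (simp add: f_def a_def)
  have summ_a: "summable (\<lambda>n. norm (a n))"
    unfolding a_def by (rule summable_norm_dterm[OF _ norm_mu_c_le]) (use \<sigma> in simp)
  have norm_f: "norm (f n y) = norm (a n) * norm (H y)" for n y
    by (simp add: f_def norm_mult)
  have fint: "integrable lborel (f n)" for n
  proof (rule Bochner_Integration.integrable_bound)
    show "integrable lborel (\<lambda>y. norm (a n) * norm (H y))" using Hint by simp
    show "AE y in lborel. norm (f n y) \<le> norm (norm (a n) * norm (H y))" by (simp add: norm_f)
    show "f n \<in> borel_measurable lborel" unfolding f_def by measurable
  qed
  have int_f: "integral\<^sup>L lborel (f n) = 2 * pi * (a n * of_real (riesz_kernel \<sigma> (v - ln (real n))))" for n
    unfolding inv f_def by simp
  have "(\<Sum>n. integral\<^sup>L lborel (f n)) = (CLBINT y. (\<Sum>n. f n y))"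
  proof (rule integral_suminf[symmetric])
    show "AE y in lborel. summable (\<lambda>n. norm (f n y))"
      unfolding norm_f by (intro AE_I2 summable_mult2 summ_a)
    show "summable (\<lambda>n. LBINT y. norm (f n y))"
      unfolding norm_f by (simp add: summable_mult2 summ_a)
  qed (rule fint)
  also have "(\<lambda>y. \<Sum>n. f n y) = (\<lambda>y. iexp (- (v * y)) * H y * dsum mu_c k (Complex \<sigma> (-y)))"
  proof (rule ext)
    fix y
    have "dterm mu_c k (Complex \<sigma> (-y)) sums dsum mu_c k (Complex \<sigma> (-y))"
      by (rule dsum_sums[OF _ norm_mu_c_le]) (use \<sigma> in simp)
    from sums_mult[OF this, of "iexp (- (v * y)) * H y"]
    show "(\<Sum>n. f n y) = iexp (- (v * y)) * H y * dsum mu_c k (Complex \<sigma> (-y))"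
      unfolding f_eq by (rule sums_unique[symmetric])
  qed
  finally have E1: "(\<Sum>n. integral\<^sup>L lborel (f n)) = (CLBINT y. iexp (- (v * y)) * H y * dsum mu_c k (Complex \<sigma> (-y)))" .
  have term0: "integral\<^sup>L lborel (f n) = 0" if "n \<notin> {1..N}" for n
  proof (cases "n = 0")
    case True thus ?thesis by (simp add: int_f a_def)
  next
    case False
    \<comment> \<open>Here n > N, where the kernel vanishes; the infinite series is thus a finite
      sum.\<close>
    hence "v - ln (real n) \<le> 0" using that N by (simp add: v_def)
    thus ?thesis by (simp add: int_f riesz_kernel_nonpos)
  qed
  have term1: "integral\<^sup>L lborel (f n) =
     of_real (2 * pi * real N powr (-(\<sigma> + 1)) * (of_int (moebius_mu n) * ln (real n) ^ k * (real N - real n)))"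
    if "n \<in> {1..N}" for n
  proof -
    have n: "n \<ge> 1" "n \<le> N" using that by auto
    have "v - ln (real n) \<ge> 0" using n by (simp add: v_def)
    hence "riesz_kernel \<sigma> (v - ln (real n)) = exp (- \<sigma> * (v - ln (real n))) - exp (- (\<sigma> + 1) * (v - ln (real n)))"
      by (rule riesz_kernel_nonneg)
    also have "exp (- b * (v - ln (real n))) = real N powr (-b) * real n powr b" for b
      using n N by (simp add: powr_def v_def algebra_simps flip: exp_add)
    hence "exp (- \<sigma> * (v - ln (real n))) - exp (- (\<sigma> + 1) * (v - ln (real n))) =
       real N powr (-\<sigma>) * real n powr \<sigma> - real N powr (-(\<sigma> + 1)) * real n powr (\<sigma> + 1)" by (simp only:)
    also have "real n powr (\<sigma> + 1) = real n powr \<sigma> * real n" using n by (simp add: powr_add)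
    also have "real N powr (-\<sigma>) = real N powr (-(\<sigma> + 1)) * real N"
      using N by (simp add: powr_diff powr_minus)
    finally have r: "riesz_kernel \<sigma> (v - ln (real n)) = real N powr (-(\<sigma> + 1)) * real n powr \<sigma> * (real N - real n)"
      by (simp add: algebra_simps)
    have np: "of_nat n powr (- of_real \<sigma>) = complex_of_real (real n powr (-\<sigma>))"
      using powr_of_real[of "real n" "-\<sigma>"] by simp
    have c: "real n powr (-\<sigma>) * real n powr \<sigma> = 1" using n by (simp flip: powr_add)
    have "integral\<^sup>L lborel (f n) = of_real (2 * pi * (of_int (moebius_mu n) * ln (real n) ^ k *
        real N powr (-(\<sigma> + 1)) * (real N - real n)) * (real n powr (-\<sigma>) * real n powr \<sigma>))"
      unfolding int_f a_def dterm_def np r by simp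
    thus ?thesis unfolding c mult_1_right by (simp only: mult_ac)
  qed
  have "(\<Sum>n. integral\<^sup>L lborel (f n)) = (\<Sum>n\<in>{1..N}. integral\<^sup>L lborel (f n))"
    by (rule suminf_finite) (use term0 in auto)
  also have "\<dots> = (\<Sum>n\<in>{1..N}. of_real (2 * pi * real N powr (-(\<sigma> + 1)) * (of_int (moebius_mu n) * ln (real n) ^ k * (real N - real n))))"
    by (intro sum.cong refl term1)
  also have "\<dots> = of_real (2 * pi * real N powr (-(\<sigma> + 1)) * A)"
    by (simp only: A_def sum_distrib_left of_real_sum)
  finally have E2: "of_real (2 * pi * real N powr (-(\<sigma> + 1)) * A) = (CLBINT y. iexp (- (v * y)) * H y * dsum mu_c k (Complex \<sigma> (-y)))"
    unfolding E1 by simp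
  have "norm (CLBINT y. iexp (- (v * y)) * H y * dsum mu_c k (Complex \<sigma> (-y))) \<le>
      (LBINT y. norm (iexp (- (v * y)) * H y * dsum mu_c k (Complex \<sigma> (-y))))"
    by (rule integral_norm_bound)
  also have "\<dots> \<le> (LBINT y::real. 2 * C * (1 + \<bar>y\<bar>) powr (-3/2))"
  proof (rule integral_mono')
    show "integrable lborel (\<lambda>y::real. 2 * C * (1 + \<bar>y\<bar>) powr (-3/2))"
      by (intro integrable_mult_right integrable_one_plus_abs_powr)
    fix y :: real
    have "norm (iexp (- (v * y)) * H y * dsum mu_c k (Complex \<sigma> (-y))) = norm (H y) * norm (dsum mu_c k (Complex \<sigma> (-y)))"
      by (simp add: norm_mult)
    also have "\<dots> \<le> norm (H y) * (C * (1 + \<bar>-y\<bar>) powr (1/2))" by (intro mult_left_mono F) auto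
    also have "\<dots> = C * (norm (H y) * (1 + \<bar>y\<bar>) powr (1/2))" by simp
    also have "\<dots> \<le> C * (2 * (1 + \<bar>y\<bar>) powr (-3/2))" using C by (intro mult_left_mono Hb)
    finally show "norm (iexp (- (v * y)) * H y * dsum mu_c k (Complex \<sigma> (-y))) \<le> 2 * C * (1 + \<bar>y\<bar>) powr (-3/2)" by simp
  qed (use C in auto)
  also have "\<dots> = 2 * C * I" by (simp add: I_def)
  finally have "\<bar>2 * pi * real N powr (-(\<sigma> + 1)) * A\<bar> \<le> 2 * C * I"
    unfolding E2[symmetric] norm_of_real .
  hence "2 * pi * real N powr (-(\<sigma> + 1)) * \<bar>A\<bar> \<le> 2 * C * I" by (simp add: abs_mult)
  moreover have "1 * (2 * real N powr (-(\<sigma> + 1)) * \<bar>A\<bar>) \<le> pi * (2 * real N powr (-(\<sigma> + 1)) * \<bar>A\<bar>)"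
    by (intro mult_right_mono) (use pi_gt3 in auto)
  ultimately have "real N powr (-(\<sigma> + 1)) * \<bar>A\<bar> \<le> C * I" by (simp add: mult_ac)
  hence "real N powr (\<sigma> + 1) * (real N powr (-(\<sigma> + 1)) * \<bar>A\<bar>) \<le> real N powr (\<sigma> + 1) * (C * I)"
    by (intro mult_left_mono) auto
  moreover have "real N powr (\<sigma> + 1) * real N powr (-(\<sigma> + 1)) = 1" using N by (simp flip: powr_add)
  ultimately show ?thesis by (simp add: A_def I_def flip: mult.assoc)
qed

lemma riesz_mean_bound:
  obtains C N0 where "C \<ge> 0" "N0 \<ge> (3::nat)"
    "\<And>N. N \<ge> N0 \<Longrightarrow> \<bar>\<Sum>n=1..N. of_int (moebius_mu n) * ln (real n) ^ k * (real N - real n)\<bar> \<le> C * real N ^ 2"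
proof -
  obtain d where d: "0 < d" "d \<le> 1" and b:
    "\<And>k. \<exists>C\<ge>0. \<forall>\<sigma> t. 1 < \<sigma> \<longrightarrow> \<sigma> \<le> 1 + d \<longrightarrow>
        norm (dsum mu_c k (Complex \<sigma> t)) \<le> C * (1 + \<bar>t\<bar>) powr (1/2)"
    using mu_bound by blast
  obtain C where C: "C \<ge> 0" "\<And>\<sigma> t. 1 < \<sigma> \<Longrightarrow> \<sigma> \<le> 1 + d \<Longrightarrow>
        norm (dsum mu_c k (Complex \<sigma> t)) \<le> C * (1 + \<bar>t\<bar>) powr (1/2)"
    using b[of k] by blast
  define I where "I = (LBINT t::real. (1 + \<bar>t\<bar>) powr (-3/2))"
  have I: "I \<ge> 0" unfolding I_def by (intro integral_nonneg_AE) auto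
  \<comment> \<open>From here on 1 / ln N \<le> d, so the line \<sigma> = 1 + 1 / ln N lies in the
    strip where the uniform bound holds.\<close>
  define N0 where "N0 = max 3 (nat \<lceil>exp (1 / d)\<rceil>)"
  show ?thesis
  proof (rule that[of "exp 1 * (C * I)" N0])
    show "exp 1 * (C * I) \<ge> 0" using C I by simp
    show "N0 \<ge> 3" by (simp add: N0_def)
    fix N assume N: "N \<ge> N0"
    hence N3: "N \<ge> 3" by (simp add: N0_def)
    have "exp (1 / d) \<le> real (nat \<lceil>exp (1 / d)\<rceil>)" by (rule real_nat_ceiling_ge)
    also have "\<dots> \<le> real N0" by (simp add: N0_def)
    also have "\<dots> \<le> real N" using N by simp
    finally have ld: "1 / d \<le> ln (real N)" using N3 by (subst ln_ge_iff) auto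
    moreover have "1 / d > 0" using d by simp
    ultimately have l: "ln (real N) > 0" by linarith
    \<comment> \<open>This choice makes N powr (\<sigma> + 1) equal to e N^2.\<close>
    define \<sigma> where "\<sigma> = 1 + 1 / ln (real N)"
    have "1 / ln (real N) \<le> d" using ld l d by (simp add: field_simps)
    hence \<sigma>: "1 < \<sigma>" "\<sigma> \<le> 1 + d" using l by (auto simp: \<sigma>_def)
    have "\<bar>\<Sum>n=1..N. of_int (moebius_mu n) * ln (real n) ^ k * (real N - real n)\<bar> \<le> real N powr (\<sigma> + 1) * (C * I)"
      unfolding I_def using N3 by (intro riesz_mean_integral_bound \<sigma> C) auto
    also have "real N powr (\<sigma> + 1) = real N ^ 2 * exp 1"
    proof -
      have "(\<sigma> + 1) * ln (real N) = 2 * ln (real N) + 1" using l by (simp add: \<sigma>_def field_simps)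
      thus ?thesis using N3 by (simp add: powr_def exp_add) (simp add: exp_double)
    qed
    finally show "\<bar>\<Sum>n=1..N. of_int (moebius_mu n) * ln (real n) ^ k * (real N - real n)\<bar> \<le> exp 1 * (C * I) * real N ^ 2"
      by (simp add: mult_ac)
  qed
qed

section \<open>From Riesz means to the summatory function\<close>

text \<open>The Riesz sum is the discrete integral of the partial sums, so its increment over h
  steps is h times their average on a short interval.\<close>

lemma riesz_mean_diff:
  fixes a :: "nat \<Rightarrow> real"
  shows "(\<Sum>n=1..N+h. a n * (real (N + h) - real n)) - (\<Sum>n=1..N. a n * (real N - real n))
     = (\<Sum>m\<in>{N..<N+h}. \<Sum>n=1..m. a n)"
proof (induction h)
  case (Suc h)
  have "(\<Sum>n=1..N+Suc h. a n * (real (N + Suc h) - real n)) = (\<Sum>n=1..N+h. a n * (real (N + h) - real n) + a n)"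
    by (simp add: algebra_simps)
  also have "\<dots> = (\<Sum>n=1..N+h. a n * (real (N + h) - real n)) + (\<Sum>n=1..N+h. a n)"
    by (rule sum.distrib)
  finally show ?case using Suc by simp
qed simp

lemma sum_atLeast1_split:
  fixes a :: "nat \<Rightarrow> 'a :: comm_monoid_add"
  assumes "R \<le> n"
  shows "(\<Sum>i=1..n. a i) = (\<Sum>i=1..R. a i) + (\<Sum>i=Suc R..n. a i)"
proof -
  have "{1..n} = {1..R} \<union> {Suc R..n}" using assms by auto
  thus ?thesis by (simp only:) (intro sum.union_disjoint, auto)
qed

text \<open>The partial sum at N is compared with its average over the next h values. With l = ln N,
  the Riesz bound contributes N^2 / h and the variation inside the interval at most h l^(2 m), up to
  constants; for h near N / l^m both are N l^m. This saves l^m over the trivial N l^(2 m).\<close>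

lemma mu_log_sum_bound:
  obtains C N0 where "C \<ge> 0" "N0 \<ge> (3::nat)"
    "\<And>N. N \<ge> N0 \<Longrightarrow> \<bar>\<Sum>n=1..N. of_int (moebius_mu n) * ln (real n) ^ (2 * m)\<bar> \<le> C * real N * ln (real N) ^ m"
proof -
  define a where "a n = of_int (moebius_mu n) * ln (real n) ^ (2 * m)" for n :: nat
  obtain C N0 where C: "C \<ge> 0" "N0 \<ge> (3::nat)"
    "\<And>N. N \<ge> N0 \<Longrightarrow> \<bar>\<Sum>n=1..N. a n * (real N - real n)\<bar> \<le> C * real N ^ 2"
    unfolding a_def using riesz_mean_bound[of "2 * m"] by blast
  obtain B :: real where B: "B \<ge> 1" "\<And>x. x \<ge> 1 \<Longrightarrow> (1 + ln x) ^ m \<le> B * x powr 1"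
    by (rule log_power_le_powr[of 1 m]) auto
  show ?thesis
  proof (rule that[of "5 * C + (1 + B) * 4 ^ m" N0])
    show "5 * C + (1 + B) * 4 ^ m \<ge> 0" using C B by simp
    show "N0 \<ge> 3" by (rule C)
    fix N assume N: "N \<ge> N0"
    hence N3: "N \<ge> 3" using C by simp
    define l where "l = ln (real N)"
    have l: "l \<ge> 1"
    proof -
      have "exp 1 \<le> real N" using N3 exp_le by linarith
      thus ?thesis unfolding l_def using N3 by (subst ln_ge_iff) auto
    qed
    have lm: "l ^ m \<ge> 1" using l by simp
    have lmB: "l ^ m \<le> B * real N"
    proof -
      have "l ^ m \<le> (1 + l) ^ m" using l by (intro power_mono) auto
      also have "\<dots> \<le> B * real N" using B(2)[of "real N"] N3 by (simp add: l_def)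
      finally show ?thesis .
    qed
    \<comment> \<open>The balancing length, rounded up. Because l^m \<le> B N, rounding enlarges it
      at most by the factor 1 + B, and h \<le> N keeps the interval below 2 N.\<close>
    define h where "h = nat \<lceil>real N / l ^ m\<rceil>"
    have q0: "real N / l ^ m > 0" using N3 lm by (intro divide_pos_pos) auto
    have h1: "real N / l ^ m \<le> real h" unfolding h_def by (rule real_nat_ceiling_ge)
    have h2: "real h \<le> real N / l ^ m + 1" unfolding h_def using q0 by linarith
    have "1 \<le> B * (real N / l ^ m)" using lmB lm by (simp add: field_simps)
    hence h3: "real h \<le> (1 + B) * (real N / l ^ m)" 
      unfolding distrib_right mult_1 using h2 by linarith
    have "real N / l ^ m \<le> real N / 1" using lm by (intro divide_left_mono) auto
    hence hN: "h \<le> N" unfolding h_def by (simp add: nat_le_iff ceiling_le_iff)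
    have h0: "real h > 0" using h1 q0 by linarith
    define A where "A n = (\<Sum>i=1..n. a i)" for n
    define D where "D n = (\<Sum>i=1..n. a i * (real n - real i))" for n
    have D: "D (N + h) - D N = (\<Sum>j\<in>{N..<N+h}. A j)"
      unfolding D_def A_def by (rule riesz_mean_diff)
    have ab: "\<bar>a i\<bar> \<le> 4 ^ m * l ^ (2 * m)" if i: "1 \<le> i" "i \<le> 2 * N" for i
    proof -
      have "\<bar>a i\<bar> = \<bar>of_int (moebius_mu i)\<bar> * ln (real i) ^ (2 * m)"
        unfolding a_def abs_mult using i by (simp add: power_abs)
      also have "\<dots> \<le> 1 * (2 * l) ^ (2 * m)"
      proof (intro mult_mono power_mono)
        \<comment> \<open>Passing from 2 N to N^2 gives ln i \<le> 2 l, the origin of the factor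
          4^m.\<close>
        have "real i \<le> real N * real N" 
        proof -
          have "real i \<le> 2 * real N" using i by linarith
          also have "\<dots> \<le> real N * real N" using N3 by (intro mult_right_mono) auto
          finally show ?thesis .
        qed
        hence "ln (real i) \<le> ln (real N * real N)" using i N3 by (subst ln_le_cancel_iff) auto
        thus "ln (real i) \<le> 2 * l" using N3 by (simp add: ln_mult l_def)
        show "\<bar>real_of_int (moebius_mu i)\<bar> \<le> 1"
          using abs_moebius_mu_le[of i] by (metis of_int_abs of_int_le_1_iff)
      qed (use i in auto)
      also have "(2 * l) ^ (2 * m) = 4 ^ m * l ^ (2 * m)"
        by (simp add: power_mult_distrib power_mult)
      finally show ?thesis by simp
    qed
    have Ad: "\<bar>A j - A N\<bar> \<le> real h * (4 ^ m * l ^ (2 * m))" if j: "j \<in> {N..<N+h}" for j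
    proof -
      have "A j = A N + (\<Sum>i=N+1..j. a i)"
        unfolding A_def using j sum_atLeast1_split[of N j a] by simp
      hence "\<bar>A j - A N\<bar> \<le> (\<Sum>i=N+1..j. \<bar>a i\<bar>)" by simp
      also have "\<dots> \<le> (\<Sum>i=N+1..j. 4 ^ m * l ^ (2 * m))"
        using j hN by (intro sum_mono ab) auto
      also have "\<dots> = real (j - N) * (4 ^ m * l ^ (2 * m))" by simp
      also have "\<dots> \<le> real h * (4 ^ m * l ^ (2 * m))" using j l by (intro mult_right_mono) auto
      finally show ?thesis .
    qed
    have "real h * A N = (D (N + h) - D N) - (\<Sum>j\<in>{N..<N+h}. A j - A N)"
      unfolding D by (simp add: sum_subtractf)
    hence "\<bar>real h * A N\<bar> \<le> \<bar>D (N + h)\<bar> + \<bar>D N\<bar> + (\<Sum>j\<in>{N..<N+h}. \<bar>A j - A N\<bar>)"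
      using sum_abs[of "\<lambda>j. A j - A N" "{N..<N+h}"] by linarith
    also have "\<dots> \<le> C * (2 * real N) ^ 2 + C * real N ^ 2 + (\<Sum>j\<in>{N..<N+h}. real h * (4 ^ m * l ^ (2 * m)))"
    proof (intro add_mono sum_mono Ad)
      have "\<bar>D (N + h)\<bar> \<le> C * real (N + h) ^ 2" unfolding D_def using N by (intro C(3)) auto
      also have "\<dots> \<le> C * (2 * real N) ^ 2" using hN C by (intro mult_left_mono power_mono) auto
      finally show "\<bar>D (N + h)\<bar> \<le> C * (2 * real N) ^ 2" .
      show "\<bar>D N\<bar> \<le> C * real N ^ 2" unfolding D_def using N by (intro C(3))
    qed
    also have "\<dots> = 5 * C * real N ^ 2 + real h * (real h * (4 ^ m * l ^ (2 * m)))"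
      by (simp add: power2_eq_square)
    also have "\<dots> \<le> real h * (5 * C * real N * l ^ m) + real h * ((1 + B) * (real N / l ^ m) * (4 ^ m * l ^ (2 * m)))"
    proof (intro add_mono mult_left_mono mult_right_mono h3)
      have "real N \<le> real h * l ^ m" using h1 lm by (simp add: field_simps)
      hence "5 * C * real N * real N \<le> 5 * C * real N * (real h * l ^ m)" using C by (intro mult_left_mono) auto
      thus "5 * C * real N ^ 2 \<le> real h * (5 * C * real N * l ^ m)" by (simp add: power2_eq_square mult_ac)
    qed (use l in auto)
    also have "\<dots> = real h * ((5 * C + (1 + B) * 4 ^ m) * real N * l ^ m)"
    proof -
      have "l \<noteq> 0" using l by linarith
      hence "real N / l ^ m * (4 ^ m * l ^ (2 * m)) = 4 ^ m * real N * l ^ m"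
        by (simp only: mult_2 power_add) simp
      hence "(1 + B) * (real N / l ^ m) * (4 ^ m * l ^ (2 * m)) = (1 + B) * (4 ^ m * real N * l ^ m)"
        by (simp only: mult.assoc)
      thus ?thesis by (simp only:) (simp add: algebra_simps)
    qed
    finally have "real h * \<bar>A N\<bar> \<le> real h * ((5 * C + (1 + B) * 4 ^ m) * real N * l ^ m)"
      by (simp add: abs_mult)
    hence "\<bar>A N\<bar> \<le> (5 * C + (1 + B) * 4 ^ m) * real N * l ^ m" using h0 by (simp only: mult_le_cancel_left_pos)
    thus "\<bar>\<Sum>n=1..N. of_int (moebius_mu n) * ln (real n) ^ (2 * m)\<bar> \<le> (5 * C + (1 + B) * 4 ^ m) * real N * ln (real N) ^ m"
      by (simp add: A_def a_def l_def)
  qed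
qed

text \<open>For nonnegative decreasing weights the total variation and the last weight telescope to
  the first weight.\<close>

lemma abel_sum_bound:
  fixes a w :: "nat \<Rightarrow> real"
  assumes "R < N" "B \<ge> 0" "\<And>n. R < n \<Longrightarrow> n \<le> N \<Longrightarrow> \<bar>\<Sum>i=Suc R..n. a i\<bar> \<le> B"
    and w: "\<And>n. R < n \<Longrightarrow> w n \<ge> 0" "\<And>n. R < n \<Longrightarrow> w (Suc n) \<le> w n"
  shows "\<bar>\<Sum>n=Suc R..N. a n * w n\<bar> \<le> B * w (Suc R)"
proof -
  define S where "S n = (\<Sum>i=Suc R..n. a i)" for n
  \<comment> \<open>The boundary term is split off so that every step adds only B times one
    decrement of the weight.\<close>
  have "\<bar>(\<Sum>n=Suc R..M. a n * w n) - S M * w M\<bar> \<le> B * (w (Suc R) - w M)" if "Suc R \<le> M" "M \<le> N" for M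
    using that
  proof (induction M rule: dec_induct)
    case base
    show ?case by (simp add: S_def)
  next
    case (step M)
    have "(\<Sum>n=Suc R..Suc M. a n * w n) - S (Suc M) * w (Suc M) =
      ((\<Sum>n=Suc R..M. a n * w n) - S M * w M) + S M * (w M - w (Suc M))"
      using step by (simp add: S_def algebra_simps)
    also have "\<bar>\<dots>\<bar> \<le> B * (w (Suc R) - w M) + B * (w M - w (Suc M))"
    proof (intro order_trans[OF abs_triangle_ineq] add_mono)
      show "\<bar>(\<Sum>n=Suc R..M. a n * w n) - S M * w M\<bar> \<le> B * (w (Suc R) - w M)" using step by simp
      have "\<bar>S M\<bar> \<le> B" unfolding S_def using step by (intro assms(3)) auto
      moreover have "w M - w (Suc M) \<ge> 0" using w(2)[of M] step by simp
      ultimately show "\<bar>S M * (w M - w (Suc M))\<bar> \<le> B * (w M - w (Suc M))"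
        unfolding abs_mult by (intro mult_mono) auto
    qed
    finally show ?case by (simp add: algebra_simps)
  qed
  from this[of N] have "\<bar>(\<Sum>n=Suc R..N. a n * w n) - S N * w N\<bar> \<le> B * (w (Suc R) - w N)" using assms(1) by simp
  moreover have "\<bar>S N * w N\<bar> \<le> B * w N"
    unfolding abs_mult S_def using assms(1,2) w(1)[of N] by (intro mult_mono assms(3)) auto
  ultimately show ?thesis by (simp add: algebra_simps)
qed

lemma sum_moebius_trivial: "\<bar>\<Sum>n=1..N. real_of_int (moebius_mu n)\<bar> \<le> real N"
proof -
  have "\<bar>\<Sum>n=1..N. real_of_int (moebius_mu n)\<bar> \<le> (\<Sum>n=1..N. \<bar>real_of_int (moebius_mu n)\<bar>)" by (rule sum_abs)
  also have "\<dots> \<le> (\<Sum>n=1..N. 1)"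
    using abs_moebius_mu_le by (intro sum_mono) (metis of_int_abs of_int_le_1_iff)
  finally show ?thesis by simp
qed

section \<open>Removal of the logarithmic weight\<close>

text \<open>This makes initial segments of length about sqrt x negligible, so they can be bounded
  trivially.\<close>

lemma sqrt_le_div_ln_power:
  obtains B :: real where "B \<ge> 1" "\<And>x. x \<ge> 3 \<Longrightarrow> sqrt x \<le> B * (x / ln x ^ m)"
proof -
  obtain B :: real where B: "B \<ge> 1" "\<And>x. x \<ge> 1 \<Longrightarrow> (1 + ln x) ^ m \<le> B * x powr (1/2)"
    by (rule log_power_le_powr[of "1/2" m]) auto
  show ?thesis
  proof (rule that[of B])
    fix x :: real assume x: "x \<ge> 3"
    have l: "ln x > 0" using x by simp
    have "ln x ^ m \<le> (1 + ln x) ^ m" using l by (intro power_mono) auto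
    also have "\<dots> \<le> B * sqrt x" using B(2)[of x] x by (simp add: powr_half_sqrt)
    finally have "sqrt x * ln x ^ m \<le> sqrt x * (B * sqrt x)" using x by (intro mult_left_mono) auto
    also have "\<dots> = B * x" using x by simp
    finally show "sqrt x \<le> B * (x / ln x ^ m)" using l by (simp add: field_simps)
  qed (rule B)
qed

text \<open>Partial summation with the weight 1 / (ln n)^(2 m) starts only near sqrt N, where ln n
  is already at least half of ln N. The weight then costs 4^m / (ln N)^(2 m), which turns N (ln N)^m
  into N / (ln N)^m.\<close>

lemma moebius_sum_bound:
  obtains C N0 where "C \<ge> 0" "N0 \<ge> (3::nat)"
    "\<And>N. N \<ge> N0 \<Longrightarrow> \<bar>\<Sum>n=1..N. real_of_int (moebius_mu n)\<bar> \<le> C * (real N / ln (real N) ^ m)"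
proof -
  define a where "a n = of_int (moebius_mu n) * ln (real n) ^ (2 * m)" for n :: nat
  obtain C N1 where C: "C \<ge> 0" "N1 \<ge> (3::nat)"
    "\<And>N. N \<ge> N1 \<Longrightarrow> \<bar>\<Sum>n=1..N. a n\<bar> \<le> C * real N * ln (real N) ^ m"
    unfolding a_def using mu_log_sum_bound[of m] by blast
  obtain B :: real where B: "B \<ge> 1" "\<And>x. x \<ge> 3 \<Longrightarrow> sqrt x \<le> B * (x / ln x ^ m)"
    using sqrt_le_div_ln_power[of m] by blast
  show ?thesis
  \<comment> \<open>The threshold is squared because the bound for the weighted sums is already
    needed at sqrt N. The factor 2 at C comes from a difference of two partial sums, the one at B
    from rounding sqrt N up.\<close>
  proof (rule that[of "2 * B + 2 * C * 4 ^ m" "N1 ^ 2"])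
    show "2 * B + 2 * C * 4 ^ m \<ge> 0" using B C by simp
    show "N1 ^ 2 \<ge> 3" using C(2) power_increasing[of 1 2 N1] by simp
    fix N assume N: "N \<ge> N1 ^ 2"
    have N9: "N \<ge> 9" using N power_mono[OF C(2), of 2] by simp
    define R where "R = nat \<lceil>sqrt (real N)\<rceil>"
    have R1: "sqrt (real N) \<le> real R" unfolding R_def by (rule real_nat_ceiling_ge)
    have s3: "sqrt (real N) \<ge> 3" using N9 by (intro real_le_rsqrt) auto
    have R2: "real R \<le> 2 * sqrt (real N)" unfolding R_def using s3 by linarith
    have RN1: "R \<ge> N1"
    proof -
      have "real N1 \<le> sqrt (real N)" using N by (intro real_le_rsqrt) (metis of_nat_le_iff of_nat_power)
      thus ?thesis using R1 by linarith
    qed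
    have RN: "R < N"
    proof -
      have "2 * sqrt (real N) < sqrt (real N) * sqrt (real N)" using s3 by (intro mult_strict_right_mono) linarith+
      thus ?thesis using R2 by simp
    qed
    define l where "l = ln (real N)"
    have l: "l > 0" using N9 by (simp add: l_def)
    define w where "w n = 1 / ln (real n) ^ (2 * m)" for n :: nat
    have lnpos: "ln (real n) > 0" if "R < n" for n using that RN1 C(2) by simp
    have "\<bar>\<Sum>n=Suc R..N. a n * w n\<bar> \<le> (2 * C * real N * l ^ m) * w (Suc R)"
    proof (rule abel_sum_bound[OF RN])
      show "2 * C * real N * l ^ m \<ge> 0" using C l by simp
      fix n assume n: "R < n"
      show "w n \<ge> 0" using lnpos[OF n] by (simp add: w_def)
      show "w (Suc n) \<le> w n" unfolding w_def using lnpos[OF n] n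
        by (intro divide_left_mono power_mono mult_pos_pos zero_less_power) auto
      assume nN: "n \<le> N"
      have A: "\<bar>\<Sum>i=1..j. a i\<bar> \<le> C * real N * l ^ m" if j: "R \<le> j" "j \<le> N" for j
      proof -
        have "\<bar>\<Sum>i=1..j. a i\<bar> \<le> C * real j * ln (real j) ^ m" using j RN1 by (intro C(3)) auto
        also have "\<dots> \<le> C * real N * l ^ m"
          unfolding l_def using j RN1 C by (intro mult_mono power_mono) auto
        finally show ?thesis .
      qed
      have "(\<Sum>i=1..n. a i) = (\<Sum>i=1..R. a i) + (\<Sum>i=Suc R..n. a i)"
        using n by (intro sum_atLeast1_split) auto
      thus "\<bar>\<Sum>i=Suc R..n. a i\<bar> \<le> 2 * C * real N * l ^ m"
        using A[of R] A[of n] n nN by (simp add: abs_le_iff)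
    qed
    also have "(\<Sum>n=Suc R..N. a n * w n) = (\<Sum>n=Suc R..N. real_of_int (moebius_mu n))"
      using lnpos by (intro sum.cong) (auto simp: a_def w_def Suc_le_eq dest!: lnpos)
    also have "(2 * C * real N * l ^ m) * w (Suc R) \<le> (2 * C * real N * l ^ m) * (4 ^ m / l ^ (2 * m))"
    proof (rule mult_left_mono)
      have "l / 2 = ln (sqrt (real N))" using N9 by (simp add: l_def ln_sqrt)
      also have "\<dots> \<le> ln (real (Suc R))" using R1 s3 by (intro ln_mono) linarith+
      finally have "(l / 2) ^ (2 * m) \<le> ln (real (Suc R)) ^ (2 * m)" using l by (intro power_mono) auto
      moreover have "0 < (l / 2) ^ (2 * m)" using l by simp
      ultimately have "w (Suc R) \<le> 1 / (l / 2) ^ (2 * m)" unfolding w_def by (intro frac_le) auto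
      also have "\<dots> = 4 ^ m / l ^ (2 * m)" by (simp add: power_divide power_mult)
      finally show "w (Suc R) \<le> 4 ^ m / l ^ (2 * m)" .
    qed (use C l in auto)
    also have "\<dots> = 2 * C * 4 ^ m * (real N / l ^ m)"
    proof -
      have "l ^ m / l ^ (2 * m) = 1 / l ^ m" using l by (simp add: mult_2 power_add)
      moreover have "2 * C * real N * l ^ m * (4 ^ m / l ^ (2 * m)) = 2 * C * 4 ^ m * (real N * (l ^ m / l ^ (2 * m)))"
        by simp
      ultimately show ?thesis by simp
    qed
    finally have T: "\<bar>\<Sum>n=Suc R..N. real_of_int (moebius_mu n)\<bar> \<le> 2 * C * 4 ^ m * (real N / l ^ m)" .
    have "(\<Sum>n=1..N. real_of_int (moebius_mu n)) = (\<Sum>n=1..R. real_of_int (moebius_mu n)) + (\<Sum>n=Suc R..N. real_of_int (moebius_mu n))"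
      using RN by (intro sum_atLeast1_split) auto
    hence "\<bar>\<Sum>n=1..N. real_of_int (moebius_mu n)\<bar> \<le> real R + 2 * C * 4 ^ m * (real N / l ^ m)"
      using T sum_moebius_trivial[of R] by linarith
    also have "real R \<le> 2 * B * (real N / l ^ m)" using R2 B(2)[of "real N"] N9 by (simp add: l_def)
    finally show "\<bar>\<Sum>n=1..N. real_of_int (moebius_mu n)\<bar> \<le> (2 * B + 2 * C * 4 ^ m) * (real N / ln (real N) ^ m)"
      by (simp add: l_def algebra_simps)
  qed
qed

text \<open>The correlation sum needs the summatory function at n and at n + x, hence at all y \<le>
  2 x, with a bound in x alone. Up to sqrt x the trivial bound suffices; beyond it ln y is at least
  half of ln x.\<close>

lemma moebius_sum_uniform_bound:
  obtains C x0 where "C \<ge> 0" "x0 \<ge> (3::nat)"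
    "\<And>x y. x \<ge> x0 \<Longrightarrow> y \<le> 2 * x \<Longrightarrow> \<bar>\<Sum>n=1..y. real_of_int (moebius_mu n)\<bar> \<le> C * (real x / ln (real x) ^ m)"
proof -
  obtain C N0 where C: "C \<ge> 0" "N0 \<ge> (3::nat)"
    "\<And>N. N \<ge> N0 \<Longrightarrow> \<bar>\<Sum>n=1..N. real_of_int (moebius_mu n)\<bar> \<le> C * (real N / ln (real N) ^ m)"
    using moebius_sum_bound[of m] by blast
  obtain B :: real where B: "B \<ge> 1" "\<And>x. x \<ge> 3 \<Longrightarrow> sqrt x \<le> B * (x / ln x ^ m)"
    using sqrt_le_div_ln_power[of m] by blast
  show ?thesis
  proof (rule that[of "B + C * (2 * 2 ^ m)" "N0 ^ 2"])
    show "B + C * (2 * 2 ^ m) \<ge> 0" using B C by simp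
    show "N0 ^ 2 \<ge> 3" using C(2) power_increasing[of 1 2 N0] by simp
    fix x y :: nat assume x: "x \<ge> N0 ^ 2" and y: "y \<le> 2 * x"
    have x9: "x \<ge> 9" using x power_mono[OF C(2), of 2] by simp
    have s: "sqrt (real x) \<ge> real N0" using x by (intro real_le_rsqrt) (metis of_nat_le_iff of_nat_power)
    have l: "ln (real x) > 0" using x9 by simp
    let ?q = "real x / ln (real x) ^ m"
    have q: "?q \<ge> 0" using l by simp
    show "\<bar>\<Sum>n=1..y. real_of_int (moebius_mu n)\<bar> \<le> (B + C * (2 * 2 ^ m)) * ?q"
    proof (cases "real y \<le> sqrt (real x)")
      case True
      have "\<bar>\<Sum>n=1..y. real_of_int (moebius_mu n)\<bar> \<le> sqrt (real x)" using True sum_moebius_trivial[of y] by linarith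
      also have "\<dots> \<le> B * ?q" using B(2)[of "real x"] x9 by simp
      also have "\<dots> \<le> (B + C * (2 * 2 ^ m)) * ?q" using C q by (intro mult_right_mono) auto
      finally show ?thesis .
    next
      case False
      hence "N0 \<le> y" using s by linarith
      hence "\<bar>\<Sum>n=1..y. real_of_int (moebius_mu n)\<bar> \<le> C * (real y / ln (real y) ^ m)" by (rule C(3))
      also have "\<dots> \<le> C * (2 * real x / (ln (real x) / 2) ^ m)"
      proof (intro mult_left_mono frac_le power_mono C(1))
        have "ln (real x) / 2 = ln (sqrt (real x))" using x9 by (simp add: ln_sqrt)
        also have "\<dots> \<le> ln (real y)"
        proof (subst ln_le_cancel_iff)
          show "real y > 0" using False real_sqrt_ge_zero[of "real x"] by linarith
        qed (use False x9 in auto)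
        finally show "ln (real x) / 2 \<le> ln (real y)" .
        show "real y \<le> 2 * real x" using y by linarith
      qed (use l in auto)
      also have "\<dots> = C * (2 * 2 ^ m) * ?q" by (simp add: power_divide)
      also have "\<dots> \<le> (B + C * (2 * 2 ^ m)) * ?q" using B q by (intro mult_right_mono) auto
      finally show ?thesis .
    qed
  qed
qed

section \<open>The correlation sum\<close>

lemma moebius_correlation_eq:
  "(\<Sum>t=1..x. \<Sum>n=1..x. real_of_int (moebius_mu n * moebius_mu (n + t))) =
   (\<Sum>n=1..x. real_of_int (moebius_mu n) *
      ((\<Sum>k=1..n+x. real_of_int (moebius_mu k)) - (\<Sum>k=1..n. real_of_int (moebius_mu k))))"
proof -
  have "(\<Sum>k=1..n+x. real_of_int (moebius_mu k)) - (\<Sum>k=1..n. real_of_int (moebius_mu k)) =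
     (\<Sum>t=1..x. real_of_int (moebius_mu (n + t)))" for n
    by (induction x) auto
  thus ?thesis by (subst sum.swap) (simp add: sum_distrib_left)
qed

theorem theorem1p1:
  fixes c :: real
  assumes "c > 0"
  shows "(\<lambda>x::nat. 1 / real x *
            (\<Sum>t = 1..x. \<Sum>n = 1..x. real_of_int (moebius_mu n * moebius_mu (n + t))))
          \<in> O[at_top](\<lambda>x::nat. real x / ln (real x) powr (2 * c))"
proof -
  define m where "m = nat \<lceil>2 * c\<rceil>"
  have m: "2 * c \<le> real m" unfolding m_def by (rule real_nat_ceiling_ge)
  obtain C x0 where C: "C \<ge> 0" "x0 \<ge> (3::nat)"
    "\<And>x y. x \<ge> x0 \<Longrightarrow> y \<le> 2 * x \<Longrightarrow> \<bar>\<Sum>n=1..y. real_of_int (moebius_mu n)\<bar> \<le> C * (real x / ln (real x) ^ m)"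
    using moebius_sum_uniform_bound[of m] by blast
  show ?thesis
  proof (rule bigoI[where c = "2 * C"], rule eventually_at_top_linorderI[of x0])
    fix x assume x: "x \<ge> x0"
    have x3: "real x \<ge> 3" using x C(2) by simp
    \<comment> \<open>The exponent m is 2 c rounded up; with ln x \<ge> 1, which follows from x
      \<ge> 3 \<ge> e, the larger exponent gives the stronger bound.\<close>
    have l: "ln (real x) \<ge> 1"
      using x3 exp_le by (subst ln_ge_iff) auto
    define M where "M y = (\<Sum>n=1..y. real_of_int (moebius_mu n))" for y
    let ?q = "real x / ln (real x) ^ m"
    have M: "\<bar>M y\<bar> \<le> C * ?q" if "y \<le> 2 * x" for y unfolding M_def using x that by (rule C(3))
    let ?S = "\<Sum>t = 1..x. \<Sum>n = 1..x. real_of_int (moebius_mu n * moebius_mu (n + t))"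
    have "\<bar>?S\<bar> \<le> (\<Sum>n=1..x. \<bar>real_of_int (moebius_mu n) * (M (n + x) - M n)\<bar>)"
      unfolding moebius_correlation_eq M_def by (rule sum_abs)
    also have "\<dots> \<le> (\<Sum>n=1..x. 1 * (C * ?q + C * ?q))"
    proof (intro sum_mono)
      fix n assume n: "n \<in> {1..x}"
      have "\<bar>M (n + x) - M n\<bar> \<le> C * ?q + C * ?q"
        using M[of "n + x"] M[of n] n by (simp add: abs_le_iff)
      moreover have "\<bar>real_of_int (moebius_mu n)\<bar> \<le> 1"
        using abs_moebius_mu_le[of n] by (metis of_int_abs of_int_le_1_iff)
      ultimately show "\<bar>real_of_int (moebius_mu n) * (M (n + x) - M n)\<bar> \<le> 1 * (C * ?q + C * ?q)"
        unfolding abs_mult by (intro mult_mono) auto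
    qed
    also have "\<dots> = real x * (2 * C * ?q)" by simp
    finally have "1 / real x * \<bar>?S\<bar> \<le> 1 / real x * (real x * (2 * C * ?q))" by (intro mult_left_mono) auto
    also have "\<dots> = 2 * C * ?q" using x3 by simp
    also have "\<dots> \<le> 2 * C * (real x / ln (real x) powr (2 * c))"
    proof (intro mult_left_mono divide_left_mono)
      have "ln (real x) powr (2 * c) \<le> ln (real x) powr real m" using l m by (intro powr_mono) auto
      also have "\<dots> = ln (real x) ^ m" using l by (intro powr_realpow) auto
      finally show "ln (real x) powr (2 * c) \<le> ln (real x) ^ m" .
    qed (use l C x3 in auto)
    finally show "norm (1 / real x * ?S) \<le> 2 * C * norm (real x / ln (real x) powr (2 * c))"
      by (simp add: abs_mult)
  qed
qed

end
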